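(* Let $\mathfrak M$, $\mathfrak C$ and $\mathfrak S$ be the classes of all functions on $\mathbb C_+$ that are Weyl–Titchmarsh functions, Livšic functions, and characteristic functions, respectively. Then: (i) the class $\mathfrak M$ is a convex set with respect to addition; (ii) the class $\mathfrak S$ is closed under multiplication, $\mathfrak S\cdot\mathfrak S\subset\mathfrak S$; (iii) the subclass $\mathfrak C\subset\mathfrak S$ is a (double sided) ideal under multiplication in the sense that $\mathfrak C\cdot\mathfrak S=\mathfrak S\cdot\mathfrak C\subset\mathfrak C$; (iv) the class $\mathfrak C$ is closed under multiplication, $\mathfrak C\cdot\mathfrak C\subset\mathfrak C$.
   Context: $\mathbb C_+$ is the open upper half-plane; products of classes are sets of pointwise products of functions. Inner products are linear in the first argument. Let $\dot A$ be a densely defined symmetric operator with deficiency indices $(1,1)$ in a Hilbert space, $A$ a self-adjoint extension of $\dot A$, and $g_\pm\in\operatorname{Ker}((\dot A)^*\mp iI)$ with $\|g_\pm\|=1$ and $g_+-g_-\in\operatorname{Dom}(A)$. The Livšic function of the pair $(\dot A,A)$ is $s(\dot A,A)(z)=\frac{z-i}{z+i}\cdot\frac{(g_z,g_-)}{(g_z,g_+)}$, $z\in\mathbb C_+$, where $g_z$ is an arbitrary nonzero element of $\operatorname{Ker}((\dot A)^*-zI)$. $\mathfrak C$ is the class of all analytic mappings from $\mathbb C_+$ into the open unit disk that are equal to $s(\dot A,A)$ for some such pair $(\dot A,A)$. The Weyl–Titchmarsh function of the pair $(\dot A,A)$ is $M(\dot A,A)(z)=\left((zA+I)(A-zI)^{-1}g_+,g_+\right)$,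 $z\in\mathbb C_+$. $\mathfrak M$ is the class of all analytic mappings from $\mathbb C_+$ into itself that are equal to $M(\dot A,A)$ for some such pair $(\dot A,A)$. $\mathfrak D$ is the set of all maximal dissipative unbounded operators $\widehat A$ (dissipative: $\operatorname{Im}(\widehat Af,f)\ge0$ on $\operatorname{Dom}(\widehat A)$) such that $\dot A=\widehat A|_{\operatorname{Dom}(\widehat A)\cap\operatorname{Dom}((\widehat A)^* )}$ is a densely defined symmetric operator with deficiency indices $(1,1)$. For $\widehat A\in\mathfrak D$ and a self-adjoint extension $A$ of $\dot A$, with $g_\pm\in\operatorname{Ker}((\dot A)^*\mp iI)$ chosen so that $\|g_\pm\|=1$ and $g_+-g_-\in\operatorname{Dom}(A)$, the von Neumann extension parameter $\kappa=\kappa(\widehat A,A)$ is the number with $|\kappa|<1$ and $g_+-\kappa g_-\in\operatorname{Dom}(\widehat A)$, and the characteristic function of $\widehat A$ relative to $A$ is $S(\widehat A,A)(z)=\frac{s(z)-\kappa}{\overline\kappa\, s(z)-1}$, $z\in\mathbb C_+$, with $s=s(\dot A,A)$. $\mathfrak S$ is the class of all functions $S(\widehat A,A)$ arising from arbitrary such pairs $(\widehat A,A)$, $\widehat A\in\mathfrak D$. *)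

theory Defs
  imports
    "HOL-Complex_Analysis.Complex_Analysis"
    "HOL-Algebra.Algebraic_Closure_Type"
    "HOL-Library.Set_Algebras"
    "HOL-Library.Function_Algebras"
begin

section \<open>Complex Hilbert spaces\<close>

text \<open>
  Hilbert spaces are carrier based, so that "there is a Hilbert space such that ..." can be
  expressed inside the logic. The fields \<open>mult\<close> and \<open>one\<close> inherited from the module record
  carry no information. Inner products are linear in the first argument.
\<close>

record 'a ip_space = "(complex, 'a) module" +
  ip :: "'a \<Rightarrow> 'a \<Rightarrow> complex"

definition hnorm :: "'a ip_space \<Rightarrow> 'a \<Rightarrow> real" where
  "hnorm H x = sqrt (Re (ip H x x))"

text \<open>The value off the carrier only serves to meet the requirements of \<^locale>\<open>Metric_space\<close>.\<close>

definition hdist :: "'a ip_space \<Rightarrow> 'a \<Rightarrow> 'a \<Rightarrow> real" where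
  "hdist H x y = (if x \<in> carrier H \<and> y \<in> carrier H then hnorm H (x \<ominus>\<^bsub>H\<^esub> y) else 0)"

locale hilbert_space =
  module "ring_of_type_algebra :: complex ring" H for H :: "'a ip_space" (structure) +
  assumes ip_add_left: "\<lbrakk>x \<in> carrier H; y \<in> carrier H; w \<in> carrier H\<rbrakk>
      \<Longrightarrow> ip H (x \<oplus> y) w = ip H x w + ip H y w"
    and ip_smult_left: "\<lbrakk>x \<in> carrier H; w \<in> carrier H\<rbrakk> \<Longrightarrow> ip H (c \<odot> x) w = c * ip H x w"
    and ip_commute: "\<lbrakk>x \<in> carrier H; w \<in> carrier H\<rbrakk> \<Longrightarrow> ip H x w = cnj (ip H w x)"
    and ip_nonneg: "x \<in> carrier H \<Longrightarrow> 0 \<le> Re (ip H x x)"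
    and ip_definite: "\<lbrakk>x \<in> carrier H; ip H x x = 0\<rbrakk> \<Longrightarrow> x = \<zero>"
    and complete: "Metric_space.mcomplete (carrier H) (hdist H)"

definition hdense :: "'a ip_space \<Rightarrow> 'a set \<Rightarrow> bool" where
  "hdense H D \<longleftrightarrow> Metric_space.mtopology (carrier H) (hdist H) closure_of D = carrier H"

definition one_dimensional :: "'a ip_space \<Rightarrow> 'a set \<Rightarrow> bool" where
  "one_dimensional H N \<longleftrightarrow>
     (\<exists>e \<in> carrier H. e \<noteq> \<zero>\<^bsub>H\<^esub> \<and> N = {c \<odot>\<^bsub>H\<^esub> e | c :: complex. True})"

section \<open>Unbounded linear operators\<close>

text \<open>
  An operator is identified with its graph \<open>T\<close>: its domain is \<^term>\<open>Domain T\<close>, and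
  \<open>T \<subseteq> B\<close> says that \<open>B\<close> extends \<open>T\<close>.
\<close>

definition linear_operator :: "'a ip_space \<Rightarrow> ('a \<times> 'a) set \<Rightarrow> bool" where
  "linear_operator H T \<longleftrightarrow>
     T \<subseteq> carrier H \<times> carrier H \<and> single_valued T \<and>
     (\<zero>\<^bsub>H\<^esub>, \<zero>\<^bsub>H\<^esub>) \<in> T \<and>
     (\<forall>u v u' v'. (u, v) \<in> T \<longrightarrow> (u', v') \<in> T \<longrightarrow> (u \<oplus>\<^bsub>H\<^esub> u', v \<oplus>\<^bsub>H\<^esub> v') \<in> T) \<and>
     (\<forall>c u v. (u, v) \<in> T \<longrightarrow> (c \<odot>\<^bsub>H\<^esub> u, c \<odot>\<^bsub>H\<^esub> v) \<in> T)"

definition op_app :: "('a \<times> 'a) set \<Rightarrow> 'a \<Rightarrow> 'a" where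
  "op_app T f = (THE h. (f, h) \<in> T)"

definition densely_defined :: "'a ip_space \<Rightarrow> ('a \<times> 'a) set \<Rightarrow> bool" where
  "densely_defined H T \<longleftrightarrow> hdense H (Domain T)"

definition bounded_operator :: "'a ip_space \<Rightarrow> ('a \<times> 'a) set \<Rightarrow> bool" where
  "bounded_operator H T \<longleftrightarrow> (\<exists>C. \<forall>(f, h) \<in> T. hnorm H h \<le> C * hnorm H f)"

text \<open>The graph of the adjoint; it is an operator whenever \<open>T\<close> is densely defined.\<close>

definition adjoint_op :: "'a ip_space \<Rightarrow> ('a \<times> 'a) set \<Rightarrow> ('a \<times> 'a) set" where
  "adjoint_op H T =
     {(f, h). f \<in> carrier H \<and> h \<in> carrier H \<and> (\<forall>(u, v) \<in> T. ip H v f = ip H u h)}"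

definition symmetric_op :: "'a ip_space \<Rightarrow> ('a \<times> 'a) set \<Rightarrow> bool" where
  "symmetric_op H T \<longleftrightarrow>
     linear_operator H T \<and> (\<forall>(u, v) \<in> T. \<forall>(u', v') \<in> T. ip H v u' = ip H u v')"

definition self_adjoint_op :: "'a ip_space \<Rightarrow> ('a \<times> 'a) set \<Rightarrow> bool" where
  "self_adjoint_op H T \<longleftrightarrow>
     linear_operator H T \<and> densely_defined H T \<and> adjoint_op H T = T"

text \<open>\<open>Ker (T* - z I)\<close>\<close>

definition deficiency_space :: "'a ip_space \<Rightarrow> ('a \<times> 'a) set \<Rightarrow> complex \<Rightarrow> 'a set" where
  "deficiency_space H T z = {f \<in> carrier H. (f, z \<odot>\<^bsub>H\<^esub> f) \<in> adjoint_op H T}"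

definition symmetric_11 :: "'a ip_space \<Rightarrow> ('a \<times> 'a) set \<Rightarrow> bool" where
  "symmetric_11 H T \<longleftrightarrow>
     symmetric_op H T \<and> densely_defined H T \<and>
     one_dimensional H (deficiency_space H T \<i>) \<and>
     one_dimensional H (deficiency_space H T (- \<i>))"

definition dissipative_op :: "'a ip_space \<Rightarrow> ('a \<times> 'a) set \<Rightarrow> bool" where
  "dissipative_op H T \<longleftrightarrow> linear_operator H T \<and> (\<forall>(f, h) \<in> T. 0 \<le> Im (ip H h f))"

definition maximal_dissipative_op :: "'a ip_space \<Rightarrow> ('a \<times> 'a) set \<Rightarrow> bool" where
  "maximal_dissipative_op H T \<longleftrightarrow>
     dissipative_op H T \<and> (\<forall>B. dissipative_op H B \<longrightarrow> T \<subseteq> B \<longrightarrow> B = T)"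

section \<open>Livsic, Weyl-Titchmarsh and characteristic functions\<close>

text \<open>
  The standing setting: \<open>A0\<close> is the symmetric operator, \<open>A\<close> the self-adjoint reference
  extension and \<open>gp\<close>, \<open>gm\<close> are the deficiency elements \<open>g\<^sub>+\<close>, \<open>g\<^sub>-\<close>.
\<close>

definition reference_setting ::
    "'a ip_space \<Rightarrow> ('a \<times> 'a) set \<Rightarrow> ('a \<times> 'a) set \<Rightarrow> 'a \<Rightarrow> 'a \<Rightarrow> bool" where
  "reference_setting H A0 A gp gm \<longleftrightarrow>
     hilbert_space H \<and> symmetric_11 H A0 \<and> self_adjoint_op H A \<and> A0 \<subseteq> A \<and>
     gp \<in> deficiency_space H A0 \<i> \<and> gm \<in> deficiency_space H A0 (- \<i>) \<and>
     hnorm H gp = 1 \<and> hnorm H gm = 1 \<and> gp \<ominus>\<^bsub>H\<^esub> gm \<in> Domain A"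

definition upper_half_plane :: "complex set" where
  "upper_half_plane = {z. 0 < Im z}"

text \<open>\<open>SOME\<close> is the choice of an arbitrary nonzero \<open>g\<^sub>z\<close>.\<close>

definition livsic_function ::
    "'a ip_space \<Rightarrow> ('a \<times> 'a) set \<Rightarrow> 'a \<Rightarrow> 'a \<Rightarrow> complex \<Rightarrow> complex" where
  "livsic_function H A0 gp gm z =
     (let gz = (SOME f. f \<in> deficiency_space H A0 z \<and> f \<noteq> \<zero>\<^bsub>H\<^esub>)
      in (z - \<i>) / (z + \<i>) * (ip H gz gm / ip H gz gp))"

definition resolvent :: "'a ip_space \<Rightarrow> ('a \<times> 'a) set \<Rightarrow> complex \<Rightarrow> 'a \<Rightarrow> 'a" where
  "resolvent H A z g = (THE f. f \<in> Domain A \<and> op_app A f \<ominus>\<^bsub>H\<^esub> z \<odot>\<^bsub>H\<^esub> f = g)"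

definition weyl_titchmarsh_function ::
    "'a ip_space \<Rightarrow> ('a \<times> 'a) set \<Rightarrow> 'a \<Rightarrow> complex \<Rightarrow> complex" where
  "weyl_titchmarsh_function H A gp z =
     (let f = resolvent H A z gp in ip H (z \<odot>\<^bsub>H\<^esub> op_app A f \<oplus>\<^bsub>H\<^esub> f) gp)"

text \<open>The symmetric part of \<open>T\<close>: its restriction to \<open>Dom T \<inter> Dom T*\<close>.\<close>

definition symmetric_part :: "'a ip_space \<Rightarrow> ('a \<times> 'a) set \<Rightarrow> ('a \<times> 'a) set" where
  "symmetric_part H T = {(f, h) \<in> T. f \<in> Domain (adjoint_op H T)}"

definition dissipative_class :: "'a ip_space \<Rightarrow> ('a \<times> 'a) set set" where
  "dissipative_class H =
     {T. maximal_dissipative_op H T \<and> \<not> bounded_operator H T \<and>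
         symmetric_11 H (symmetric_part H T)}"

definition is_von_neumann_parameter ::
    "'a ip_space \<Rightarrow> ('a \<times> 'a) set \<Rightarrow> 'a \<Rightarrow> 'a \<Rightarrow> complex \<Rightarrow> bool" where
  "is_von_neumann_parameter H T gp gm \<kappa> \<longleftrightarrow>
     cmod \<kappa> < 1 \<and> gp \<ominus>\<^bsub>H\<^esub> \<kappa> \<odot>\<^bsub>H\<^esub> gm \<in> Domain T"

definition characteristic_function ::
    "'a ip_space \<Rightarrow> ('a \<times> 'a) set \<Rightarrow> 'a \<Rightarrow> 'a \<Rightarrow> complex \<Rightarrow> complex" where
  "characteristic_function H T gp gm z =
     (let s = livsic_function H (symmetric_part H T) gp gm z;
          \<kappa> = (THE k. is_von_neumann_parameter H T gp gm k)
      in (s - \<kappa>) / (cnj \<kappa> * s - 1))"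

section \<open>The three classes\<close>

text \<open>
  A function on the upper half-plane is represented by any function on the complex numbers that
  agrees with it there; the values elsewhere are irrelevant. The type argument \<open>'a\<close> is the universe in
  which the carriers of the Hilbert spaces live, as one cannot quantify over all types at once:
  the Hilbert spaces taken into account are, up to isomorphism, all those of cardinality at most
  that of \<open>'a\<close>.
\<close>

definition livsic_class :: "'a itself \<Rightarrow> (complex \<Rightarrow> complex) set" where
  "livsic_class _ =
     {s. s holomorphic_on upper_half_plane \<and> s ` upper_half_plane \<subseteq> ball 0 1 \<and>
         (\<exists>(H :: 'a ip_space) A0 A gp gm. reference_setting H A0 A gp gm \<and>
            (\<forall>z \<in> upper_half_plane. s z = livsic_function H A0 gp gm z))}"

definition weyl_titchmarsh_class :: "'a itself \<Rightarrow> (complex \<Rightarrow> complex) set" where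
  "weyl_titchmarsh_class _ =
     {m. m holomorphic_on upper_half_plane \<and> m ` upper_half_plane \<subseteq> upper_half_plane \<and>
         (\<exists>(H :: 'a ip_space) A0 A gp gm. reference_setting H A0 A gp gm \<and>
            (\<forall>z \<in> upper_half_plane. m z = weyl_titchmarsh_function H A gp z))}"

definition characteristic_class :: "'a itself \<Rightarrow> (complex \<Rightarrow> complex) set" where
  "characteristic_class _ =
     {S. \<exists>(H :: 'a ip_space) T A gp gm.
            T \<in> dissipative_class H \<and> reference_setting H (symmetric_part H T) A gp gm \<and>
            (\<forall>z \<in> upper_half_plane. S z = characteristic_function H T gp gm z)}"

end

theory Submission
  imports Defs
begin

text \<open>
  A pair \<open>(A\<^sub>0, A)\<close> with the unit vector \<open>g\<^sub>+\<close> is encoded in the Cayley transform \<open>U = (A - i) (A + i)\<^sup>-\<^sup>1\<close>: one has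
  \<open>g\<^sub>- = U g\<^sub>+\<close>, and up to closure \<open>A\<^sub>0\<close> is the restriction of \<open>A\<close> to \<open>{h - U h | h \<bottom> g\<^sub>+}\<close>. Conversely, a unitary
  operator with a unit vector comes from a pair if that domain is dense, which means that \<open>U* x - x\<close> is
  a multiple of \<open>g\<^sub>+\<close> for \<open>x = 0\<close> only (\<open>unitary_model\<close>). For \<open>\<zeta> = (z - i) / (z + i)\<close> and
  \<open>p = ((1 - \<zeta> U*)\<^sup>-\<^sup>1 g\<^sub>+, g\<^sub>+)\<close> the Weyl-Titchmarsh function is \<open>i (2 p - 1)\<close> and the Livsic function is
  \<open>s = 1 - 1 / p\<close>. The operators of the dissipative class with symmetric part \<open>A\<^sub>0\<close> are the inverse
  Cayley transforms of the contractions that agree with \<open>U\<close> on the orthogonal complement of \<open>g\<^sub>+\<close> and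
  map \<open>g\<^sub>+\<close> to \<open>\<kappa> g\<^sub>-\<close>, with \<open>|\<kappa>| < 1\<close>. Therefore the three classes are described by unitary
  models alone (\<open>weyl_titchmarsh_class_iff\<close>, \<open>livsic_class_iff\<close>, \<open>characteristic_class_iff\<close>).

  The first claim is then seen in the orthogonal sum of two models, where the vector with components
  \<open>sqrt t g\<^sub>1\<close> and \<open>sqrt (1 - t) g\<^sub>2\<close> has the convex combination of the two functions \<open>p\<close> as its own \<open>p\<close>.

  For the claims on products, a model together with \<open>\<kappa>\<close> is turned into a unitary operator on \<open>H \<oplus> \<complex>\<close>
  that has no stationary state and whose transfer function is the characteristic function. This
  construction can be reversed, \<open>\<kappa>\<close> being the value of the transfer function at \<open>i\<close>. So the characteristic
  functions are exactly the transfer functions \<open>S\<close> of such operators with \<open>|S(i)| < 1\<close>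
  (\<open>characteristic_class_iff_realizes\<close>). Connecting the output of one operator to the input of another
  multiplies the transfer functions, and the cascade visibly has no stationary state; hence the
  characteristic class is closed under multiplication. The Livsic functions are the characteristic
  functions that vanish at \<open>i\<close> (\<open>livsic_class_iff_characteristic\<close>), and such functions form an ideal.

  All sums of Hilbert spaces are formed inside the type of the summands. This is possible because
  a type that carries a nonzero complex Hilbert space is infinite, so that it contains a copy of
  the set of its pairs.
\<close>

section \<open>Geometry of a Hilbert space given by its carrier\<close>

text \<open>
  The variational argument behind perpendiculars: a quadratic polynomial in \<open>c\<close> that is nonnegative
  and has no constant term has no linear term either.
\<close>

lemma quadratic_form_vanishes:
  fixes a :: complex and n :: real
  assumes ge: "\<And>c. 0 \<le> 2 * Re (c * a) + (cmod c)\<^sup>2 * n"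
  shows "a = 0"
proof (rule ccontr)
  assume ne: "a \<noteq> 0"
  (* at c = - t * cnj a the right-hand side is t * |a|^2 * (t * n - 2) *)
  define t where "t = 1 / (\<bar>n\<bar> + 1)"
  have t: "t > 0" by (simp add: t_def add_nonneg_pos)
  have "t * n \<le> t * \<bar>n\<bar>" using t by simp
  also have "\<dots> \<le> 1" by (simp add: t_def)
  finally have tn: "t * n \<le> 1" .
  have "0 \<le> 2 * Re ((- of_real t * cnj a) * a) + (cmod (- of_real t * cnj a))\<^sup>2 * n"
    by (rule ge)
  also have "cmod (- of_real t * cnj a) = t * cmod a"
    using t by (simp add: norm_mult)
  also have "Re ((- of_real t * cnj a) * a) = - t * (cmod a)\<^sup>2"
    by (simp add: cmod_power2) (simp add: power2_eq_square algebra_simps)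
  also have "2 * (- t * (cmod a)\<^sup>2) + (t * cmod a)\<^sup>2 * n = (t * (cmod a)\<^sup>2) * (t * n - 2)"
    by (simp add: power2_eq_square algebra_simps)
  finally have "0 \<le> (t * (cmod a)\<^sup>2) * (t * n - 2)" .
  moreover have "0 < t * (cmod a)\<^sup>2"
    using t ne by simp
  ultimately have "0 \<le> t * n - 2"
    by (meson zero_le_mult_iff not_less)
  then show False using tn by simp
qed

context hilbert_space
begin

lemma smult_in_carrier [simp, intro]: "x \<in> carrier H \<Longrightarrow> c \<odot> x \<in> carrier H"
  by (rule smult_closed) (auto simp: ring_of_type_algebra_def)

lemma minus_in_carrier [simp, intro]: "\<lbrakk>x \<in> carrier H; y \<in> carrier H\<rbrakk> \<Longrightarrow> x \<ominus> y \<in> carrier H"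
  by (simp add: M.minus_closed)

lemma minus_add_cancel: "\<lbrakk>x \<in> carrier H; y \<in> carrier H\<rbrakk> \<Longrightarrow> (x \<ominus> y) \<oplus> y = x"
  unfolding a_minus_def
  using M.a_assoc[of x "\<ominus> y" y] M.l_neg[of y] M.r_zero[of x] M.a_inv_closed[of y] by metis

lemma ip_zero_left: "w \<in> carrier H \<Longrightarrow> ip H \<zero> w = 0"
  using ip_add_left[of \<zero> \<zero> w] by simp

lemma ip_minus_left:
  assumes "x \<in> carrier H" "y \<in> carrier H" "w \<in> carrier H"
  shows "ip H (x \<ominus> y) w = ip H x w - ip H y w"
  using ip_add_left[of "x \<ominus> y" y w] minus_add_cancel[of x y] assms by simp

lemma ip_add_right:
  assumes "x \<in> carrier H" "y \<in> carrier H" "w \<in> carrier H"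
  shows "ip H w (x \<oplus> y) = ip H w x + ip H w y"
  using assms ip_commute[of w] by (simp add: ip_add_left)

lemma ip_minus_right:
  assumes "x \<in> carrier H" "y \<in> carrier H" "w \<in> carrier H"
  shows "ip H w (x \<ominus> y) = ip H w x - ip H w y"
  using assms ip_commute[of w] by (simp add: ip_minus_left)

lemma ip_smult_right:
  assumes "x \<in> carrier H" "w \<in> carrier H"
  shows "ip H w (c \<odot> x) = cnj c * ip H w x"
  using assms ip_commute[of w] by (simp add: ip_smult_left)

lemma ip_zero_right: "w \<in> carrier H \<Longrightarrow> ip H w \<zero> = 0"
  using ip_commute[of w] by (simp add: ip_zero_left)

lemmas ip_simps = ip_add_left ip_add_right ip_minus_left ip_minus_right
  ip_smult_left ip_smult_right ip_zero_left ip_zero_right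

lemma minus_eq_zeroD:
  assumes "x \<ominus> y = \<zero>" "x \<in> carrier H" "y \<in> carrier H"
  shows "x = y"
  using minus_add_cancel[of x y] assms by simp

text \<open>
  Vectors are compared through their inner products with all other vectors. This turns every
  identity between linear combinations into one between complex numbers, where the arithmetic of
  the simplifier applies.
\<close>

lemma ip_eqI:
  assumes "x \<in> carrier H" "y \<in> carrier H" "\<And>w. w \<in> carrier H \<Longrightarrow> ip H x w = ip H y w"
  shows "x = y"
proof -
  have "ip H (x \<ominus> y) (x \<ominus> y) = 0"
    using assms by (simp add: ip_minus_left)
  then have "x \<ominus> y = \<zero>"
    using assms by (intro ip_definite) auto
  then show ?thesis
    by (rule minus_eq_zeroD[OF _ assms(1,2)])
qed

lemma minus_self: "x \<in> carrier H \<Longrightarrow> x \<ominus> x = \<zero>"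
  by (rule ip_eqI) (auto simp: ip_simps)

lemma smult_zero_left [simp]: "x \<in> carrier H \<Longrightarrow> 0 \<odot> x = \<zero>"
  by (rule ip_eqI) (auto simp: ip_simps)

lemma smult_zero_right [simp]: "c \<odot> \<zero> = \<zero>"
  by (rule ip_eqI) (auto simp: ip_simps)

lemma smult_1 [simp]: "x \<in> carrier H \<Longrightarrow> 1 \<odot> x = x"
  by (rule ip_eqI) (auto simp: ip_simps)

lemma smult_smult: "x \<in> carrier H \<Longrightarrow> a \<odot> (b \<odot> x) = (a * b) \<odot> x"
  by (rule ip_eqI) (auto simp: ip_simps)

lemma ip_self: "x \<in> carrier H \<Longrightarrow> ip H x x = of_real ((hnorm H x)\<^sup>2)"
  using ip_commute[of x x] ip_nonneg[of x]
  by (auto simp: hnorm_def complex_eq_iff)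

lemma hnorm_nonneg [simp]: "0 \<le> hnorm H x"
  if "x \<in> carrier H"
  using ip_nonneg[OF that] by (simp add: hnorm_def)

lemma hnorm_eq_0 [simp]: "x \<in> carrier H \<Longrightarrow> hnorm H x = 0 \<longleftrightarrow> x = \<zero>"
  using ip_definite[of x] by (auto simp: ip_self) (simp add: hnorm_def ip_zero_left)

lemma hnorm_zero [simp]: "hnorm H \<zero> = 0"
  by simp

lemma hnorm_squared: "x \<in> carrier H \<Longrightarrow> (hnorm H x)\<^sup>2 = Re (ip H x x)"
  by (simp add: ip_self)

lemma hnorm_smult:
  assumes x: "x \<in> carrier H"
  shows "hnorm H (c \<odot> x) = cmod c * hnorm H x"
proof -
  have "ip H (c \<odot> x) (c \<odot> x) = of_real ((cmod c)\<^sup>2) * ip H x x"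
    unfolding complex_norm_square using x by (simp add: ip_simps)
  then have "(hnorm H (c \<odot> x))\<^sup>2 = (cmod c * hnorm H x)\<^sup>2"
    using x unfolding hnorm_squared[OF smult_in_carrier[OF x]] power_mult_distrib hnorm_squared[OF x]
    by simp
  then show ?thesis
    using x by (simp add: power2_eq_iff_nonneg)
qed

lemma hnorm_minus_swap: "\<lbrakk>x \<in> carrier H; y \<in> carrier H\<rbrakk> \<Longrightarrow> hnorm H (x \<ominus> y) = hnorm H (y \<ominus> x)"
  by (simp add: hnorm_def ip_simps algebra_simps)

lemma hnorm_add_squared:
  assumes "x \<in> carrier H" "y \<in> carrier H"
  shows "(hnorm H (x \<oplus> y))\<^sup>2 = (hnorm H x)\<^sup>2 + 2 * Re (ip H x y) + (hnorm H y)\<^sup>2"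
  using assms ip_commute[of y x] by (simp add: hnorm_squared ip_simps)

lemma hnorm_minus_squared:
  assumes "x \<in> carrier H" "y \<in> carrier H"
  shows "(hnorm H (x \<ominus> y))\<^sup>2 = (hnorm H x)\<^sup>2 - 2 * Re (ip H x y) + (hnorm H y)\<^sup>2"
proof -
  have "x \<ominus> y = x \<oplus> (-1) \<odot> y"
    using assms by (intro ip_eqI) (auto simp: ip_simps)
  then show ?thesis
    using assms by (simp add: hnorm_add_squared ip_simps hnorm_smult)
qed

lemma Cauchy_Schwarz:
  assumes x: "x \<in> carrier H" and y: "y \<in> carrier H"
  shows "cmod (ip H x y) \<le> hnorm H x * hnorm H y"
proof (cases "y = \<zero>")
  case True
  then show ?thesis using x by (simp add: ip_zero_right)
next
  case False
  define n where "n = (hnorm H y)\<^sup>2"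
  have n: "n > 0" using False y by (simp add: n_def)
  have "0 \<le> (hnorm H (of_real n \<odot> x \<ominus> ip H x y \<odot> y))\<^sup>2" by simp
  also have "\<dots> = n\<^sup>2 * (hnorm H x)\<^sup>2 - 2 * (n * (cmod (ip H x y))\<^sup>2) + (cmod (ip H x y))\<^sup>2 * n"
  proof -
    have "Re (ip H (of_real n \<odot> x) (ip H x y \<odot> y)) = n * (cmod (ip H x y))\<^sup>2"
      using x y by (simp add: ip_simps cmod_power2) (simp add: power2_eq_square algebra_simps)
    then show ?thesis
      using x y n by (simp add: hnorm_minus_squared hnorm_smult power_mult_distrib flip: n_def)
  qed
  also have "\<dots> = n * (n * (hnorm H x)\<^sup>2 - (cmod (ip H x y))\<^sup>2)"
    by (simp add: power2_eq_square algebra_simps)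
  finally have "(cmod (ip H x y))\<^sup>2 \<le> n * (hnorm H x)\<^sup>2"
    using n by (simp add: zero_le_mult_iff)
  then have "(cmod (ip H x y))\<^sup>2 \<le> (hnorm H x * hnorm H y)\<^sup>2"
    by (simp add: n_def power_mult_distrib mult.commute)
  then show ?thesis
    using x y by (meson power2_le_imp_le mult_nonneg_nonneg hnorm_nonneg)
qed

lemma hnorm_triangle:
  assumes x: "x \<in> carrier H" and y: "y \<in> carrier H"
  shows "hnorm H (x \<oplus> y) \<le> hnorm H x + hnorm H y"
proof (rule power2_le_imp_le)
  have "Re (ip H x y) \<le> hnorm H x * hnorm H y"
    using Cauchy_Schwarz[OF x y] complex_Re_le_cmod[of "ip H x y"] by linarith
  then show "(hnorm H (x \<oplus> y))\<^sup>2 \<le> (hnorm H x + hnorm H y)\<^sup>2"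
    using x y by (simp add: hnorm_add_squared power2_sum)
qed (use assms in simp)

lemma hnorm_triangle_minus:
  assumes x: "x \<in> carrier H" and y: "y \<in> carrier H" and z: "z \<in> carrier H"
  shows "hnorm H (x \<ominus> z) \<le> hnorm H (x \<ominus> y) + hnorm H (y \<ominus> z)"
proof -
  have "x \<ominus> z = (x \<ominus> y) \<oplus> (y \<ominus> z)"
    using assms by (intro ip_eqI) (auto simp: ip_simps)
  then show ?thesis
    using hnorm_triangle[of "x \<ominus> y" "y \<ominus> z"] assms by simp
qed

lemma Metric_space_hdist: "Metric_space (carrier H) (hdist H)"
proof
  fix x y z
  show "0 \<le> hdist H x y"
    by (simp add: hdist_def)
  show "hdist H x y = hdist H y x"
    by (simp add: hdist_def hnorm_minus_swap)
  show "hdist H x y = 0 \<longleftrightarrow> x = y" if "x \<in> carrier H" "y \<in> carrier H"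
    using that minus_eq_zeroD[of x y] by (auto simp: hdist_def minus_self)
  show "hdist H x z \<le> hdist H x y + hdist H y z"
    if "x \<in> carrier H" "y \<in> carrier H" "z \<in> carrier H"
    using that by (simp add: hdist_def hnorm_triangle_minus)
qed

definition converges_to :: "(nat \<Rightarrow> 'a) \<Rightarrow> 'a \<Rightarrow> bool" where
  "converges_to v x \<longleftrightarrow> (\<lambda>n. hnorm H (v n \<ominus> x)) \<longlonglongrightarrow> 0"

lemma Cauchy_converges:
  assumes v: "\<And>n. v n \<in> carrier H"
    and C: "\<And>\<epsilon>. \<epsilon> > 0 \<Longrightarrow> \<exists>N. \<forall>m\<ge>N. \<forall>n\<ge>N. hnorm H (v m \<ominus> v n) < \<epsilon>"
  shows "\<exists>x \<in> carrier H. converges_to v x"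
proof -
  interpret Metric_space "carrier H" "hdist H" by (rule Metric_space_hdist)
  have "MCauchy v"
    unfolding MCauchy_def using v C by (auto simp: hdist_def)
  then obtain x where x: "limitin mtopology v x sequentially"
    using complete mcomplete_def by blast
  then have "x \<in> carrier H" "(\<lambda>n. hdist H (v n) x) \<longlonglongrightarrow> 0"
    by (auto simp: limitin_metric_dist_null)
  then show ?thesis
    using v by (auto simp: hdist_def converges_to_def)
qed

lemma convergence_transfer:
  assumes v: "\<And>n. v n \<in> carrier H" and w: "\<And>n. w n \<in> carrier H" and x: "x \<in> carrier H"
    and lim: "converges_to v x"
    and le: "\<And>m n. hnorm H (w m \<ominus> w n) \<le> C * hnorm H (v m \<ominus> v n)"
  shows "\<exists>y \<in> carrier H. converges_to w y"
proof (rule Cauchy_converges[OF w])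
  fix e :: real assume e: "e > 0"
  define B where "B = \<bar>C\<bar> + 1"
  have B: "B > 0" "C \<le> B" by (auto simp: B_def)
  define d where "d = e / (2 * B)"
  have d: "d > 0" using e B by (simp add: d_def)
  obtain N where N: "\<And>n. n \<ge> N \<Longrightarrow> hnorm H (v n \<ominus> x) < d"
    using order_tendstoD(2)[OF lim[unfolded converges_to_def] d] by (auto simp: eventually_sequentially)
  have "hnorm H (w m \<ominus> w n) < e" if mn: "m \<ge> N" "n \<ge> N" for m n
  proof -
    have vv: "hnorm H (v m \<ominus> v n) < 2 * d"
      using hnorm_triangle_minus[OF v[of m] x v[of n]] N[OF mn(1)] N[OF mn(2)]
        hnorm_minus_swap[OF x v[of n]] by simp
    have "hnorm H (w m \<ominus> w n) \<le> C * hnorm H (v m \<ominus> v n)" by (rule le)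
    also have "\<dots> \<le> B * hnorm H (v m \<ominus> v n)"
      using v B by (intro mult_right_mono) auto
    also have "\<dots> < B * (2 * d)"
      using vv B by (intro mult_strict_left_mono) auto
    also have "\<dots> = e" using B by (simp add: d_def)
    finally show ?thesis .
  qed
  then show "\<exists>N. \<forall>m\<ge>N. \<forall>n\<ge>N. hnorm H (w m \<ominus> w n) < e" by (intro exI allI impI)
qed

lemma converges_to_ip:
  assumes c: "converges_to v x" and v: "\<And>n. v n \<in> carrier H" and x: "x \<in> carrier H"
    and w: "w \<in> carrier H"
  shows "(\<lambda>n. ip H (v n) w) \<longlonglongrightarrow> ip H x w"
proof (rule LIM_zero_cancel, rule Lim_null_comparison)
  show "\<forall>\<^sub>F n in sequentially. norm (ip H (v n) w - ip H x w) \<le> hnorm H (v n \<ominus> x) * hnorm H w"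
    using Cauchy_Schwarz[of "v _ \<ominus> x" w] v x w by (simp add: ip_simps)
  show "(\<lambda>n. hnorm H (v n \<ominus> x) * hnorm H w) \<longlonglongrightarrow> 0"
    using c by (intro tendsto_mult_left_zero) (simp add: converges_to_def)
qed

lemma hdense_iff:
  assumes D: "D \<subseteq> carrier H"
  shows "hdense H D \<longleftrightarrow> (\<forall>x \<in> carrier H. \<forall>\<epsilon>>0. \<exists>d \<in> D. hnorm H (d \<ominus> x) < \<epsilon>)"
proof -
  interpret Metric_space "carrier H" "hdist H" by (rule Metric_space_hdist)
  have "(\<exists>d \<in> D. d \<in> mball x \<epsilon>) \<longleftrightarrow> (\<exists>d \<in> D. hnorm H (d \<ominus> x) < \<epsilon>)" if "x \<in> carrier H" for x \<epsilon>
    using that D by (intro bex_cong refl) (auto simp: hdist_def hnorm_minus_swap[OF that])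
  then have "(\<forall>x \<in> carrier H. \<forall>\<epsilon>>0. \<exists>d \<in> D. d \<in> mball x \<epsilon>)
      \<longleftrightarrow> (\<forall>x \<in> carrier H. \<forall>\<epsilon>>0. \<exists>d \<in> D. hnorm H (d \<ominus> x) < \<epsilon>)"
    by (intro ball_cong refl) simp
  moreover have "hdense H D \<longleftrightarrow> (\<forall>x \<in> carrier H. \<forall>\<epsilon>>0. \<exists>d \<in> D. d \<in> mball x \<epsilon>)"
    unfolding hdense_def metric_closure_of by blast
  ultimately show ?thesis by simp
qed

lemma hdense_sequence:
  assumes D: "D \<subseteq> carrier H" and "hdense H D" and x: "x \<in> carrier H"
  shows "\<exists>v. (\<forall>n. v n \<in> D) \<and> converges_to v x"
proof -
  have "\<forall>n. \<exists>d \<in> D. hnorm H (d \<ominus> x) < inverse (real (Suc n))"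
    using assms hdense_iff[OF D] by auto
  then obtain v where v: "\<And>n. v n \<in> D" "\<And>n. hnorm H (v n \<ominus> x) < inverse (real (Suc n))"
    by metis
  have "(\<lambda>n. hnorm H (v n \<ominus> x)) \<longlonglongrightarrow> 0"
  proof (rule tendsto_sandwich[OF _ _ tendsto_const LIMSEQ_inverse_real_of_nat])
    show "\<forall>\<^sub>F n in sequentially. 0 \<le> hnorm H (v n \<ominus> x)"
      using v(1) D x by (intro always_eventually allI hnorm_nonneg) auto
    show "\<forall>\<^sub>F n in sequentially. hnorm H (v n \<ominus> x) \<le> inverse (real (Suc n))"
      using v(2) by (simp add: less_imp_le)
  qed
  then show ?thesis
    using v(1) unfolding converges_to_def by blast
qed

lemma hdense_orthogonal:
  assumes "D \<subseteq> carrier H" "hdense H D" "x \<in> carrier H" "\<And>d. d \<in> D \<Longrightarrow> ip H d x = 0"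
  shows "x = \<zero>"
proof -
  obtain v where v: "\<And>n. v n \<in> D" "converges_to v x"
    using hdense_sequence[OF assms(1-3)] by blast
  have "(\<lambda>n. ip H (v n) x) \<longlonglongrightarrow> ip H x x"
    using assms(1,3) v by (intro converges_to_ip) auto
  then have "(\<lambda>n. 0) \<longlonglongrightarrow> ip H x x"
    using assms(4)[OF v(1)] by simp
  then have "ip H x x = 0"
    by (simp add: LIMSEQ_const_iff)
  then show ?thesis
    by (rule ip_definite[OF assms(3)])
qed

definition subspace :: "'a set \<Rightarrow> bool" where
  "subspace D \<longleftrightarrow> D \<subseteq> carrier H \<and> \<zero> \<in> D \<and>
     (\<forall>x \<in> D. \<forall>y \<in> D. x \<oplus> y \<in> D) \<and> (\<forall>c. \<forall>x \<in> D. c \<odot> x \<in> D)"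

text \<open>
  The projection theorem in the form in which it is needed: a minimizing sequence for the distance
  to \<open>x\<close> is Cauchy by the parallelogram law, and its limit \<open>p\<close> is the foot of a perpendicular,
  so that \<open>x - p\<close> vanishes.
\<close>

lemma subspace_hdenseI:
  assumes D: "subspace D"
    and perp: "\<And>x. \<lbrakk>x \<in> carrier H; \<And>d. d \<in> D \<Longrightarrow> ip H d x = 0\<rbrakk> \<Longrightarrow> x = \<zero>"
  shows "hdense H D"
proof -
  have DH: "D \<subseteq> carrier H" and D0: "\<zero> \<in> D"
    and Dadd: "\<And>x y. x \<in> D \<Longrightarrow> y \<in> D \<Longrightarrow> x \<oplus> y \<in> D" and Dsm: "\<And>c x. x \<in> D \<Longrightarrow> c \<odot> x \<in> D"
    using D by (auto simp: subspace_def)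
  have "\<exists>d \<in> D. hnorm H (d \<ominus> x) < \<epsilon>" if x: "x \<in> carrier H" and \<epsilon>: "\<epsilon> > 0" for x \<epsilon>
  proof -
    define \<delta> where "\<delta> = Inf ((\<lambda>d. (hnorm H (d \<ominus> x))\<^sup>2) ` D)"
    have bdd: "bdd_below ((\<lambda>d. (hnorm H (d \<ominus> x))\<^sup>2) ` D)"
      by (rule bdd_belowI[of _ 0]) auto
    have \<delta>_le: "\<delta> \<le> (hnorm H (d \<ominus> x))\<^sup>2" if "d \<in> D" for d
      unfolding \<delta>_def using bdd that by (auto intro: cInf_lower)
    define r :: "nat \<Rightarrow> real" where "r n = inverse (real (Suc n))" for n
    have r0: "r n > 0" and r_mono: "N \<le> n \<Longrightarrow> r n \<le> r N" for n N
      by (auto simp: r_def intro: le_imp_inverse_le)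
    have r_lim: "r \<longlonglongrightarrow> 0"
      using LIMSEQ_inverse_real_of_nat by (simp add: r_def[abs_def])
    have "\<exists>d \<in> D. (hnorm H (d \<ominus> x))\<^sup>2 < \<delta> + r n" for n
      using cInf_lessD[of "(\<lambda>d. (hnorm H (d \<ominus> x))\<^sup>2) ` D" "\<delta> + r n"] D0 r0[of n]
      by (auto simp: \<delta>_def)
    then obtain v where vD: "\<And>n. v n \<in> D"
      and v: "\<And>n. (hnorm H (v n \<ominus> x))\<^sup>2 < \<delta> + r n"
      by metis
    have vH: "v n \<in> carrier H" for n using vD DH by auto
    have par: "(hnorm H (v m \<ominus> v n))\<^sup>2 \<le> 2 * (r m + r n)" for m n
    proof -
      let ?a = "v m \<ominus> x" and ?b = "v n \<ominus> x" and ?c = "(1/2) \<odot> (v m \<oplus> v n)"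
      have ab: "?a \<in> carrier H" "?b \<in> carrier H" using vH x by auto
      have "?c \<in> D" using Dsm Dadd vD by auto
      then have "\<delta> \<le> (hnorm H (?c \<ominus> x))\<^sup>2" by (rule \<delta>_le)
      moreover have "?a \<oplus> ?b = 2 \<odot> (?c \<ominus> x)"
        using vH x by (intro ip_eqI) (auto simp: ip_simps algebra_simps)
      then have "(hnorm H (?a \<oplus> ?b))\<^sup>2 = 4 * (hnorm H (?c \<ominus> x))\<^sup>2"
        using vH x by (simp add: hnorm_smult power_mult_distrib)
      moreover have "?a \<ominus> ?b = v m \<ominus> v n"
        using vH x by (intro ip_eqI) (auto simp: ip_simps algebra_simps)
      ultimately show ?thesis
        using v[of m] v[of n] hnorm_add_squared[OF ab] hnorm_minus_squared[OF ab] by simp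
    qed
    have C: "\<exists>N. \<forall>m\<ge>N. \<forall>n\<ge>N. hnorm H (v m \<ominus> v n) < e" if e: "e > 0" for e
    proof -
      obtain N where "r N < e\<^sup>2 / 4"
        using reals_Archimedean[of "e\<^sup>2 / 4"] e by (auto simp: r_def)
      then have N: "4 * r N < e\<^sup>2" by simp
      have "hnorm H (v m \<ominus> v n) < e" if "m \<ge> N" "n \<ge> N" for m n
      proof -
        have "2 * (r m + r n) \<le> 4 * r N"
          using r_mono[OF that(1)] r_mono[OF that(2)] by simp
        then have "(hnorm H (v m \<ominus> v n))\<^sup>2 < e\<^sup>2"
          by (rule le_less_trans[OF par le_less_trans[OF _ N]])
        then show ?thesis
          by (rule power2_less_imp_less) (use e in simp)
      qed
      then show ?thesis
        by (intro exI allI impI)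
    qed
    obtain p where p: "p \<in> carrier H" and lim: "converges_to v p"
      using Cauchy_converges[OF vH C] by auto
    have foot: "ip H d (p \<ominus> x) = 0" if d: "d \<in> D" for d
    proof (rule quadratic_form_vanishes)
      fix c
      have dH: "d \<in> carrier H" using d DH by auto
      (* Moving from the foot in the direction c d changes the squared distance by
         2 Re (c (d, p - x)) + |c|^2 |d|^2, which must not be negative. *)
      show "0 \<le> 2 * Re (c * ip H d (p \<ominus> x)) + (cmod c)\<^sup>2 * (hnorm H d)\<^sup>2"
      proof -
        have "(\<lambda>n. \<delta> - (\<delta> + r n)) \<longlonglongrightarrow> \<delta> - (\<delta> + 0)"
          by (intro tendsto_intros r_lim)
        then have l1: "(\<lambda>n. \<delta> - (\<delta> + r n)) \<longlonglongrightarrow> 0" by simp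
        have "(\<lambda>n. cnj (ip H (v n) d) - ip H d x) \<longlonglongrightarrow> cnj (ip H p d) - ip H d x"
          by (intro tendsto_intros converges_to_ip lim vH p dH)
        then have "(\<lambda>n. ip H d (v n \<ominus> x)) \<longlonglongrightarrow> ip H d (p \<ominus> x)"
          using vH p dH x ip_commute[of d] by (simp add: ip_simps)
        then have l2: "(\<lambda>n. 2 * Re (c * ip H d (v n \<ominus> x)) + (cmod c)\<^sup>2 * (hnorm H d)\<^sup>2)
            \<longlonglongrightarrow> 2 * Re (c * ip H d (p \<ominus> x)) + (cmod c)\<^sup>2 * (hnorm H d)\<^sup>2"
          by (intro tendsto_intros)
        have "\<delta> - (\<delta> + r n)
            \<le> 2 * Re (c * ip H d (v n \<ominus> x)) + (cmod c)\<^sup>2 * (hnorm H d)\<^sup>2" for n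
        proof -
          have "\<delta> \<le> (hnorm H (v n \<oplus> c \<odot> d \<ominus> x))\<^sup>2"
            using Dadd Dsm vD d by (intro \<delta>_le) auto
          also have "v n \<oplus> c \<odot> d \<ominus> x = c \<odot> d \<oplus> (v n \<ominus> x)"
            using vH dH x by (intro ip_eqI) (auto simp: ip_simps algebra_simps)
          also have "(hnorm H \<dots>)\<^sup>2 = (cmod c)\<^sup>2 * (hnorm H d)\<^sup>2 + 2 * Re (c * ip H d (v n \<ominus> x)) + (hnorm H (v n \<ominus> x))\<^sup>2"
            using vH dH x by (simp add: hnorm_add_squared hnorm_smult power_mult_distrib ip_smult_left)
          finally show ?thesis using v[of n] by linarith
        qed
        then show ?thesis
          by (intro LIMSEQ_le[OF l1 l2] exI allI impI)
      qed
    qed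
    have "p \<ominus> x = \<zero>"
      by (rule perp[OF minus_in_carrier[OF p x] foot])
    then have "p = x" by (rule minus_eq_zeroD[OF _ p x])
    then have "\<forall>\<^sub>F n in sequentially. hnorm H (v n \<ominus> x) < \<epsilon>"
      using order_tendstoD(2)[OF lim[unfolded converges_to_def] \<epsilon>] by simp
    then obtain n where "hnorm H (v n \<ominus> x) < \<epsilon>"
      using eventually_happens'[OF sequentially_bot] by blast
    then show ?thesis
      using vD by blast
  qed
  then show ?thesis
    unfolding hdense_iff[OF DH] by simp
qed

end

section \<open>Unitary operators and their Caratheodory functions\<close>

definition unitary_pair :: "'b set \<Rightarrow> ('b \<Rightarrow> 'b \<Rightarrow> complex) \<Rightarrow> ('b \<Rightarrow> 'b) \<Rightarrow> ('b \<Rightarrow> 'b) \<Rightarrow> bool" where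
  "unitary_pair C q U V \<longleftrightarrow>
     (\<forall>x \<in> C. U x \<in> C \<and> V x \<in> C \<and> V (U x) = x \<and> U (V x) = x) \<and>
     (\<forall>x \<in> C. \<forall>y \<in> C. q (U x) y = q x (V y))"

text \<open>
  A unitary operator is given together with its inverse. The identity \<open>(U x, y) = (x, V y)\<close> for a
  pair of mutually inverse maps already forces both to be linear and isometric.
\<close>

locale unitary_operator = hilbert_space H for H :: "'a ip_space" (structure) +
  fixes U Ui :: "'a \<Rightarrow> 'a"
  assumes unitary: "unitary_pair (carrier H) (ip H) U Ui"
begin

lemma U_in_carrier [simp]: "x \<in> carrier H \<Longrightarrow> U x \<in> carrier H"
  and Ui_in_carrier [simp]: "x \<in> carrier H \<Longrightarrow> Ui x \<in> carrier H"
  and Ui_U [simp]: "x \<in> carrier H \<Longrightarrow> Ui (U x) = x"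
  and U_Ui [simp]: "x \<in> carrier H \<Longrightarrow> U (Ui x) = x"
  and ip_U_left: "\<lbrakk>x \<in> carrier H; y \<in> carrier H\<rbrakk> \<Longrightarrow> ip H (U x) y = ip H x (Ui y)"
  using unitary unfolding unitary_pair_def by simp_all

lemma ip_Ui_left: "\<lbrakk>x \<in> carrier H; y \<in> carrier H\<rbrakk> \<Longrightarrow> ip H (Ui x) y = ip H x (U y)"
  using ip_U_left[of "Ui x" "U y"] by simp

lemmas ip_unitary = ip_U_left ip_Ui_left

lemma unitary_operator_inverse: "unitary_operator H Ui U"
  by unfold_locales (simp add: unitary_pair_def ip_Ui_left)

lemma U_add: "\<lbrakk>x \<in> carrier H; y \<in> carrier H\<rbrakk> \<Longrightarrow> U (x \<oplus> y) = U x \<oplus> U y"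
  by (rule ip_eqI) (auto simp: ip_simps ip_unitary)

lemma U_smult: "x \<in> carrier H \<Longrightarrow> U (c \<odot> x) = c \<odot> U x"
  by (rule ip_eqI) (auto simp: ip_simps ip_unitary)

lemma U_zero: "U \<zero> = \<zero>"
  by (rule ip_eqI) (auto simp: ip_simps ip_unitary)

lemma hnorm_U: "x \<in> carrier H \<Longrightarrow> hnorm H (U x) = hnorm H x"
  by (simp add: hnorm_def ip_unitary)

text \<open>For \<open>|\<zeta>| < 1\<close> the map \<open>k \<mapsto> g + \<zeta> U k\<close> is a contraction.\<close>

lemma neumann_solution:
  assumes \<zeta>: "cmod \<zeta> < 1" and g: "g \<in> carrier H"
  obtains k where "k \<in> carrier H" "k \<ominus> \<zeta> \<odot> U k = g"
proof -
  interpret Metric_space "carrier H" "hdist H" by (rule Metric_space_hdist)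
  obtain k where k: "k \<in> carrier H" "g \<oplus> \<zeta> \<odot> U k = k"
  proof (rule Banach_fixedpoint_thm[of "\<lambda>k. g \<oplus> \<zeta> \<odot> U k" "cmod \<zeta>"])
    show "mcomplete" by (rule complete)
    show "carrier H \<noteq> {}" using g by auto
    show "(\<lambda>k. g \<oplus> \<zeta> \<odot> U k) \<in> carrier H \<rightarrow> carrier H" using g by auto
    fix x y assume xy: "x \<in> carrier H" "y \<in> carrier H"
    have "(g \<oplus> \<zeta> \<odot> U x) \<ominus> (g \<oplus> \<zeta> \<odot> U y) = \<zeta> \<odot> U (x \<ominus> y)"
      using xy g by (intro ip_eqI) (auto simp: ip_simps ip_unitary algebra_simps)
    then show "hdist H (g \<oplus> \<zeta> \<odot> U x) (g \<oplus> \<zeta> \<odot> U y) \<le> cmod \<zeta> * hdist H x y"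
      using xy g by (simp add: hdist_def hnorm_smult hnorm_U)
  qed (use \<zeta> in auto)
  have "k \<ominus> \<zeta> \<odot> U k = g"
  proof (rule ip_eqI)
    fix w assume w: "w \<in> carrier H"
    have "ip H k w = ip H (g \<oplus> \<zeta> \<odot> U k) w" using k by simp
    then show "ip H (k \<ominus> \<zeta> \<odot> U k) w = ip H g w"
      using k(1) g w by (simp add: ip_simps)
  qed (use k g in auto)
  then show thesis using that k by blast
qed

lemma neumann_bound:
  assumes k: "k \<in> carrier H"
  shows "(1 - cmod \<zeta>) * hnorm H k \<le> hnorm H (k \<ominus> \<zeta> \<odot> U k)"
proof -
  have "k = (k \<ominus> \<zeta> \<odot> U k) \<oplus> \<zeta> \<odot> U k"
    using k by (intro ip_eqI) (auto simp: ip_simps)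
  then have "hnorm H k \<le> hnorm H (k \<ominus> \<zeta> \<odot> U k) + hnorm H (\<zeta> \<odot> U k)"
    using hnorm_triangle[of "k \<ominus> \<zeta> \<odot> U k" "\<zeta> \<odot> U k"] k by simp
  then show ?thesis
    using k by (simp add: hnorm_smult hnorm_U algebra_simps)
qed

lemma neumann_unique:
  assumes \<zeta>: "cmod \<zeta> < 1" and k: "k \<in> carrier H" and h: "h \<in> carrier H"
    and eq: "k \<ominus> \<zeta> \<odot> U k = h \<ominus> \<zeta> \<odot> U h"
  shows "k = h"
proof -
  have "(k \<ominus> h) \<ominus> \<zeta> \<odot> U (k \<ominus> h) = (k \<ominus> \<zeta> \<odot> U k) \<ominus> (h \<ominus> \<zeta> \<odot> U h)"
    using k h by (intro ip_eqI) (auto simp: ip_simps ip_unitary algebra_simps)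
  also have "\<dots> = \<zero>"
    using k h eq minus_self by simp
  finally have "(1 - cmod \<zeta>) * hnorm H (k \<ominus> h) \<le> 0"
    using neumann_bound[of "k \<ominus> h" \<zeta>] k h by simp
  then have "hnorm H (k \<ominus> h) \<le> 0"
    using \<zeta> by (simp add: mult_le_0_iff)
  then have "hnorm H (k \<ominus> h) = 0"
    by (rule antisym) (use k h in auto)
  then have "k \<ominus> h = \<zero>" using k h by simp
  then show ?thesis using k h by (rule minus_eq_zeroD)
qed

end

text \<open>
  A unitary operator \<open>U\<close> with a unit vector \<open>g\<^sub>+\<close> encodes a pair: \<open>U\<close> is the Cayley transform of the
  self-adjoint operator and \<open>g\<^sub>+\<close> spans the deficiency space at \<open>\<i>\<close>. Since the symmetric operator has
  the domain \<open>{h - U h | h \<bottom> g\<^sub>+}\<close>, a vector \<open>x\<close> is orthogonal to that domain exactly when \<open>U* x - x\<close> is a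
  multiple of \<open>g\<^sub>+\<close>; hence the last condition says that the symmetric operator is densely defined.
\<close>

locale unitary_model = unitary_operator H U Ui for H :: "'a ip_space" (structure) and U Ui +
  fixes gp gm :: 'a
  assumes gp [simp]: "gp \<in> carrier H" and gm_eq: "gm = U gp" and ip_gp [simp]: "ip H gp gp = 1"
    and no_fixed: "\<lbrakk>h \<in> carrier H; Ui h \<ominus> h = c \<odot> gp\<rbrakk> \<Longrightarrow> h = \<zero>"
begin

lemma gm [simp]: "gm \<in> carrier H"
  and Ui_gm [simp]: "Ui gm = gp" and U_gp [simp]: "U gp = gm"
  and ip_gm [simp]: "ip H gm gm = 1"
  by (simp_all add: gm_eq ip_unitary)

sublocale inverse: unitary_operator H Ui U
  by (rule unitary_operator_inverse)

text \<open>
  \<open>kvec \<zeta>\<close> is \<open>(1 - \<zeta> U*)\<^sup>-\<^sup>1 g\<^sub>+\<close>, and \<open>pfun\<close> is the Caratheodory function of the spectral measure of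
  \<open>g\<^sub>+\<close>, normalized by \<open>pfun 0 = 1\<close>.
\<close>

definition kvec :: "complex \<Rightarrow> 'a" where
  "kvec \<zeta> = (SOME k. k \<in> carrier H \<and> k \<ominus> \<zeta> \<odot> Ui k = gp)"

definition pfun :: "complex \<Rightarrow> complex" where
  "pfun \<zeta> = ip H (kvec \<zeta>) gp"

lemma kvec:
  assumes "cmod \<zeta> < 1"
  shows "kvec \<zeta> \<in> carrier H" "kvec \<zeta> \<ominus> \<zeta> \<odot> Ui (kvec \<zeta>) = gp"
proof -
  obtain k where "k \<in> carrier H" "k \<ominus> \<zeta> \<odot> Ui k = gp"
    by (rule inverse.neumann_solution[OF assms gp])
  then have "\<exists>k. k \<in> carrier H \<and> k \<ominus> \<zeta> \<odot> Ui k = gp" by blast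
  then have "kvec \<zeta> \<in> carrier H \<and> kvec \<zeta> \<ominus> \<zeta> \<odot> Ui (kvec \<zeta>) = gp"
    unfolding kvec_def by (rule someI_ex)
  then show "kvec \<zeta> \<in> carrier H" "kvec \<zeta> \<ominus> \<zeta> \<odot> Ui (kvec \<zeta>) = gp" by auto
qed

lemma ip_kvec:
  assumes "cmod \<zeta> < 1" "w \<in> carrier H"
  shows "ip H (kvec \<zeta>) w = ip H gp w + \<zeta> * ip H (kvec \<zeta>) (U w)"
proof -
  have "ip H (kvec \<zeta> \<ominus> \<zeta> \<odot> Ui (kvec \<zeta>)) w = ip H (kvec \<zeta>) w - \<zeta> * ip H (kvec \<zeta>) (U w)"
    using kvec(1)[OF assms(1)] assms(2) by (simp add: ip_simps ip_unitary)
  then show ?thesis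
    unfolding kvec(2)[OF assms(1)] by (simp add: algebra_simps)
qed

lemma pfun_eq: "cmod \<zeta> < 1 \<Longrightarrow> pfun \<zeta> = 1 + \<zeta> * ip H (kvec \<zeta>) gm"
  using ip_kvec[of \<zeta> gp] by (simp add: pfun_def)

lemma kvec_smult:
  assumes \<zeta>: "cmod \<zeta> < 1"
  shows "c \<odot> kvec \<zeta> \<ominus> \<zeta> \<odot> Ui (c \<odot> kvec \<zeta>) = c \<odot> gp"
  using kvec[OF \<zeta>] ip_kvec[OF \<zeta>] by (intro ip_eqI) (auto simp: ip_simps ip_unitary algebra_simps)

lemma kvec_unique:
  assumes "cmod \<zeta> < 1" "k \<in> carrier H" "k \<ominus> \<zeta> \<odot> Ui k = c \<odot> gp"
  shows "k = c \<odot> kvec \<zeta>"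
proof (rule inverse.neumann_unique[OF assms(1)])
  show "k \<ominus> \<zeta> \<odot> Ui k = c \<odot> kvec \<zeta> \<ominus> \<zeta> \<odot> Ui (c \<odot> kvec \<zeta>)"
    unfolding assms(3) kvec_smult[OF assms(1)] ..
qed (use kvec assms in auto)

text \<open>Take norms in \<open>\<zeta> U* k = k - g\<^sub>+\<close>.\<close>

lemma Re_pfun:
  assumes \<zeta>: "cmod \<zeta> < 1"
  shows "2 * Re (pfun \<zeta>) = 1 + (1 - (cmod \<zeta>)\<^sup>2) * (hnorm H (kvec \<zeta>))\<^sup>2"
proof -
  note k = kvec[OF \<zeta>]
  have "\<zeta> \<odot> Ui (kvec \<zeta>) = kvec \<zeta> \<ominus> gp"
    using k ip_kvec[OF \<zeta>] by (intro ip_eqI) (auto simp: ip_simps ip_unitary)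
  then have "hnorm H (\<zeta> \<odot> Ui (kvec \<zeta>)) = hnorm H (kvec \<zeta> \<ominus> gp)" by simp
  then have "(cmod \<zeta> * hnorm H (kvec \<zeta>))\<^sup>2 = (hnorm H (kvec \<zeta> \<ominus> gp))\<^sup>2"
    using k by (simp add: hnorm_smult inverse.hnorm_U)
  also have "\<dots> = (hnorm H (kvec \<zeta>))\<^sup>2 - 2 * Re (pfun \<zeta>) + 1"
    using k by (simp add: hnorm_minus_squared pfun_def hnorm_squared[of gp])
  finally show ?thesis
    by (simp add: power_mult_distrib algebra_simps)
qed

lemma Re_pfun_gt:
  assumes \<zeta>: "cmod \<zeta> < 1"
  shows "2 * Re (pfun \<zeta>) > 1"
proof -
  have "kvec \<zeta> \<noteq> \<zero>"
  proof
    assume "kvec \<zeta> = \<zero>"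
    then have "ip H gp gp = 0"
      using ip_kvec[OF \<zeta>, of gp] by (simp add: ip_zero_left)
    then show False by simp
  qed
  then have "0 < (1 - (cmod \<zeta>)\<^sup>2) * (hnorm H (kvec \<zeta>))\<^sup>2"
    using \<zeta> kvec[OF \<zeta>] by (intro mult_pos_pos) (auto simp: abs_square_less_1)
  then show ?thesis using Re_pfun[OF \<zeta>] by simp
qed

lemma pfun_nonzero: "cmod \<zeta> < 1 \<Longrightarrow> pfun \<zeta> \<noteq> 0"
  using Re_pfun_gt[of \<zeta>] by auto

lemma pfun_0: "pfun 0 = 1"
  using pfun_eq[of 0] by simp

text \<open>
  With \<open>e\<close> solving the adjoint equation at \<open>\<omega>\<close>, the difference quotient of \<open>pfun\<close> at \<open>\<omega>\<close> is the
  inner product of \<open>U* k\<^sub>\<zeta>\<close> with \<open>e\<close>, and \<open>k\<^sub>\<zeta>\<close> depends continuously on \<open>\<zeta>\<close>.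
\<close>

lemma pfun_holomorphic: "pfun holomorphic_on ball 0 1"
proof -
  have "\<exists>D. (pfun has_field_derivative D) (at \<omega>)" if \<omega>: "cmod \<omega> < 1" for \<omega>
  proof -
    obtain e where e: "e \<in> carrier H" "e \<ominus> cnj \<omega> \<odot> U e = gp"
      using neumann_solution[of "cnj \<omega>" gp] \<omega> by auto
    note k\<omega> = kvec[OF \<omega>]
    have diff: "pfun \<zeta> - pfun \<omega> = (\<zeta> - \<omega>) * ip H (kvec \<zeta>) (U e)" if \<zeta>: "cmod \<zeta> < 1" for \<zeta>
    proof -
      have gp_e: "ip H x gp = ip H x e - \<omega> * ip H x (U e)" if "x \<in> carrier H" for x
        using that e(1) by (simp add: e(2)[symmetric] ip_simps)
      show ?thesis
        unfolding pfun_def gp_e[OF kvec(1)[OF \<zeta>]] gp_e[OF kvec(1)[OF \<omega>]]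
        using ip_kvec[OF \<zeta> e(1)] ip_kvec[OF \<omega> e(1)] by (simp add: algebra_simps)
    qed
    have lip: "(1 - cmod \<zeta>) * hnorm H (kvec \<zeta> \<ominus> kvec \<omega>) \<le> cmod (\<zeta> - \<omega>) * hnorm H (kvec \<omega>)"
      if \<zeta>: "cmod \<zeta> < 1" for \<zeta>
    proof -
      have "(kvec \<zeta> \<ominus> kvec \<omega>) \<ominus> \<zeta> \<odot> Ui (kvec \<zeta> \<ominus> kvec \<omega>) = (\<zeta> - \<omega>) \<odot> Ui (kvec \<omega>)"
      proof (rule ip_eqI)
        fix w assume w: "w \<in> carrier H"
        show "ip H ((kvec \<zeta> \<ominus> kvec \<omega>) \<ominus> \<zeta> \<odot> Ui (kvec \<zeta> \<ominus> kvec \<omega>)) w = ip H ((\<zeta> - \<omega>) \<odot> Ui (kvec \<omega>)) w"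
          using kvec(1)[OF \<zeta>] kvec(1)[OF \<omega>] w ip_kvec[OF \<zeta> w] ip_kvec[OF \<omega> w]
          by (simp add: ip_simps ip_unitary algebra_simps)
      qed (use kvec(1)[OF \<zeta>] kvec(1)[OF \<omega>] in auto)
      then show ?thesis
        using inverse.neumann_bound[of "kvec \<zeta> \<ominus> kvec \<omega>" \<zeta>] kvec(1)[OF \<zeta>] kvec(1)[OF \<omega>]
        by (simp add: hnorm_smult inverse.hnorm_U)
    qed
    have near: "\<forall>\<^sub>F \<zeta> in at \<omega>. cmod \<zeta> < 1"
      using \<omega> by (intro order_tendstoD(2)[of cmod "cmod \<omega>"] tendsto_norm tendsto_ident_at)
    have "((\<lambda>\<zeta>. ip H (kvec \<zeta>) (U e)) \<longlongrightarrow> ip H (kvec \<omega>) (U e)) (at \<omega>)"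
    proof (rule LIM_zero_cancel, rule Lim_null_comparison)
      show "\<forall>\<^sub>F \<zeta> in at \<omega>. norm (ip H (kvec \<zeta>) (U e) - ip H (kvec \<omega>) (U e))
          \<le> cmod (\<zeta> - \<omega>) * hnorm H (kvec \<omega>) / (1 - cmod \<zeta>) * hnorm H (U e)"
        using near
      proof eventually_elim
        fix \<zeta> assume \<zeta>: "cmod \<zeta> < 1"
        have "norm (ip H (kvec \<zeta>) (U e) - ip H (kvec \<omega>) (U e)) = cmod (ip H (kvec \<zeta> \<ominus> kvec \<omega>) (U e))"
          using kvec(1)[OF \<zeta>] kvec(1)[OF \<omega>] e by (simp add: ip_simps)
        also have "\<dots> \<le> hnorm H (kvec \<zeta> \<ominus> kvec \<omega>) * hnorm H (U e)"
          using kvec(1)[OF \<zeta>] kvec(1)[OF \<omega>] e by (intro Cauchy_Schwarz) auto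
        also have "\<dots> \<le> cmod (\<zeta> - \<omega>) * hnorm H (kvec \<omega>) / (1 - cmod \<zeta>) * hnorm H (U e)"
          using lip[OF \<zeta>] \<zeta> e by (intro mult_right_mono) (auto simp: pos_le_divide_eq mult.commute)
        finally show "norm (ip H (kvec \<zeta>) (U e) - ip H (kvec \<omega>) (U e))
          \<le> cmod (\<zeta> - \<omega>) * hnorm H (kvec \<omega>) / (1 - cmod \<zeta>) * hnorm H (U e)" .
      qed
      have "((\<lambda>\<zeta>. cmod (\<zeta> - \<omega>) * hnorm H (kvec \<omega>) / (1 - cmod \<zeta>) * hnorm H (U e))
          \<longlongrightarrow> cmod (\<omega> - \<omega>) * hnorm H (kvec \<omega>) / (1 - cmod \<omega>) * hnorm H (U e)) (at \<omega>)"
        using \<omega> by (intro tendsto_intros) auto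
      then show "((\<lambda>\<zeta>. cmod (\<zeta> - \<omega>) * hnorm H (kvec \<omega>) / (1 - cmod \<zeta>) * hnorm H (U e)) \<longlongrightarrow> 0) (at \<omega>)"
        by simp
    qed
    moreover have "\<forall>\<^sub>F \<zeta> in at \<omega>. ip H (kvec \<zeta>) (U e) = (pfun \<zeta> - pfun \<omega>) / (\<zeta> - \<omega>)"
      using near eventually_neq_at_within[of \<omega>] by eventually_elim (simp add: diff)
    ultimately have "((\<lambda>\<zeta>. (pfun \<zeta> - pfun \<omega>) / (\<zeta> - \<omega>)) \<longlongrightarrow> ip H (kvec \<omega>) (U e)) (at \<omega>)"
      by (rule Lim_transform_eventually)
    then show ?thesis
      unfolding has_field_derivative_iff by blast
  qed
  then show ?thesis
    by (auto simp: holomorphic_on_open)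
qed

end

section \<open>The Cayley transform\<close>

definition inverse_cayley :: "'a ip_space \<Rightarrow> ('a \<Rightarrow> 'a) \<Rightarrow> 'a set \<Rightarrow> ('a \<times> 'a) set" where
  "inverse_cayley H K D = {(h \<ominus>\<^bsub>H\<^esub> K h, \<i> \<odot>\<^bsub>H\<^esub> (h \<oplus>\<^bsub>H\<^esub> K h)) | h. h \<in> D}"

lemma inverse_cayleyI:
  "\<lbrakk>h \<in> D; u = h \<ominus>\<^bsub>H\<^esub> K h; v = \<i> \<odot>\<^bsub>H\<^esub> (h \<oplus>\<^bsub>H\<^esub> K h)\<rbrakk> \<Longrightarrow> (u, v) \<in> inverse_cayley H K D"
  unfolding inverse_cayley_def by blast

context hilbert_space
begin

text \<open>
  The differences and sums of two vectors determine them; this is how an element of a graph is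
  matched with an element \<open>(h - K h, i (h + K h))\<close>.
\<close>

lemma cayley_pair_eq:
  assumes "h \<in> carrier H" "k \<in> carrier H" "h' \<in> carrier H" "k' \<in> carrier H"
    and 1: "h \<ominus> k = h' \<ominus> k'" and 2: "\<i> \<odot> (h \<oplus> k) = \<i> \<odot> (h' \<oplus> k')"
  shows "h = h' \<and> k = k'"
proof -
  have e: "ip H h w = ip H h' w \<and> ip H k w = ip H k' w" if w: "w \<in> carrier H" for w
  proof -
    have "ip H h w - ip H k w = ip H h' w - ip H k' w"
      using arg_cong[OF 1, of "\<lambda>x. ip H x w"] assms(1-4) w by (simp add: ip_simps)
    moreover have "ip H h w + ip H k w = ip H h' w + ip H k' w"
      using arg_cong[OF 2, of "\<lambda>x. ip H x w"] assms(1-4) w by (simp add: ip_simps)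
    ultimately show ?thesis by (auto simp: complex_eq_iff)
  qed
  then show ?thesis
    using assms by (auto intro!: ip_eqI)
qed

lemma cayley_pair_exists:
  assumes f: "f \<in> carrier H" "f' \<in> carrier H"
  obtains h k where "h \<in> carrier H" "k \<in> carrier H" "f = h \<ominus> k" "f' = \<i> \<odot> (h \<oplus> k)"
proof
  show "(1 / (2 * \<i>)) \<odot> (f' \<oplus> \<i> \<odot> f) \<in> carrier H" "(1 / (2 * \<i>)) \<odot> (f' \<ominus> \<i> \<odot> f) \<in> carrier H"
    using f by auto
  show "f = (1 / (2 * \<i>)) \<odot> (f' \<oplus> \<i> \<odot> f) \<ominus> (1 / (2 * \<i>)) \<odot> (f' \<ominus> \<i> \<odot> f)"
    using f by (intro ip_eqI) (auto simp: ip_simps field_simps)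
  show "f' = \<i> \<odot> ((1 / (2 * \<i>)) \<odot> (f' \<oplus> \<i> \<odot> f) \<oplus> (1 / (2 * \<i>)) \<odot> (f' \<ominus> \<i> \<odot> f))"
    using f by (intro ip_eqI) (auto simp: ip_simps field_simps)
qed

lemma linear_operator_inverse_cayley:
  assumes D: "subspace D" and K: "\<And>h. h \<in> carrier H \<Longrightarrow> K h \<in> carrier H"
    and Kadd: "\<And>h k. \<lbrakk>h \<in> carrier H; k \<in> carrier H\<rbrakk> \<Longrightarrow> K (h \<oplus> k) = K h \<oplus> K k"
    and Ksm: "\<And>c h. h \<in> carrier H \<Longrightarrow> K (c \<odot> h) = c \<odot> K h"
    and inj: "\<And>h. \<lbrakk>h \<in> carrier H; h \<ominus> K h = \<zero>\<rbrakk> \<Longrightarrow> h = \<zero>"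
  shows "linear_operator H (inverse_cayley H K D)"
proof -
  have DH: "h \<in> carrier H" if "h \<in> D" for h using D that by (auto simp: subspace_def)
  have uniq: "h = k" if "h \<in> D" "k \<in> D" "h \<ominus> K h = k \<ominus> K k" for h k
  proof -
    note c = DH[OF that(1)] DH[OF that(2)]
    have Km: "K (h \<ominus> k) = K h \<ominus> K k"
    proof -
      have "h \<ominus> k = h \<oplus> (-1) \<odot> k" using c by (intro ip_eqI) (auto simp: ip_simps)
      then have "K (h \<ominus> k) = K h \<oplus> (-1) \<odot> K k" using c by (simp add: Kadd Ksm)
      also have "\<dots> = K h \<ominus> K k" using c K by (intro ip_eqI) (auto simp: ip_simps)
      finally show ?thesis .
    qed
    have "(h \<ominus> k) \<ominus> K (h \<ominus> k) = (h \<ominus> K h) \<ominus> (k \<ominus> K k)"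
      unfolding Km using c K by (intro ip_eqI) (auto simp: ip_simps)
    also have "\<dots> = \<zero>" using that(3) c K by (simp add: minus_self)
    finally have "h \<ominus> k = \<zero>" by (rule inj[OF minus_in_carrier[OF c]])
    then show ?thesis by (rule minus_eq_zeroD[OF _ c])
  qed
  have sv: "single_valued (inverse_cayley H K D)"
  proof (rule single_valuedI)
    fix x y z assume "(x, y) \<in> inverse_cayley H K D" "(x, z) \<in> inverse_cayley H K D"
    then obtain h k where "h \<in> D" "k \<in> D" "x = h \<ominus> K h" "x = k \<ominus> K k"
      and yz: "y = \<i> \<odot> (h \<oplus> K h)" "z = \<i> \<odot> (k \<oplus> K k)"
      by (auto simp: inverse_cayley_def)
    then have "h = k" by (metis uniq)
    then show "y = z" using yz by simp
  qed
  have z: "K \<zero> = \<zero>" using Ksm[of \<zero> 0] K by simp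
  have add: "(u \<oplus> u', v \<oplus> v') \<in> inverse_cayley H K D"
    if uv: "(u, v) \<in> inverse_cayley H K D" "(u', v') \<in> inverse_cayley H K D" for u v u' v'
  proof -
    obtain h h' where h: "h \<in> D" "h' \<in> D" and e: "u = h \<ominus> K h" "v = \<i> \<odot> (h \<oplus> K h)"
        "u' = h' \<ominus> K h'" "v' = \<i> \<odot> (h' \<oplus> K h')"
      using uv by (auto simp: inverse_cayley_def)
    have "u \<oplus> u' = (h \<oplus> h') \<ominus> K (h \<oplus> h')" "v \<oplus> v' = \<i> \<odot> ((h \<oplus> h') \<oplus> K (h \<oplus> h'))"
      unfolding e Kadd[OF DH[OF h(1)] DH[OF h(2)]]
      using DH h K by (intro ip_eqI; auto simp: ip_simps algebra_simps)+
    moreover have "h \<oplus> h' \<in> D" using D h by (auto simp: subspace_def)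
    ultimately show ?thesis by (intro inverse_cayleyI)
  qed
  have sm: "(c \<odot> u, c \<odot> v) \<in> inverse_cayley H K D"
    if uv: "(u, v) \<in> inverse_cayley H K D" for c u v
  proof -
    obtain h where h: "h \<in> D" and e: "u = h \<ominus> K h" "v = \<i> \<odot> (h \<oplus> K h)"
      using uv by (auto simp: inverse_cayley_def)
    have "c \<odot> u = c \<odot> h \<ominus> K (c \<odot> h)" "c \<odot> v = \<i> \<odot> (c \<odot> h \<oplus> K (c \<odot> h))"
      unfolding e Ksm[OF DH[OF h]]
      using DH h K by (intro ip_eqI; auto simp: ip_simps algebra_simps)+
    moreover have "c \<odot> h \<in> D" using D h by (auto simp: subspace_def)
    ultimately show ?thesis by (intro inverse_cayleyI)
  qed
  have "(\<zero>, \<zero>) \<in> inverse_cayley H K D"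
  proof (rule inverse_cayleyI)
    show "\<zero> \<in> D" using D by (simp add: subspace_def)
    show "\<zero> = \<zero> \<ominus> K \<zero>" unfolding z by (rule minus_self[OF M.zero_closed, symmetric])
    show "\<zero> = \<i> \<odot> (\<zero> \<oplus> K \<zero>)" unfolding z M.l_zero[OF M.zero_closed] by simp
  qed
  moreover have "inverse_cayley H K D \<subseteq> carrier H \<times> carrier H"
    using DH K by (auto simp: inverse_cayley_def)
  ultimately show ?thesis
    unfolding linear_operator_def using sv add sm by simp
qed

lemma subspace_carrier: "subspace (carrier H)"
  by (auto simp: subspace_def)

lemma subspace_Domain:
  assumes "linear_operator H T"
  shows "subspace (Domain T)"
  using assms unfolding linear_operator_def subspace_def by (auto simp: Domain_iff) blast+

text \<open>
  A vector orthogonal to the range of \<open>A + \<eta>\<close> would be an eigenvector with the nonreal eigenvalue \<open>\<eta>\<close>,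
  so the range is dense; it is closed because \<open>|A f + \<eta> f|\<^sup>2 = |A f|\<^sup>2 + |f|\<^sup>2\<close> and \<open>A\<close>, being an adjoint, is
  closed.
\<close>

lemma self_adjoint_range:
  assumes A: "self_adjoint_op H A" and \<eta>: "\<eta> = \<i> \<or> \<eta> = - \<i>" and g: "g \<in> carrier H"
  shows "\<exists>f f'. (f, f') \<in> A \<and> f' \<oplus> \<eta> \<odot> f = g"
proof -
  have lin: "linear_operator H A" and adj: "adjoint_op H A = A"
    using A by (auto simp: self_adjoint_op_def)
  have car: "f \<in> carrier H" "f' \<in> carrier H" if "(f, f') \<in> A" for f f'
    using lin that by (auto simp: linear_operator_def)
  have sym: "ip H v f = ip H u f'" if "(f, f') \<in> A" "(u, v) \<in> A" for f f' u v
  proof -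
    have "(f, f') \<in> adjoint_op H A" using that adj by simp
    then show ?thesis using that(2) by (auto simp: adjoint_op_def)
  qed
  have A0: "(\<zero>, \<zero>) \<in> A"
    and Aadd: "\<And>u v u' v'. (u, v) \<in> A \<Longrightarrow> (u', v') \<in> A \<Longrightarrow> (u \<oplus> u', v \<oplus> v') \<in> A"
    and Asm: "\<And>c u v. (u, v) \<in> A \<Longrightarrow> (c \<odot> u, c \<odot> v) \<in> A"
    using lin unfolding linear_operator_def by blast+
  define R where "R = {f' \<oplus> \<eta> \<odot> f | f f'. (f, f') \<in> A}"
  have R: "subspace R"
  proof -
    have "x \<oplus> y \<in> R" if xy: "x \<in> R" "y \<in> R" for x y
    proof -
      obtain f f' u v where m: "(f, f') \<in> A" "(u, v) \<in> A" and e: "x = f' \<oplus> \<eta> \<odot> f" "y = v \<oplus> \<eta> \<odot> u"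
        using xy by (auto simp: R_def)
      have "x \<oplus> y = (f' \<oplus> v) \<oplus> \<eta> \<odot> (f \<oplus> u)"
        unfolding e using car[OF m(1)] car[OF m(2)] by (intro ip_eqI) (auto simp: ip_simps algebra_simps)
      then show ?thesis unfolding R_def using Aadd[OF m] by blast
    qed
    moreover have "c \<odot> x \<in> R" if x: "x \<in> R" for c x
    proof -
      obtain f f' where m: "(f, f') \<in> A" and e: "x = f' \<oplus> \<eta> \<odot> f"
        using x by (auto simp: R_def)
      have "c \<odot> x = c \<odot> f' \<oplus> \<eta> \<odot> (c \<odot> f)"
        unfolding e using car[OF m] by (intro ip_eqI) (auto simp: ip_simps algebra_simps)
      then show ?thesis unfolding R_def using Asm[OF m] by blast
    qed
    moreover have "\<zero> \<in> R" unfolding R_def using A0 by force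
    moreover have "R \<subseteq> carrier H" using car by (auto simp: R_def)
    ultimately show ?thesis by (simp add: subspace_def)
  qed
  have dense: "hdense H R"
  proof (rule subspace_hdenseI[OF R])
    fix x assume x: "x \<in> carrier H" and perp: "\<And>d. d \<in> R \<Longrightarrow> ip H d x = 0"
    have "ip H v x = ip H u (\<eta> \<odot> x)" if m: "(u, v) \<in> A" for u v
    proof -
      have "ip H (v \<oplus> \<eta> \<odot> u) x = 0" using m by (intro perp) (auto simp: R_def)
      then show ?thesis
        using \<eta> car[OF m] x by (auto simp: ip_simps add_eq_0_iff)
    qed
    then have "(x, \<eta> \<odot> x) \<in> A"
      using x adj by (auto simp: adjoint_op_def)
    then have "ip H (\<eta> \<odot> x) x = ip H x (\<eta> \<odot> x)" by (intro sym)
    then show "x = \<zero>"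
      using \<eta> x ip_definite[OF x] by (auto simp: ip_simps)
  qed
  obtain r where r: "\<And>n. r n \<in> R" and rlim: "converges_to r g"
    using hdense_sequence[OF _ dense g] R by (auto simp: subspace_def)
  have "\<forall>n. \<exists>f f'. (f, f') \<in> A \<and> r n = f' \<oplus> \<eta> \<odot> f"
    using r by (simp add: R_def) blast
  then obtain F F' where FA: "\<And>n. (F n, F' n) \<in> A" and rF: "\<And>n. r n = F' n \<oplus> \<eta> \<odot> F n"
    by metis
  have Fc: "F n \<in> carrier H" "F' n \<in> carrier H" "r n \<in> carrier H" for n
    using car[OF FA] rF by auto
  (* (A d, d) is real, so the cross term of |A d + \<eta> d|^2 vanishes *)
  have graph: "(hnorm H (F' m \<ominus> F' n))\<^sup>2 + (hnorm H (F m \<ominus> F n))\<^sup>2 = (hnorm H (r m \<ominus> r n))\<^sup>2" for m n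
  proof -
    define d d' where "d = F m \<ominus> F n" and "d' = F' m \<ominus> F' n"
    have dc: "d \<in> carrier H" "d' \<in> carrier H" using Fc by (auto simp: d_def d'_def)
    have "d = F m \<oplus> (-1) \<odot> F n" "d' = F' m \<oplus> (-1) \<odot> F' n"
      unfolding d_def d'_def using Fc by (intro ip_eqI; auto simp: ip_simps)+
    then have "(d, d') \<in> A" using Aadd[OF FA Asm[OF FA]] by simp
    then have "ip H d' d = ip H d d'" by (intro sym)
    then have real: "Im (ip H d' d) = 0"
      using ip_commute[OF dc] by (simp add: complex_eq_iff)
    have "r m \<ominus> r n = d' \<oplus> \<eta> \<odot> d"
      unfolding rF d_def d'_def using Fc by (intro ip_eqI) (auto simp: ip_simps algebra_simps)
    then show ?thesis
      using dc real \<eta> by (auto simp: hnorm_add_squared hnorm_smult ip_simps simp flip: d_def d'_def)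
  qed
  have le: "hnorm H (F m \<ominus> F n) \<le> 1 * hnorm H (r m \<ominus> r n)" for m n
  proof (rule power2_le_imp_le)
    show "(hnorm H (F m \<ominus> F n))\<^sup>2 \<le> (1 * hnorm H (r m \<ominus> r n))\<^sup>2"
      unfolding mult_1 graph[symmetric] by simp
  qed (use Fc in simp)
  obtain f where f: "f \<in> carrier H" "converges_to F f"
    using convergence_transfer[OF Fc(3) Fc(1) g rlim le] by auto
  have le': "hnorm H (F' m \<ominus> F' n) \<le> 1 * hnorm H (r m \<ominus> r n)" for m n
  proof (rule power2_le_imp_le)
    show "(hnorm H (F' m \<ominus> F' n))\<^sup>2 \<le> (1 * hnorm H (r m \<ominus> r n))\<^sup>2"
      unfolding mult_1 graph[symmetric] by simp
  qed (use Fc in simp)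
  obtain f' where f': "f' \<in> carrier H" "converges_to F' f'"
    using convergence_transfer[OF Fc(3) Fc(2) g rlim le'] by auto
  have "ip H v f = ip H u f'" if m: "(u, v) \<in> A" for u v
  proof -
    note c = car[OF m]
    have l: "(\<lambda>n. cnj (ip H (F n) v)) \<longlonglongrightarrow> cnj (ip H f v)"
      using f Fc c by (intro tendsto_cnj converges_to_ip) auto
    have l': "(\<lambda>n. cnj (ip H (F' n) u)) \<longlonglongrightarrow> cnj (ip H f' u)"
      using f' Fc c by (intro tendsto_cnj converges_to_ip) auto
    have "cnj (ip H (F n) v) = cnj (ip H (F' n) u)" for n
      using sym[OF FA[of n] m] ip_commute Fc c by metis
    then have "cnj (ip H f v) = cnj (ip H f' u)"
      by (intro LIMSEQ_unique[OF l]) (use l' in simp)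
    then show ?thesis
      using ip_commute[OF c(2) f(1)] ip_commute[OF c(1) f'(1)] by simp
  qed
  then have "(f, f') \<in> A"
    using f f' adj by (auto simp: adjoint_op_def)
  moreover have "f' \<oplus> \<eta> \<odot> f = g"
  proof (rule ip_eqI)
    fix w assume w: "w \<in> carrier H"
    have "(\<lambda>n. ip H (F' n) w + \<eta> * ip H (F n) w) \<longlonglongrightarrow> ip H f' w + \<eta> * ip H f w"
      using f f' Fc w by (intro tendsto_intros converges_to_ip) auto
    moreover have "(\<lambda>n. ip H (r n) w) \<longlonglongrightarrow> ip H g w"
      using g Fc w by (intro converges_to_ip rlim) auto
    moreover have "ip H (r n) w = ip H (F' n) w + \<eta> * ip H (F n) w" for n
      unfolding rF using Fc w by (simp add: ip_simps)
    ultimately have "ip H f' w + \<eta> * ip H f w = ip H g w"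
      using LIMSEQ_unique by simp
    then show "ip H (f' \<oplus> \<eta> \<odot> f) w = ip H g w"
      using f f' w by (simp add: ip_simps)
  qed (use f f' g in auto)
  ultimately show ?thesis by blast
qed

text \<open>
  With \<open>A f + i f = 2 i h\<close> and \<open>A f - i f = 2 i k\<close> the Cayley transform is \<open>h \<mapsto> k\<close>, and the graph of \<open>A\<close>
  consists of the pairs \<open>(h - k, i (h + k))\<close>. Symmetry of \<open>A\<close> is the isometry of this relation, and
  the ranges of \<open>A + i\<close> and \<open>A - i\<close> are its domain and range.
\<close>

lemma cayley_transform:
  assumes A: "self_adjoint_op H A"
  obtains U Ui where "unitary_operator H U Ui" "A = inverse_cayley H U (carrier H)"
proof -
  have lin: "linear_operator H A" and adj: "adjoint_op H A = A"
    using A by (auto simp: self_adjoint_op_def)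
  define W where "W h k \<longleftrightarrow> h \<in> carrier H \<and> k \<in> carrier H \<and> (h \<ominus> k, \<i> \<odot> (h \<oplus> k)) \<in> A" for h k
  have W_ip: "ip H k k' = ip H h h'" if w: "W h k" "W h' k'" for h k h' k'
  proof -
    have "(h' \<ominus> k', \<i> \<odot> (h' \<oplus> k')) \<in> adjoint_op H A"
      unfolding adj using w by (simp add: W_def)
    then have "ip H (\<i> \<odot> (h \<oplus> k)) (h' \<ominus> k') = ip H (h \<ominus> k) (\<i> \<odot> (h' \<oplus> k'))"
      using w by (auto simp: adjoint_op_def W_def)
    then show ?thesis
      using w by (simp add: W_def ip_simps algebra_simps complex_eq_iff)
  qed
  have W1: "\<exists>k. W h k" if h: "h \<in> carrier H" for h
  proof -
    obtain f f' where f: "(f, f') \<in> A" "f' \<oplus> \<i> \<odot> f = (2 * \<i>) \<odot> h"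
      using self_adjoint_range[OF A, of "\<i>" "(2 * \<i>) \<odot> h"] h by auto
    then have fc: "f \<in> carrier H" "f' \<in> carrier H" using lin by (auto simp: linear_operator_def)
    have c: "ip H f' w + \<i> * ip H f w = 2 * \<i> * ip H h w" if "w \<in> carrier H" for w
      using arg_cong[OF f(2), of "\<lambda>x. ip H x w"] fc h that by (simp add: ip_simps)
    have "h \<ominus> (h \<ominus> f) = f"
      using fc h by (intro ip_eqI) (auto simp: ip_simps)
    moreover have "\<i> \<odot> (h \<oplus> (h \<ominus> f)) = f'"
    proof (rule ip_eqI)
      fix w assume w: "w \<in> carrier H"
      show "ip H (\<i> \<odot> (h \<oplus> (h \<ominus> f))) w = ip H f' w"
        using c[OF w] fc h w by (simp add: ip_simps algebra_simps)
    qed (use fc h in auto)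
    ultimately have "W h (h \<ominus> f)" using f fc h by (simp add: W_def)
    then show ?thesis by blast
  qed
  have W2: "\<exists>h. W h k" if k: "k \<in> carrier H" for k
  proof -
    obtain f f' where f: "(f, f') \<in> A" "f' \<oplus> (- \<i>) \<odot> f = (2 * \<i>) \<odot> k"
      using self_adjoint_range[OF A, of "- \<i>" "(2 * \<i>) \<odot> k"] k by auto
    then have fc: "f \<in> carrier H" "f' \<in> carrier H" using lin by (auto simp: linear_operator_def)
    have c: "ip H f' w - \<i> * ip H f w = 2 * \<i> * ip H k w" if "w \<in> carrier H" for w
      using arg_cong[OF f(2), of "\<lambda>x. ip H x w"] fc k that by (simp add: ip_simps)
    have "(k \<oplus> f) \<ominus> k = f"
      using fc k by (intro ip_eqI) (auto simp: ip_simps)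
    moreover have "\<i> \<odot> ((k \<oplus> f) \<oplus> k) = f'"
    proof (rule ip_eqI)
      fix w assume w: "w \<in> carrier H"
      show "ip H (\<i> \<odot> ((k \<oplus> f) \<oplus> k)) w = ip H f' w"
        using c[OF w] fc k w by (simp add: ip_simps algebra_simps)
    qed (use fc k in auto)
    ultimately have "W (k \<oplus> f) k" using f fc k by (simp add: W_def)
    then show ?thesis by blast
  qed
  have hn: "h = h'" if "h \<in> carrier H" "h' \<in> carrier H"
    "ip H h h = n" "ip H h h' = n" "ip H h' h = n" "ip H h' h' = n" for h h' n
  proof -
    have "ip H (h \<ominus> h') (h \<ominus> h') = 0" using that by (simp add: ip_simps)
    then have "h \<ominus> h' = \<zero>" using that by (intro ip_definite) auto
    then show ?thesis by (rule minus_eq_zeroD[OF _ that(1,2)])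
  qed
  have Wf: "k = k'" if w: "W h k" "W h k'" for h k k'
    using w W_ip by (intro hn[of _ _ "ip H h h"]) (auto simp: W_def)
  have Wi: "h = h'" if w: "W h k" "W h' k" for h h' k
    using w W_ip[symmetric] by (intro hn[of _ _ "ip H k k"]) (auto simp: W_def)
  define U where "U h = (SOME k. W h k)" for h
  define Ui where "Ui k = (SOME h. W h k)" for k
  have U: "W h (U h)" if "h \<in> carrier H" for h
    unfolding U_def by (rule someI_ex[OF W1[OF that]])
  have Ui: "W (Ui k) k" if "k \<in> carrier H" for k
    unfolding Ui_def by (rule someI_ex[OF W2[OF that]])
  have cU: "U h \<in> carrier H" "Ui h \<in> carrier H" if "h \<in> carrier H" for h
    using U[OF that] Ui[OF that] by (auto simp: W_def)
  have "ip H (U x) y = ip H x (Ui y)" if "x \<in> carrier H" "y \<in> carrier H" for x y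
    by (rule W_ip[OF U Ui]) (use that in auto)
  moreover have "Ui (U x) = x" "U (Ui x) = x" if "x \<in> carrier H" for x
    using Wi[OF Ui[OF cU(1)[OF that]] U[OF that]] Wf[OF U[OF cU(2)[OF that]] Ui[OF that]] by auto
  ultimately have "unitary_operator H U Ui"
    using cU by unfold_locales (simp add: unitary_pair_def)
  moreover have "A = inverse_cayley H U (carrier H)"
  proof
    show "inverse_cayley H U (carrier H) \<subseteq> A"
      using U by (auto simp: inverse_cayley_def W_def)
    show "A \<subseteq> inverse_cayley H U (carrier H)"
    proof (rule subrelI)
      fix f f' assume m: "(f, f') \<in> A"
      then have "f \<in> carrier H" "f' \<in> carrier H" using lin by (auto simp: linear_operator_def)
      then obtain h k where h: "h \<in> carrier H" "k \<in> carrier H" "f = h \<ominus> k" "f' = \<i> \<odot> (h \<oplus> k)"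
        by (rule cayley_pair_exists)
      then have "W h k" using m by (simp add: W_def)
      then have "k = U h" using Wf[OF _ U] h by blast
      then show "(f, f') \<in> inverse_cayley H U (carrier H)"
        using h by (auto simp: inverse_cayley_def)
    qed
  qed
  ultimately show thesis using that by blast
qed

end

section \<open>The functions of a pair in terms of its Cayley transform\<close>

definition cayley_point :: "complex \<Rightarrow> complex" where
  "cayley_point z = (z - \<i>) / (z + \<i>)"

lemma cayley_point_less_1: "0 < Im z \<Longrightarrow> cmod (cayley_point z) < 1"
proof -
  assume z: "0 < Im z"
  have "(cmod (z - \<i>))\<^sup>2 < (cmod (z + \<i>))\<^sup>2"
    using z unfolding cmod_power2 by (simp add: power2_eq_square algebra_simps)
  then have "cmod (z - \<i>) < cmod (z + \<i>)"
    by (rule power2_less_imp_less) simp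
  then show ?thesis
    by (simp add: cayley_point_def norm_divide divide_less_eq)
qed

lemma upper_half_plane_nonzero: "0 < Im z \<Longrightarrow> z + \<i> \<noteq> 0"
  by (auto simp: complex_eq_iff)

lemma cayley_point_holomorphic: "cayley_point holomorphic_on upper_half_plane"
  unfolding cayley_point_def[abs_def]
  by (intro holomorphic_intros) (auto simp: upper_half_plane_def upper_half_plane_nonzero)

lemma (in hilbert_space) one_dimensional_multiple:
  assumes N: "one_dimensional H N" and g: "g \<in> N" "g \<noteq> \<zero>" and x: "x \<in> N"
  obtains c where "x = c \<odot> g"
proof -
  obtain e where e: "e \<in> carrier H" and N_eq: "N = {c \<odot> e | c. True}"
    using N by (auto simp: one_dimensional_def)
  obtain a where a: "g = a \<odot> e" using g N_eq by auto
  obtain b where b: "x = b \<odot> e" using x N_eq by auto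
  have "a \<noteq> 0" using g(2) a e by auto
  then have "x = (b / a) \<odot> g" using a b e by (simp add: smult_smult)
  then show thesis using that by blast
qed

text \<open>
  The standing setting together with the Cayley transform \<open>U\<close> of \<open>A\<close>. The symmetric operator \<open>A0\<close> may
  be smaller than the restriction of \<open>A\<close> that \<open>U\<close> and \<open>gp\<close> determine, namely if it is not closed; it
  enters through its deficiency spaces and the density of its domain, which it shares with its
  closure.
\<close>

locale reference_model = unitary_operator H U Ui for H :: "'a ip_space" (structure) and U Ui +
  fixes A0 A :: "('a \<times> 'a) set" and gp gm :: 'a
  assumes setting: "reference_setting H A0 A gp gm"
    and A_eq: "A = inverse_cayley H U (carrier H)"
begin

lemma deficiency_one_dimensional:
    "one_dimensional H (deficiency_space H A0 \<i>)" "one_dimensional H (deficiency_space H A0 (- \<i>))"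
  and gp_deficiency: "gp \<in> deficiency_space H A0 \<i>"
  and gm_deficiency: "gm \<in> deficiency_space H A0 (- \<i>)"
  and A0_dense: "hdense H (Domain A0)"
  and A0_subset: "A0 \<subseteq> A"
  and A_self_adjoint: "self_adjoint_op H A"
  and A0_linear: "linear_operator H A0"
  using setting by (auto simp: reference_setting_def symmetric_11_def densely_defined_def symmetric_op_def)

lemma gp_carrier: "gp \<in> carrier H" and gm_carrier: "gm \<in> carrier H"
  using gp_deficiency gm_deficiency by (auto simp: deficiency_space_def)

lemma ip_gp_1: "ip H gp gp = 1" and ip_gm_1: "ip H gm gm = 1"
  using setting gp_carrier gm_carrier by (simp_all add: reference_setting_def ip_self)

lemma gp_nonzero: "gp \<noteq> \<zero>" and gm_nonzero: "gm \<noteq> \<zero>"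
  using ip_gp_1 ip_gm_1 ip_zero_left by auto

lemma A0_elem:
  assumes "(u, v) \<in> A0"
  obtains h where "h \<in> carrier H" "u = h \<ominus> U h" "v = \<i> \<odot> (h \<oplus> U h)"
proof -
  have "(u, v) \<in> inverse_cayley H U (carrier H)"
    using assms A0_subset A_eq by auto
  then show thesis
    using that unfolding inverse_cayley_def by blast
qed

lemma deficiency_iff:
  assumes f: "f \<in> carrier H"
  shows "f \<in> deficiency_space H A0 z \<longleftrightarrow> (\<forall>(u, v) \<in> A0. ip H v f = cnj z * ip H u f)"
proof -
  have "ip H u (z \<odot> f) = cnj z * ip H u f" if "(u, v) \<in> A0" for u v
    using that A0_linear f by (intro ip_smult_right) (auto simp: linear_operator_def)
  then show ?thesis
    using f by (auto simp: deficiency_space_def adjoint_op_def)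
qed

text \<open>
  The deficiency spaces at all points are images of the one at \<open>\<i>\<close>: for \<open>u = h - U h\<close> and
  \<open>\<zeta> = (z - i) / (z + i)\<close> one has
  \<open>(A\<^sub>0 u, f) - (u, z f) = (i - cnj z) (h, f - \<zeta> U* f)\<close>.
\<close>

lemma deficiency_shift:
  assumes f: "f \<in> carrier H" and z: "z + \<i> \<noteq> 0"
  shows "f \<in> deficiency_space H A0 z \<longleftrightarrow> f \<ominus> cayley_point z \<odot> Ui f \<in> deficiency_space H A0 \<i>"
proof -
  define x where "x = f \<ominus> cayley_point z \<odot> Ui f"
  have x: "x \<in> carrier H" using f by (simp add: x_def)
  have zc: "cnj z - \<i> \<noteq> 0"
  proof
    assume "cnj z - \<i> = 0"
    then have "cnj (cnj z - \<i>) = 0" by simp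
    then show False using z by simp
  qed
  have "ip H v f = cnj z * ip H u f \<longleftrightarrow> ip H v x = cnj \<i> * ip H u x" if uv: "(u, v) \<in> A0" for u v
  proof -
    obtain h where h: "h \<in> carrier H" "u = h \<ominus> U h" "v = \<i> \<odot> (h \<oplus> U h)"
      using uv by (rule A0_elem)
    have hx: "ip H h x = ip H h f - (cnj z + \<i>) / (cnj z - \<i>) * ip H h (Ui f)"
      using h f by (simp add: x_def ip_simps cayley_point_def)
    have "ip H v f - cnj z * ip H u f = (\<i> - cnj z) * ip H h x"
    proof -
      have "(\<i> - cnj z) * ip H h x = (\<i> - cnj z) * ip H h f + (cnj z + \<i>) * ip H h (Ui f)"
        unfolding hx using zc by (simp add: field_simps)
      then show ?thesis
        unfolding h(2,3) using h(1) f by (simp add: ip_simps ip_unitary algebra_simps)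
    qed
    then have 1: "ip H v f = cnj z * ip H u f \<longleftrightarrow> ip H h x = 0"
      using zc by (auto simp: algebra_simps)
    have "ip H v x - cnj \<i> * ip H u x = 2 * \<i> * ip H h x"
      unfolding h(2,3) using h(1) x by (simp add: ip_simps ip_unitary algebra_simps)
    then have 2: "ip H v x = cnj \<i> * ip H u x \<longleftrightarrow> ip H h x = 0"
      unfolding eq_iff_diff_eq_0[of "ip H v x"] by simp
    show ?thesis unfolding 1 2 ..
  qed
  then have "(\<forall>(u, v) \<in> A0. ip H v f = cnj z * ip H u f) \<longleftrightarrow> (\<forall>(u, v) \<in> A0. ip H v x = cnj \<i> * ip H u x)"
    by (intro ball_cong refl) auto
  then show ?thesis
    unfolding deficiency_iff[OF f] deficiency_iff[OF x] x_def[symmetric] .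
qed

lemma smult_deficiency:
  assumes "x \<in> deficiency_space H A0 z"
  shows "c \<odot> x \<in> deficiency_space H A0 z"
proof -
  have x: "x \<in> carrier H" using assms by (simp add: deficiency_space_def)
  have car: "u \<in> carrier H" "v \<in> carrier H" if "(u, v) \<in> A0" for u v
    using that A0_linear by (auto simp: linear_operator_def)
  have "ip H v (c \<odot> x) = cnj z * ip H u (c \<odot> x)" if uv: "(u, v) \<in> A0" for u v
    using assms uv car[OF uv] x unfolding deficiency_iff[OF x] by (auto simp: ip_simps)
  then show ?thesis
    unfolding deficiency_iff[OF smult_in_carrier[OF x]] by blast
qed

lemma deficiency_i_iff: "x \<in> deficiency_space H A0 \<i> \<longleftrightarrow> (\<exists>c. x = c \<odot> gp)"
  using one_dimensional_multiple[OF deficiency_one_dimensional(1) gp_deficiency gp_nonzero]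
    smult_deficiency[OF gp_deficiency] by metis

lemma deficiency_minus_i_iff: "x \<in> deficiency_space H A0 (- \<i>) \<longleftrightarrow> (\<exists>c. x = c \<odot> gm)"
  using one_dimensional_multiple[OF deficiency_one_dimensional(2) gm_deficiency gm_nonzero]
    smult_deficiency[OF gm_deficiency] by metis

lemma A0_perp_gp:
  assumes m: "(h \<ominus> U h, \<i> \<odot> (h \<oplus> U h)) \<in> A0" and h: "h \<in> carrier H"
  shows "ip H h gp = 0"
proof -
  have "ip H (\<i> \<odot> (h \<oplus> U h)) gp = cnj \<i> * ip H (h \<ominus> U h) gp"
    using gp_deficiency m unfolding deficiency_iff[OF gp_carrier] by blast
  then show ?thesis
    using h gp_carrier by (simp add: ip_simps algebra_simps)
qed

text \<open>
  The adjoint of \<open>A0\<close> sends \<open>gp - gm\<close> to \<open>i (gp + gm)\<close>. By density of the domain of \<open>A0\<close> the operator \<open>A\<close>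
  does the same, which is the statement about its Cayley transform.
\<close>

lemma U_gp_eq: "gm = U gp"
proof -
  note c = gp_carrier gm_carrier
  obtain w where w: "(gp \<ominus> gm, w) \<in> A"
    using setting by (auto simp: reference_setting_def)
  have wc: "w \<in> carrier H"
    using w A_self_adjoint by (auto simp: self_adjoint_op_def linear_operator_def)
  have car: "u \<in> carrier H" "v \<in> carrier H" if "(u, v) \<in> A0" for u v
    using that A0_linear by (auto simp: linear_operator_def)
  have "w \<ominus> \<i> \<odot> (gp \<oplus> gm) = \<zero>"
  proof (rule hdense_orthogonal[OF _ A0_dense])
    fix u assume "u \<in> Domain A0"
    then obtain v where uv: "(u, v) \<in> A0" by auto
    have "(gp \<ominus> gm, w) \<in> adjoint_op H A"
      using w A_self_adjoint by (simp add: self_adjoint_op_def)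
    then have 1: "ip H v (gp \<ominus> gm) = ip H u w"
      using uv A0_subset by (auto simp: adjoint_op_def)
    have 2: "ip H v gp = cnj \<i> * ip H u gp" and 3: "ip H v gm = cnj (- \<i>) * ip H u gm"
      using gp_deficiency gm_deficiency uv
      unfolding deficiency_iff[OF gp_carrier] deficiency_iff[OF gm_carrier] by blast+
    show "ip H u (w \<ominus> \<i> \<odot> (gp \<oplus> gm)) = 0"
      using 1 2 3 car[OF uv] c wc by (simp add: ip_simps algebra_simps)
  qed (use car c wc in auto)
  then have "w = \<i> \<odot> (gp \<oplus> gm)"
    by (rule minus_eq_zeroD) (use c wc in auto)
  then have "(gp \<ominus> gm, \<i> \<odot> (gp \<oplus> gm)) \<in> inverse_cayley H U (carrier H)"
    using w A_eq by simp
  then obtain h where h: "h \<in> carrier H" "gp \<ominus> gm = h \<ominus> U h" "\<i> \<odot> (gp \<oplus> gm) = \<i> \<odot> (h \<oplus> U h)"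
    unfolding inverse_cayley_def by blast
  have "gp = h \<and> gm = U h"
    by (rule cayley_pair_eq[OF c h(1) U_in_carrier[OF h(1)] h(2,3)])
  then show ?thesis by simp
qed

text \<open>Such an \<open>h\<close> is orthogonal to \<open>k - U k\<close> for all \<open>k \<bottom> gp\<close>, hence to the domain of \<open>A0\<close>.\<close>

lemma no_fixed_vector:
  assumes h: "h \<in> carrier H" and e: "Ui h \<ominus> h = c \<odot> gp"
  shows "h = \<zero>"
proof (rule hdense_orthogonal[OF _ A0_dense h])
  show "Domain A0 \<subseteq> carrier H"
    using A0_linear by (auto simp: linear_operator_def)
  fix u assume "u \<in> Domain A0"
  then obtain v where uv: "(u, v) \<in> A0" by auto
  obtain k where k: "k \<in> carrier H" "u = k \<ominus> U k" "v = \<i> \<odot> (k \<oplus> U k)"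
    using uv by (rule A0_elem)
  have k0: "ip H k gp = 0" using uv k by (intro A0_perp_gp) auto
  have "ip H k (Ui h \<ominus> h) = 0"
    unfolding e using k k0 gp_carrier by (simp add: ip_simps)
  then show "ip H u h = 0"
    unfolding k(2) using k(1) h by (simp add: ip_simps ip_unitary)
qed

sublocale unitary_model H U Ui gp gm
  by unfold_locales (use gp_carrier U_gp_eq ip_gp_1 no_fixed_vector in auto)

lemma deficiency_upper_iff:
  assumes f: "f \<in> carrier H" and z: "0 < Im z"
  shows "f \<in> deficiency_space H A0 z \<longleftrightarrow> (\<exists>c. f = c \<odot> kvec (cayley_point z))"
proof -
  note \<zeta> = cayley_point_less_1[OF z]
  have "f \<in> deficiency_space H A0 z \<longleftrightarrow> (\<exists>c. f \<ominus> cayley_point z \<odot> Ui f = c \<odot> gp)"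
    using deficiency_shift[OF f upper_half_plane_nonzero[OF z]] deficiency_i_iff by auto
  also have "\<dots> \<longleftrightarrow> (\<exists>c. f = c \<odot> kvec (cayley_point z))"
  proof
    assume "\<exists>c. f \<ominus> cayley_point z \<odot> Ui f = c \<odot> gp"
    then show "\<exists>c. f = c \<odot> kvec (cayley_point z)"
      using kvec_unique[OF \<zeta> f] by blast
  next
    assume "\<exists>c. f = c \<odot> kvec (cayley_point z)"
    then obtain c where c: "f = c \<odot> kvec (cayley_point z)" by blast
    have "f \<ominus> cayley_point z \<odot> Ui f = c \<odot> gp"
      unfolding c by (rule kvec_smult[OF \<zeta>])
    then show "\<exists>c. f \<ominus> cayley_point z \<odot> Ui f = c \<odot> gp" by blast
  qed
  finally show ?thesis .
qed

text \<open>
  One may take \<open>g\<^sub>z = kvec \<zeta>\<close>, for which \<open>(g\<^sub>z, gp) = p\<close> and \<open>\<zeta> (g\<^sub>z, gm) = p - 1\<close>.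
\<close>

lemma livsic_function_eq:
  assumes z: "0 < Im z"
  shows "livsic_function H A0 gp gm z = 1 - 1 / pfun (cayley_point z)"
proof -
  let ?\<zeta> = "cayley_point z"
  note \<zeta> = cayley_point_less_1[OF z] and k = kvec(1)[OF cayley_point_less_1[OF z]]
  define f where "f = (SOME f. f \<in> deficiency_space H A0 z \<and> f \<noteq> \<zero>)"
  have "kvec ?\<zeta> \<noteq> \<zero>"
    using pfun_nonzero[OF \<zeta>] gp by (auto simp: pfun_def ip_zero_left)
  moreover have "kvec ?\<zeta> \<in> deficiency_space H A0 z"
    using deficiency_upper_iff[OF k z] smult_1[OF k] by metis
  ultimately have "\<exists>f. f \<in> deficiency_space H A0 z \<and> f \<noteq> \<zero>" by blast
  then have "f \<in> deficiency_space H A0 z \<and> f \<noteq> \<zero>"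
    unfolding f_def by (rule someI_ex)
  then obtain c where c: "f = c \<odot> kvec ?\<zeta>" "f \<noteq> \<zero>"
    using deficiency_upper_iff[OF _ z] by (auto simp: deficiency_space_def)
  then have "c \<noteq> 0" using k by auto
  then have "ip H f gm / ip H f gp = ip H (kvec ?\<zeta>) gm / pfun ?\<zeta>"
    unfolding c(1) using k by (simp add: ip_simps pfun_def)
  then have "livsic_function H A0 gp gm z = ?\<zeta> * (ip H (kvec ?\<zeta>) gm / pfun ?\<zeta>)"
    unfolding livsic_function_def Let_def f_def[symmetric] cayley_point_def[symmetric] by simp
  also have "\<dots> = (pfun ?\<zeta> - 1) / pfun ?\<zeta>"
    using pfun_eq[OF \<zeta>] by simp
  finally show ?thesis
    using pfun_nonzero[OF \<zeta>] by (simp add: diff_divide_distrib)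
qed

text \<open>
  The resolvent of \<open>A\<close> at \<open>gp\<close> is \<open>h - U h\<close> with \<open>h = U* kvec \<zeta> / (z + i)\<close>.
\<close>

lemma weyl_titchmarsh_function_eq:
  assumes z: "0 < Im z"
  shows "weyl_titchmarsh_function H A gp z = \<i> * (2 * pfun (cayley_point z) - 1)"
proof -
  let ?\<zeta> = "cayley_point z"
  note \<zeta> = cayley_point_less_1[OF z] and k = kvec(1)[OF cayley_point_less_1[OF z]]
    and nz = upper_half_plane_nonzero[OF z]
  have sv: "single_valued A"
    using A_self_adjoint by (simp add: self_adjoint_op_def linear_operator_def)
  have app: "op_app A (h \<ominus> U h) = \<i> \<odot> (h \<oplus> U h)" if h: "h \<in> carrier H" for h
  proof -
    have m: "(h \<ominus> U h, \<i> \<odot> (h \<oplus> U h)) \<in> A"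
      unfolding A_eq by (rule inverse_cayleyI[OF h refl refl])
    show ?thesis
      unfolding op_app_def
    proof (rule the_equality)
      show "(h \<ominus> U h, \<i> \<odot> (h \<oplus> U h)) \<in> A" by (rule m)
    next
      fix y assume "(h \<ominus> U h, y) \<in> A"
      then show "y = \<i> \<odot> (h \<oplus> U h)"
        using sv m by (auto dest: single_valuedD)
    qed
  qed
  have eqn: "op_app A (h \<ominus> U h) \<ominus> z \<odot> (h \<ominus> U h) = gp \<longleftrightarrow> h = (1 / (z + \<i>)) \<odot> Ui (kvec ?\<zeta>)"
    if h: "h \<in> carrier H" for h
  proof -
    define y where "y = (z + \<i>) \<odot> U h"
    have y: "y \<in> carrier H" using h by (simp add: y_def)
    have "op_app A (h \<ominus> U h) \<ominus> z \<odot> (h \<ominus> U h) = y \<ominus> ?\<zeta> \<odot> Ui y"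
      unfolding app[OF h]
    proof (rule ip_eqI)
      fix w assume w: "w \<in> carrier H"
      have "ip H (y \<ominus> ?\<zeta> \<odot> Ui y) w = (z + \<i>) * ip H h (Ui w) - ?\<zeta> * (z + \<i>) * ip H h w"
        using h w by (simp add: y_def ip_simps ip_unitary mult.assoc)
      also have "?\<zeta> * (z + \<i>) = z - \<i>" using nz by (simp add: cayley_point_def)
      finally show "ip H (\<i> \<odot> (h \<oplus> U h) \<ominus> z \<odot> (h \<ominus> U h)) w = ip H (y \<ominus> ?\<zeta> \<odot> Ui y) w"
        using h w by (simp add: ip_simps ip_unitary algebra_simps)
    qed (use h y in auto)
    also have "\<dots> = gp \<longleftrightarrow> y = kvec ?\<zeta>"
      using kvec_unique[OF \<zeta> y, of 1] kvec(2)[OF \<zeta>] k by auto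
    also have "\<dots> \<longleftrightarrow> h = (1 / (z + \<i>)) \<odot> Ui (kvec ?\<zeta>)"
    proof
      assume "y = kvec ?\<zeta>"
      then show "h = (1 / (z + \<i>)) \<odot> Ui (kvec ?\<zeta>)"
        using h nz by (simp add: y_def inverse.U_smult smult_smult flip: \<open>y = kvec ?\<zeta>\<close>)
    next
      assume "h = (1 / (z + \<i>)) \<odot> Ui (kvec ?\<zeta>)"
      then show "y = kvec ?\<zeta>" using k nz by (simp add: y_def U_smult smult_smult)
    qed
    finally show ?thesis .
  qed
  define h where "h = (1 / (z + \<i>)) \<odot> Ui (kvec ?\<zeta>)"
  have h: "h \<in> carrier H" using k by (simp add: h_def)
  have "resolvent H A z gp = h \<ominus> U h"
    unfolding resolvent_def
  proof (rule the_equality)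
    show "h \<ominus> U h \<in> Domain A \<and> op_app A (h \<ominus> U h) \<ominus> z \<odot> (h \<ominus> U h) = gp"
      using eqn[OF h] inverse_cayleyI[OF h refl refl, of H U] h_def unfolding A_eq by blast
    fix f assume f: "f \<in> Domain A \<and> op_app A f \<ominus> z \<odot> f = gp"
    then obtain k where "k \<in> carrier H" "f = k \<ominus> U k"
      unfolding A_eq inverse_cayley_def by blast
    then show "f = h \<ominus> U h" using eqn[of k] f h_def by simp
  qed
  then have "weyl_titchmarsh_function H A gp z = ip H (z \<odot> (\<i> \<odot> (h \<oplus> U h)) \<oplus> (h \<ominus> U h)) gp"
    by (simp add: weyl_titchmarsh_function_def Let_def app[OF h])
  also have "\<dots> = \<i> * ((z - \<i>) * ip H h gp + (z + \<i>) * ip H h (Ui gp))"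
    using h by (simp add: ip_simps ip_unitary algebra_simps)
  also have "(z + \<i>) * ip H h (Ui gp) = pfun ?\<zeta>"
    unfolding h_def pfun_def using k nz by (simp add: ip_simps ip_unitary)
  also have "(z - \<i>) * ip H h gp = ?\<zeta> * ip H (kvec ?\<zeta>) gm"
    unfolding h_def using k nz by (simp add: ip_simps ip_unitary cayley_point_def)
  also have "\<dots> = pfun ?\<zeta> - 1"
    using pfun_eq[OF \<zeta>] by simp
  finally show ?thesis by (simp add: algebra_simps)
qed

end

lemma reference_setting_model:
  assumes "reference_setting H A0 A gp gm"
  obtains U Ui where "reference_model H U Ui A0 A gp gm"
proof -
  interpret hilbert_space H using assms by (simp add: reference_setting_def)
  have "self_adjoint_op H A" using assms by (simp add: reference_setting_def)
  then obtain U Ui where "unitary_operator H U Ui" and A: "A = inverse_cayley H U (carrier H)"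
    by (rule cayley_transform)
  interpret unitary_operator H U Ui by fact
  have "reference_model H U Ui A0 A gp gm"
    by unfold_locales (fact assms A)+
  then show thesis by (rule that)
qed

section \<open>The pair with a given Cayley transform\<close>

text \<open>
  Every unitary model arises from a pair: \<open>A\<close> is the inverse Cayley transform of \<open>U\<close>, and \<open>A0\<close> is its
  restriction obtained by admitting only \<open>h \<bottom> gp\<close>.
\<close>

context unitary_model
begin

definition perp_gp :: "'a set" where
  "perp_gp = {h \<in> carrier H. ip H h gp = 0}"

lemma subspace_perp_gp: "subspace perp_gp"
  by (auto simp: subspace_def perp_gp_def ip_simps)

lemma perp_gpD: "h \<in> perp_gp \<Longrightarrow> h \<in> carrier H"
  by (simp add: perp_gp_def)

lemma perp_gp_ip: "h \<in> perp_gp \<Longrightarrow> ip H h gp = 0"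
  by (simp add: perp_gp_def)

lemma perp_perp_gp:
  assumes y: "y \<in> carrier H" and perp: "\<And>h. h \<in> perp_gp \<Longrightarrow> ip H h y = 0"
  shows "y = ip H y gp \<odot> gp"
proof -
  let ?h = "y \<ominus> ip H y gp \<odot> gp"
  have h: "?h \<in> perp_gp" using y by (simp add: perp_gp_def ip_simps)
  have "ip H ?h ?h = ip H ?h y - cnj (ip H y gp) * ip H ?h gp"
    using y by (simp add: ip_minus_right ip_smult_right)
  also have "\<dots> = 0" using perp[OF h] h by (simp add: perp_gp_def)
  finally have "?h = \<zero>" using y by (intro ip_definite) auto
  then show ?thesis by (rule minus_eq_zeroD) (use y in auto)
qed

lemma U_no_fixed:
  assumes h: "h \<in> carrier H" and e: "h \<ominus> U h = c \<odot> gm"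
  shows "h = \<zero>"
proof (rule no_fixed[OF h, of c])
  have "ip H h w - ip H h (Ui w) = c * ip H gm w" if "w \<in> carrier H" for w
    using arg_cong[OF e, of "\<lambda>x. ip H x w"] h that by (simp add: ip_simps ip_unitary)
  note * = this[OF U_in_carrier]
  show "Ui h \<ominus> h = c \<odot> gp"
  proof (rule ip_eqI)
    fix w assume w: "w \<in> carrier H"
    have "ip H gm (U w) = ip H gp w"
      using ip_U_left[of gp "U w"] w by simp
    then show "ip H (Ui h \<ominus> h) w = ip H (c \<odot> gp) w"
      using *[OF w] h w by (simp add: ip_simps ip_unitary)
  qed (use h in auto)
qed

lemma linear_inverse_cayley_U:
  assumes "subspace D"
  shows "linear_operator H (inverse_cayley H U D)"
proof (rule linear_operator_inverse_cayley[OF assms])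
  fix h assume "h \<in> carrier H" "h \<ominus> U h = \<zero>"
  then show "h = \<zero>" using U_no_fixed[of h 0] by simp
qed (auto simp: U_add U_smult)

lemma symmetric_inverse_cayley_U:
  assumes D: "subspace D" and "(u, v) \<in> inverse_cayley H U D" "(u', v') \<in> inverse_cayley H U D"
  shows "ip H v u' = ip H u v'"
proof -
  obtain h h' where h: "h \<in> D" "u = h \<ominus> U h" "v = \<i> \<odot> (h \<oplus> U h)"
    and h': "h' \<in> D" "u' = h' \<ominus> U h'" "v' = \<i> \<odot> (h' \<oplus> U h')"
    using assms unfolding inverse_cayley_def by blast
  have "h \<in> carrier H" "h' \<in> carrier H"
    using D h(1) h'(1) by (auto simp: subspace_def)
  then show ?thesis
    unfolding h(2,3) h'(2,3) by (simp add: ip_simps ip_unitary algebra_simps)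
qed

lemma dense_inverse_cayley_U:
  assumes D: "subspace D" and sub: "perp_gp \<subseteq> D"
  shows "densely_defined H (inverse_cayley H U D)"
  unfolding densely_defined_def
proof (rule subspace_hdenseI)
  show "subspace (Domain (inverse_cayley H U D))"
    by (rule subspace_Domain[OF linear_inverse_cayley_U[OF D]])
  fix x assume x: "x \<in> carrier H" and perp: "\<And>d. d \<in> Domain (inverse_cayley H U D) \<Longrightarrow> ip H d x = 0"
  have "ip H h (Ui x \<ominus> x) = 0" if h: "h \<in> perp_gp" for h
  proof -
    have "(h \<ominus> U h, \<i> \<odot> (h \<oplus> U h)) \<in> inverse_cayley H U D"
      using h sub by (intro inverse_cayleyI) auto
    then have "ip H (h \<ominus> U h) x = 0" by (intro perp) auto
    then show ?thesis
      using perp_gpD[OF h] x by (simp add: ip_simps ip_unitary)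
  qed
  then have "Ui x \<ominus> x = ip H (Ui x \<ominus> x) gp \<odot> gp"
    using x by (intro perp_perp_gp) auto
  then show "x = \<zero>" by (rule no_fixed[OF x])
qed

lemma adjoint_inverse_cayley_U: "adjoint_op H (inverse_cayley H U (carrier H)) = inverse_cayley H U (carrier H)"
proof
  let ?A = "inverse_cayley H U (carrier H)"
  show "?A \<subseteq> adjoint_op H ?A"
  proof (rule subrelI)
    fix f f' assume m: "(f, f') \<in> ?A"
    have "f \<in> carrier H" "f' \<in> carrier H"
      using m by (auto simp: inverse_cayley_def)
    then show "(f, f') \<in> adjoint_op H ?A"
      using symmetric_inverse_cayley_U[OF subspace_carrier _ m] by (auto simp: adjoint_op_def)
  qed
  show "adjoint_op H ?A \<subseteq> ?A"
  proof (rule subrelI)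
    fix f f' assume m: "(f, f') \<in> adjoint_op H ?A"
    then have f: "f \<in> carrier H" "f' \<in> carrier H" by (auto simp: adjoint_op_def)
    obtain h k where h: "h \<in> carrier H" "k \<in> carrier H" "f = h \<ominus> k" "f' = \<i> \<odot> (h \<oplus> k)"
      using f by (rule cayley_pair_exists)
    have "k = U h"
    proof (rule ip_eqI)
      fix w assume w: "w \<in> carrier H"
      let ?w = "Ui w"
      have "(?w \<ominus> U ?w, \<i> \<odot> (?w \<oplus> U ?w)) \<in> ?A"
        by (rule inverse_cayleyI[OF _ refl refl]) (use w in simp)
      then have "ip H (\<i> \<odot> (?w \<oplus> w)) f = ip H (?w \<ominus> w) f'"
        using m w by (auto simp: adjoint_op_def)
      then have "ip H w k = ip H w (U h)"
        unfolding h(3,4) using h(1,2) w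
        by (simp add: ip_simps ip_unitary algebra_simps complex_eq_iff)
      then show "ip H k w = ip H (U h) w"
        using ip_commute[of w k] ip_commute[of w "U h"] h w by simp
    qed (use h in auto)
    then show "(f, f') \<in> ?A" using h by (intro inverse_cayleyI[OF h(1)]) auto
  qed
qed

lemma reference_setting_inverse_cayley:
  "reference_setting H (inverse_cayley H U perp_gp) (inverse_cayley H U (carrier H)) gp gm"
proof -
  let ?A0 = "inverse_cayley H U perp_gp"
  have sub: "?A0 \<subseteq> inverse_cayley H U (carrier H)"
    using perp_gpD by (auto simp: inverse_cayley_def)
  have def_iff: "f \<in> deficiency_space H ?A0 z \<longleftrightarrow> f \<in> carrier H \<and>
      (\<forall>h \<in> perp_gp. (\<i> - cnj z) * ip H h f + (\<i> + cnj z) * ip H h (Ui f) = 0)" for f z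
  proof -
    have "ip H (\<i> \<odot> (h \<oplus> U h)) f = ip H (h \<ominus> U h) (z \<odot> f) \<longleftrightarrow>
        (\<i> - cnj z) * ip H h f + (\<i> + cnj z) * ip H h (Ui f) = 0"
      if "h \<in> perp_gp" "f \<in> carrier H" for h
    proof -
      have "ip H (\<i> \<odot> (h \<oplus> U h)) f - ip H (h \<ominus> U h) (z \<odot> f) =
          (\<i> - cnj z) * ip H h f + (\<i> + cnj z) * ip H h (Ui f)"
        using that perp_gpD[OF that(1)] by (simp add: ip_simps ip_unitary algebra_simps)
      then show ?thesis by (metis eq_iff_diff_eq_0)
    qed
    then show ?thesis
      by (auto simp: deficiency_space_def adjoint_op_def inverse_cayley_def)
  qed
  have dp: "deficiency_space H ?A0 \<i> = {c \<odot> gp | c. True}"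
  proof -
    have "f \<in> deficiency_space H ?A0 \<i> \<longleftrightarrow> (\<exists>c. f = c \<odot> gp)" for f
    proof
      assume "f \<in> deficiency_space H ?A0 \<i>"
      then have "f \<in> carrier H" "\<And>h. h \<in> perp_gp \<Longrightarrow> ip H h f = 0" by (auto simp: def_iff)
      then have "f = ip H f gp \<odot> gp" by (intro perp_perp_gp)
      then show "\<exists>c. f = c \<odot> gp" ..
    next
      assume "\<exists>c. f = c \<odot> gp"
      then show "f \<in> deficiency_space H ?A0 \<i>"
        by (auto simp: def_iff ip_simps perp_gpD perp_gp_ip)
    qed
    then show ?thesis by auto
  qed
  have dm: "deficiency_space H ?A0 (- \<i>) = {c \<odot> gm | c. True}"
  proof -
    have "f \<in> deficiency_space H ?A0 (- \<i>) \<longleftrightarrow> (\<exists>c. f = c \<odot> gm)" for f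
    proof
      assume "f \<in> deficiency_space H ?A0 (- \<i>)"
      then have f: "f \<in> carrier H" and "\<And>h. h \<in> perp_gp \<Longrightarrow> ip H h (Ui f) = 0"
        by (auto simp: def_iff)
      then have "Ui f = ip H (Ui f) gp \<odot> gp" by (intro perp_perp_gp) auto
      then obtain c where "Ui f = c \<odot> gp" ..
      then have "U (Ui f) = c \<odot> gm" by (simp add: U_smult)
      then have "f = c \<odot> gm" unfolding U_Ui[OF f] .
      then show "\<exists>c. f = c \<odot> gm" ..
    next
      assume "\<exists>c. f = c \<odot> gm"
      then show "f \<in> deficiency_space H ?A0 (- \<i>)"
        by (auto simp: def_iff ip_simps perp_gpD perp_gp_ip inverse.U_smult)
    qed
    then show ?thesis by auto
  qed
  have norm: "hnorm H gp = 1" "hnorm H gm = 1" by (simp_all add: hnorm_def)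
  have nz: "gp \<noteq> \<zero>" "gm \<noteq> \<zero>"
    using norm hnorm_eq_0[OF gp] hnorm_eq_0[OF gm] by linarith+
  have "symmetric_op H ?A0"
    unfolding symmetric_op_def
  proof (intro conjI)
    show "linear_operator H ?A0"
      by (rule linear_inverse_cayley_U[OF subspace_perp_gp])
    show "\<forall>(u, v) \<in> ?A0. \<forall>(u', v') \<in> ?A0. ip H v u' = ip H u v'"
    proof (rule ballI, rule case_prodI2, rule ballI, rule case_prodI2)
      fix p u v q u' v' assume "p \<in> ?A0" "p = (u, v)" "q \<in> ?A0" "q = (u', v')"
      then show "ip H v u' = ip H u v'"
        using symmetric_inverse_cayley_U[OF subspace_perp_gp, of u v u' v'] by simp
    qed
  qed
  moreover have "one_dimensional H (deficiency_space H ?A0 \<i>)"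
    unfolding dp one_dimensional_def by (rule bexI[OF _ gp]) (use nz in simp)
  moreover have "one_dimensional H (deficiency_space H ?A0 (- \<i>))"
    unfolding dm one_dimensional_def by (rule bexI[OF _ gm]) (use nz in simp)
  ultimately have sym: "symmetric_11 H ?A0"
    unfolding symmetric_11_def using dense_inverse_cayley_U[OF subspace_perp_gp] by simp
  have "perp_gp \<subseteq> carrier H" using perp_gpD by auto
  then have sa: "self_adjoint_op H (inverse_cayley H U (carrier H))"
    unfolding self_adjoint_op_def
    using linear_inverse_cayley_U[OF subspace_carrier] adjoint_inverse_cayley_U
      dense_inverse_cayley_U[OF subspace_carrier] by simp
  have "(gp \<ominus> U gp, \<i> \<odot> (gp \<oplus> U gp)) \<in> inverse_cayley H U (carrier H)"
    by (rule inverse_cayleyI[OF gp refl refl])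
  then have dom: "gp \<ominus> gm \<in> Domain (inverse_cayley H U (carrier H))"
    by auto
  have mem: "gp \<in> deficiency_space H ?A0 \<i>" "gm \<in> deficiency_space H ?A0 (- \<i>)"
    unfolding dp dm mem_Collect_eq by (rule exI[of _ 1], simp)+
  have "hilbert_space H" by unfold_locales
  then show ?thesis
    unfolding reference_setting_def using sub norm sym sa dom mem by simp
qed

lemma reference_model_inverse_cayley:
  "reference_model H U Ui (inverse_cayley H U perp_gp) (inverse_cayley H U (carrier H)) gp gm"
  by unfold_locales (fact reference_setting_inverse_cayley refl)+

end

section \<open>Dissipative extensions\<close>

context unitary_model
begin

text \<open>
  The contraction that agrees with \<open>U\<close> on the orthogonal complement of \<open>gp\<close> and maps \<open>gp\<close> to \<open>\<kappa> gm\<close>. Its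
  inverse Cayley transform is the dissipative extension of the symmetric operator with von Neumann
  parameter \<open>\<kappa>\<close>.
\<close>

definition contraction_ext :: "complex \<Rightarrow> 'a \<Rightarrow> 'a" where
  "contraction_ext \<kappa> h = U h \<oplus> ((\<kappa> - 1) * ip H h gp) \<odot> gm"

definition dissipative_ext :: "complex \<Rightarrow> ('a \<times> 'a) set" where
  "dissipative_ext \<kappa> = inverse_cayley H (contraction_ext \<kappa>) (carrier H)"

lemma contraction_ext_in_carrier [simp]: "h \<in> carrier H \<Longrightarrow> contraction_ext \<kappa> h \<in> carrier H"
  by (simp add: contraction_ext_def)

lemma ip_contraction_ext:
  "\<lbrakk>h \<in> carrier H; w \<in> carrier H\<rbrakk> \<Longrightarrow>
     ip H (contraction_ext \<kappa> h) w = ip H h (Ui w) + (\<kappa> - 1) * ip H h gp * ip H gm w"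
  by (simp add: contraction_ext_def ip_simps ip_unitary)

lemma contraction_ext_gp: "contraction_ext \<kappa> gp = \<kappa> \<odot> gm"
  by (rule ip_eqI) (auto simp: ip_contraction_ext ip_simps ip_Ui_left[symmetric] ip_U_left[of gp, simplified, symmetric] algebra_simps)

lemma contraction_ext_perp: "h \<in> perp_gp \<Longrightarrow> contraction_ext \<kappa> h = U h"
  using perp_gpD[of h] perp_gp_ip[of h] by (simp add: contraction_ext_def)

lemma contraction_ext_no_fixed:
  assumes h: "h \<in> carrier H" and e: "h \<ominus> contraction_ext \<kappa> h = c \<odot> gm"
  shows "h = \<zero>"
proof (rule U_no_fixed[OF h])
  show "h \<ominus> U h = (c + (\<kappa> - 1) * ip H h gp) \<odot> gm"
  proof (rule ip_eqI)
    fix w assume w: "w \<in> carrier H"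
    have "ip H (h \<ominus> contraction_ext \<kappa> h) w = c * ip H gm w"
      unfolding e using w by (simp add: ip_simps)
    then show "ip H (h \<ominus> U h) w = ip H ((c + (\<kappa> - 1) * ip H h gp) \<odot> gm) w"
      using h w by (simp add: ip_minus_left ip_smult_left ip_contraction_ext ip_unitary algebra_simps)
  qed (use h in auto)
qed

lemma dissipative_extI: "h \<in> carrier H \<Longrightarrow>
    (h \<ominus> contraction_ext \<kappa> h, \<i> \<odot> (h \<oplus> contraction_ext \<kappa> h)) \<in> dissipative_ext \<kappa>"
  unfolding dissipative_ext_def by (rule inverse_cayleyI[OF _ refl refl])

lemma dissipative_extE:
  assumes "(f, f') \<in> dissipative_ext \<kappa>"
  obtains h where "h \<in> carrier H" "f = h \<ominus> contraction_ext \<kappa> h" "f' = \<i> \<odot> (h \<oplus> contraction_ext \<kappa> h)"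
  using assms unfolding dissipative_ext_def inverse_cayley_def by blast

lemma linear_dissipative_ext: "linear_operator H (dissipative_ext \<kappa>)"
  unfolding dissipative_ext_def
proof (rule linear_operator_inverse_cayley[OF subspace_carrier])
  fix h assume "h \<in> carrier H" "h \<ominus> contraction_ext \<kappa> h = \<zero>"
  then show "h = \<zero>" using contraction_ext_no_fixed[of h \<kappa> 0] by simp
next
  fix h k assume "h \<in> carrier H" "k \<in> carrier H"
  then show "contraction_ext \<kappa> (h \<oplus> k) = contraction_ext \<kappa> h \<oplus> contraction_ext \<kappa> k"
    by (intro ip_eqI) (auto simp: ip_contraction_ext ip_simps algebra_simps)
next
  fix h c assume "h \<in> carrier H"
  then show "contraction_ext \<kappa> (c \<odot> h) = c \<odot> contraction_ext \<kappa> h"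
    by (intro ip_eqI) (auto simp: ip_contraction_ext ip_simps algebra_simps)
qed auto

lemma Im_cayley_pair:
  assumes "h \<in> carrier H" "k \<in> carrier H"
  shows "Im (ip H (\<i> \<odot> (h \<oplus> k)) (h \<ominus> k)) = (hnorm H h)\<^sup>2 - (hnorm H k)\<^sup>2"
  using assms ip_commute[of h k] by (simp add: ip_simps hnorm_squared)

lemma hnorm_rank_one_change:
  assumes h: "h \<in> carrier H"
  shows "(hnorm H (U h \<oplus> (b - ip H h gp) \<odot> gm))\<^sup>2 = (hnorm H h)\<^sup>2 - (cmod (ip H h gp))\<^sup>2 + (cmod b)\<^sup>2"
proof -
  have "(hnorm H (U h \<oplus> (b - ip H h gp) \<odot> gm))\<^sup>2
      = (hnorm H h)\<^sup>2 + 2 * Re (cnj (b - ip H h gp) * ip H h gp) + (cmod (b - ip H h gp))\<^sup>2"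
    using h by (simp add: hnorm_add_squared hnorm_U hnorm_smult ip_smult_right ip_unitary power_mult_distrib hnorm_squared[of gm])
  then show ?thesis
    by (simp add: cmod_power2) (simp add: power2_eq_square algebra_simps)
qed

lemma hnorm_contraction_ext:
  assumes h: "h \<in> carrier H"
  shows "(hnorm H (contraction_ext \<kappa> h))\<^sup>2 = (hnorm H h)\<^sup>2 - (1 - (cmod \<kappa>)\<^sup>2) * (cmod (ip H h gp))\<^sup>2"
proof -
  have "contraction_ext \<kappa> h = U h \<oplus> (\<kappa> * ip H h gp - ip H h gp) \<odot> gm"
    by (simp add: contraction_ext_def left_diff_distrib)
  then show ?thesis
    using h by (simp add: hnorm_rank_one_change norm_mult power_mult_distrib algebra_simps)
qed

lemma dissipative_dissipative_ext:
  assumes "cmod \<kappa> \<le> 1"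
  shows "dissipative_op H (dissipative_ext \<kappa>)"
proof -
  have "0 \<le> Im (ip H f' f)" if m: "(f, f') \<in> dissipative_ext \<kappa>" for f f'
  proof -
    obtain h where h: "h \<in> carrier H" "f = h \<ominus> contraction_ext \<kappa> h" "f' = \<i> \<odot> (h \<oplus> contraction_ext \<kappa> h)"
      using m by (rule dissipative_extE)
    have "Im (ip H f' f) = (1 - (cmod \<kappa>)\<^sup>2) * (cmod (ip H h gp))\<^sup>2"
      unfolding h(2,3) using h(1) by (simp add: Im_cayley_pair hnorm_contraction_ext)
    then show ?thesis using assms by (simp add: abs_square_le_1)
  qed
  then show ?thesis
    unfolding dissipative_op_def using linear_dissipative_ext by blast
qed

text \<open>
  A dissipative operator \<open>B\<close> has \<open>B + i\<close> injective; an operator with \<open>Ran (T + i) = H\<close> therefore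
  has no proper dissipative extension.
\<close>

lemma maximal_dissipative_dissipative_ext:
  assumes \<kappa>: "cmod \<kappa> \<le> 1"
  shows "maximal_dissipative_op H (dissipative_ext \<kappa>)"
  unfolding maximal_dissipative_op_def
proof (intro conjI allI impI dissipative_dissipative_ext[OF \<kappa>])
  fix B assume B: "dissipative_op H B" and sub: "dissipative_ext \<kappa> \<subseteq> B"
  have lin: "linear_operator H B" using B by (simp add: dissipative_op_def)
  have "B \<subseteq> dissipative_ext \<kappa>"
  proof (rule subrelI)
    fix f f' assume m: "(f, f') \<in> B"
    then have "f \<in> carrier H" "f' \<in> carrier H" using lin by (auto simp: linear_operator_def)
    then obtain h k where h: "h \<in> carrier H" "k \<in> carrier H" "f = h \<ominus> k" "f' = \<i> \<odot> (h \<oplus> k)"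
      by (rule cayley_pair_exists)
    let ?K = "contraction_ext \<kappa> h"
    have mh: "(h \<ominus> ?K, \<i> \<odot> (h \<oplus> ?K)) \<in> B"
      using sub dissipative_extI[OF h(1)] by blast
    have "(f \<oplus> (-1) \<odot> (h \<ominus> ?K), f' \<oplus> (-1) \<odot> (\<i> \<odot> (h \<oplus> ?K))) \<in> B"
      using m mh lin unfolding linear_operator_def by simp
    also have "f \<oplus> (-1) \<odot> (h \<ominus> ?K) = ?K \<ominus> k"
      unfolding h(3) using h(1,2) by (intro ip_eqI) (auto simp: ip_simps)
    also have "f' \<oplus> (-1) \<odot> (\<i> \<odot> (h \<oplus> ?K)) = (- \<i>) \<odot> (?K \<ominus> k)"
      unfolding h(4) using h(1,2) by (intro ip_eqI) (auto simp: ip_simps algebra_simps)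
    finally have "0 \<le> Im (ip H ((- \<i>) \<odot> (?K \<ominus> k)) (?K \<ominus> k))"
      using B unfolding dissipative_op_def by blast
    also have "\<dots> = - ((hnorm H (?K \<ominus> k))\<^sup>2)"
      unfolding hnorm_squared[OF minus_in_carrier[OF contraction_ext_in_carrier[OF h(1)] h(2)]]
      using h(1,2) by (simp add: ip_smult_left)
    finally have "hnorm H (?K \<ominus> k) = 0" by simp
    then have "?K \<ominus> k = \<zero>" using h(1,2) by simp
    then have "?K = k" by (rule minus_eq_zeroD) (use h in auto)
    then show "(f, f') \<in> dissipative_ext \<kappa>"
      using dissipative_extI[OF h(1), of \<kappa>] h(3,4) by simp
  qed
  then show "B = dissipative_ext \<kappa>" using sub by blast
qed

lemma inverse_cayley_perp_subset: "inverse_cayley H U perp_gp \<subseteq> dissipative_ext \<kappa>"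
proof (rule subrelI)
  fix f f' assume "(f, f') \<in> inverse_cayley H U perp_gp"
  then obtain h where h: "h \<in> perp_gp" "f = h \<ominus> U h" "f' = \<i> \<odot> (h \<oplus> U h)"
    unfolding inverse_cayley_def by blast
  show "(f, f') \<in> dissipative_ext \<kappa>"
    using dissipative_extI[OF perp_gpD[OF h(1)], of \<kappa>] h(2,3) contraction_ext_perp[OF h(1)] by simp
qed

lemma adjoint_dissipative_ext_iff:
  assumes n: "n \<in> carrier H" and k: "k \<in> carrier H"
  shows "(n \<ominus> k, \<i> \<odot> (n \<oplus> k)) \<in> adjoint_op H (dissipative_ext \<kappa>) \<longleftrightarrow>
    (\<forall>h \<in> carrier H. ip H h n = ip H (contraction_ext \<kappa> h) k)"
proof -
  have "ip H (\<i> \<odot> (h \<oplus> contraction_ext \<kappa> h)) (n \<ominus> k) = ip H (h \<ominus> contraction_ext \<kappa> h) (\<i> \<odot> (n \<oplus> k))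
      \<longleftrightarrow> ip H h n = ip H (contraction_ext \<kappa> h) k" if h: "h \<in> carrier H" for h
  proof -
    let ?K = "contraction_ext \<kappa> h"
    have "ip H (\<i> \<odot> (h \<oplus> ?K)) (n \<ominus> k) - ip H (h \<ominus> ?K) (\<i> \<odot> (n \<oplus> k)) = 2 * \<i> * (ip H h n - ip H ?K k)"
      using h n k by (simp add: ip_simps algebra_simps)
    then show ?thesis
      unfolding eq_iff_diff_eq_0[of "ip H (\<i> \<odot> (h \<oplus> ?K)) (n \<ominus> k)"] by simp
  qed
  then have "(\<forall>(u, v) \<in> dissipative_ext \<kappa>. ip H v (n \<ominus> k) = ip H u (\<i> \<odot> (n \<oplus> k))) \<longleftrightarrow>
    (\<forall>h \<in> carrier H. ip H h n = ip H (contraction_ext \<kappa> h) k)"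
    unfolding dissipative_ext_def inverse_cayley_def by auto
  then show ?thesis
    using n k by (simp add: adjoint_op_def)
qed

text \<open>
  An \<open>f\<close> in the domains of the operator and of its adjoint is \<open>h - K h\<close> and also \<open>K* k - k\<close>. The vector
  \<open>y = h - K* k\<close> then satisfies \<open>y - U y \<in> \<complex> gm\<close>, so it vanishes; comparing the components along \<open>gp\<close> and
  \<open>gm\<close> leaves \<open>(1 - |\<kappa>|\<^sup>2) (k, gm) = 0\<close>.
\<close>

lemma symmetric_part_dissipative_ext:
  assumes \<kappa>: "cmod \<kappa> < 1"
  shows "symmetric_part H (dissipative_ext \<kappa>) = inverse_cayley H U perp_gp"
proof
  show "inverse_cayley H U perp_gp \<subseteq> symmetric_part H (dissipative_ext \<kappa>)"
  proof (rule subrelI)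
    fix f f' assume m: "(f, f') \<in> inverse_cayley H U perp_gp"
    then obtain h where h: "h \<in> perp_gp" "f = h \<ominus> U h" "f' = \<i> \<odot> (h \<oplus> U h)"
      unfolding inverse_cayley_def by blast
    note hc = perp_gpD[OF h(1)]
    have "ip H g h = ip H (contraction_ext \<kappa> g) (U h)" if "g \<in> carrier H" for g
      using that hc perp_gp_ip[OF h(1)] ip_commute[of gm "U h"]
      by (simp add: ip_contraction_ext ip_unitary)
    then have "(f, f') \<in> adjoint_op H (dissipative_ext \<kappa>)"
      unfolding h(2,3) using hc by (subst adjoint_dissipative_ext_iff) auto
    then show "(f, f') \<in> symmetric_part H (dissipative_ext \<kappa>)"
      using m inverse_cayley_perp_subset by (auto simp: symmetric_part_def)
  qed
  show "symmetric_part H (dissipative_ext \<kappa>) \<subseteq> inverse_cayley H U perp_gp"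
  proof (rule subrelI)
    fix f f' assume "(f, f') \<in> symmetric_part H (dissipative_ext \<kappa>)"
    then obtain g where m: "(f, f') \<in> dissipative_ext \<kappa>" and g: "(f, g) \<in> adjoint_op H (dissipative_ext \<kappa>)"
      by (auto simp: symmetric_part_def)
    obtain h where h: "h \<in> carrier H" "f = h \<ominus> contraction_ext \<kappa> h" "f' = \<i> \<odot> (h \<oplus> contraction_ext \<kappa> h)"
      using m by (rule dissipative_extE)
    have "f \<in> carrier H" "g \<in> carrier H" using g by (auto simp: adjoint_op_def)
    then obtain n k where n: "n \<in> carrier H" "k \<in> carrier H" "f = n \<ominus> k" "g = \<i> \<odot> (n \<oplus> k)"
      by (rule cayley_pair_exists)
    have adj: "ip H x n = ip H (contraction_ext \<kappa> x) k" if "x \<in> carrier H" for x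
      using g adjoint_dissipative_ext_iff[OF n(1,2)] that unfolding n(3,4) by blast
    define a where "a = ip H h gp"
    define b where "b = ip H k gm"
    (* n = K* k *)
    have n_eq: "n = Ui k \<oplus> ((cnj \<kappa> - 1) * b) \<odot> gp"
    proof (rule ip_eqI)
      fix w assume w: "w \<in> carrier H"
      have "ip H w n = ip H w (Ui k \<oplus> ((cnj \<kappa> - 1) * b) \<odot> gp)"
        using adj[OF w] w n ip_commute[of gm k] by (simp add: ip_contraction_ext ip_simps b_def algebra_simps)
      then show "ip H n w = ip H (Ui k \<oplus> ((cnj \<kappa> - 1) * b) \<odot> gp) w"
        using ip_commute[of n w] ip_commute[of "Ui k \<oplus> ((cnj \<kappa> - 1) * b) \<odot> gp" w] n w by simp
    qed (use n in auto)
    define y where "y = h \<ominus> (Ui k \<oplus> ((cnj \<kappa> - 1) * b) \<odot> gp)"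
    have y: "y \<in> carrier H" using h n by (simp add: y_def)
    have fw: "ip H h w - ip H h (Ui w) - (\<kappa> - 1) * a * ip H gm w
        = ip H k (U w) + (cnj \<kappa> - 1) * b * ip H gp w - ip H k w" if w: "w \<in> carrier H" for w
    proof -
      have "ip H f w = ip H h w - ip H h (Ui w) - (\<kappa> - 1) * a * ip H gm w"
        unfolding h(2) using h(1) w by (simp add: ip_minus_left ip_contraction_ext a_def)
      moreover have "ip H f w = ip H k (U w) + (cnj \<kappa> - 1) * b * ip H gp w - ip H k w"
        unfolding n(3) n_eq using n(2) w by (simp add: ip_simps ip_unitary)
      ultimately show ?thesis by simp
    qed
    have "y \<ominus> U y = ((\<kappa> - 1) * a + (cnj \<kappa> - 1) * b) \<odot> gm"
    proof (rule ip_eqI)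
      fix w assume w: "w \<in> carrier H"
      have "ip H gm w = ip H gp (Ui w)" using ip_U_left[of gp w] w by simp
      then show "ip H (y \<ominus> U y) w = ip H (((\<kappa> - 1) * a + (cnj \<kappa> - 1) * b) \<odot> gm) w"
        using fw[OF w] h(1) n(1,2) w
        by (simp add: y_def ip_simps ip_unitary algebra_simps)
    qed (use y in auto)
    note e = this
    have y0: "y = \<zero>" by (rule U_no_fixed[OF y e])
    then have "y \<ominus> U y = \<zero>" by (simp add: U_zero minus_self)
    then have "((\<kappa> - 1) * a + (cnj \<kappa> - 1) * b) \<odot> gm = \<zero>" using e by simp
    then have "ip H (((\<kappa> - 1) * a + (cnj \<kappa> - 1) * b) \<odot> gm) gm = 0"
      by (simp only: ip_zero_left[OF gm])
    then have 1: "(\<kappa> - 1) * a + (cnj \<kappa> - 1) * b = 0" by (simp add: ip_simps)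
    have "ip H y gp = 0" unfolding y0 by (rule ip_zero_left[OF gp])
    then have 2: "a = cnj \<kappa> * b"
      using h(1) n(2) by (simp add: y_def ip_simps ip_unitary a_def b_def algebra_simps)
    have "(\<kappa> - 1) * (cnj \<kappa> * b) + (cnj \<kappa> - 1) * b = (\<kappa> * cnj \<kappa> - 1) * b"
      by (simp add: algebra_simps)
    with 1 2 have "(\<kappa> * cnj \<kappa> - 1) * b = 0" by simp
    moreover have "\<kappa> * cnj \<kappa> \<noteq> 1"
      using \<kappa> by (auto simp: complex_norm_square[symmetric] abs_square_eq_1 simp flip: of_real_power)
    ultimately have "b = 0" by simp
    then have "h \<in> perp_gp" using 2 h(1) by (simp add: perp_gp_def a_def)
    then show "(f, f') \<in> inverse_cayley H U perp_gp"
      using contraction_ext_perp[of h \<kappa>] h(2,3) by (intro inverse_cayleyI[of h]) simp_all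
  qed
qed

text \<open>
  A bound on \<open>T = i (1 + K) (1 - K)\<^sup>-\<^sup>1\<close> would make \<open>1 - K\<close> bounded below. Its range is dense, so it
  would be the whole space and contain \<open>gm\<close>, which is excluded.
\<close>

lemma unbounded_dissipative_ext: "\<not> bounded_operator H (dissipative_ext \<kappa>)"
proof
  let ?K = "contraction_ext \<kappa>"
  assume "bounded_operator H (dissipative_ext \<kappa>)"
  then obtain C where C: "\<forall>(f, f') \<in> dissipative_ext \<kappa>. hnorm H f' \<le> C * hnorm H f"
    by (auto simp: bounded_operator_def)
  have below: "2 * hnorm H h \<le> (C + 1) * hnorm H (h \<ominus> ?K h)" if h: "h \<in> carrier H" for h
  proof -
    have "hnorm H (\<i> \<odot> (h \<oplus> ?K h)) \<le> C * hnorm H (h \<ominus> ?K h)"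
      using C dissipative_extI[OF h] by blast
    then have 1: "hnorm H (h \<oplus> ?K h) \<le> C * hnorm H (h \<ominus> ?K h)"
      using h by (simp add: hnorm_smult)
    have "2 \<odot> h = (h \<oplus> ?K h) \<oplus> (h \<ominus> ?K h)"
      using h by (intro ip_eqI) (auto simp: ip_simps)
    then have "hnorm H (2 \<odot> h) \<le> hnorm H (h \<oplus> ?K h) + hnorm H (h \<ominus> ?K h)"
      using hnorm_triangle[of "h \<oplus> ?K h" "h \<ominus> ?K h"] h by simp
    then have "2 * hnorm H h \<le> hnorm H (h \<oplus> ?K h) + hnorm H (h \<ominus> ?K h)"
      using h by (simp add: hnorm_smult)
    with 1 show ?thesis by (simp add: algebra_simps)
  qed
  have diff: "(h \<ominus> h') \<ominus> ?K (h \<ominus> h') = (h \<ominus> ?K h) \<ominus> (h' \<ominus> ?K h')" if "h \<in> carrier H" "h' \<in> carrier H" for h h'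
    using that by (intro ip_eqI) (auto simp: ip_simps ip_contraction_ext algebra_simps)
  let ?D = "Domain (inverse_cayley H U perp_gp)"
  have D_sub: "?D \<subseteq> carrier H"
    using subspace_Domain[OF linear_inverse_cayley_U[OF subspace_perp_gp]] by (simp add: subspace_def)
  have D_dense: "hdense H ?D"
    using dense_inverse_cayley_U[OF subspace_perp_gp] by (simp add: densely_defined_def)
  obtain d where d: "\<And>n. d n \<in> ?D" and dlim: "converges_to d gm"
    using hdense_sequence[OF D_sub D_dense gm] by auto
  have "\<exists>h. h \<in> carrier H \<and> d n = h \<ominus> ?K h" for n
  proof -
    obtain v where "(d n, v) \<in> inverse_cayley H U perp_gp" using d[of n] by auto
    then have "(d n, v) \<in> dissipative_ext \<kappa>" using inverse_cayley_perp_subset by blast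
    then show ?thesis by (rule dissipative_extE) auto
  qed
  then obtain h where h: "\<And>n. h n \<in> carrier H" and dh: "\<And>n. d n = h n \<ominus> ?K (h n)"
    by metis
  have dc: "d n \<in> carrier H" for n using d D_sub by blast
  have le: "hnorm H (h m \<ominus> h n) \<le> (C + 1) / 2 * hnorm H (d m \<ominus> d n)" for m n
    using below[of "h m \<ominus> h n"] h diff[OF h h] dh by simp
  obtain x where x: "x \<in> carrier H" "converges_to h x"
    using convergence_transfer[OF dc h gm dlim le] by auto
  have "x \<ominus> ?K x = 1 \<odot> gm"
  proof (rule ip_eqI)
    fix w assume w: "w \<in> carrier H"
    have lim: "(\<lambda>n. ip H (h n) y) \<longlonglongrightarrow> ip H x y" if "y \<in> carrier H" for y
      using x h that by (intro converges_to_ip) auto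
    have ipK: "ip H (y \<ominus> ?K y) w = ip H y w - ip H y (Ui w) - (\<kappa> - 1) * ip H y gp * ip H gm w"
      if "y \<in> carrier H" for y
      using that w by (simp add: ip_minus_left ip_contraction_ext)
    have "(\<lambda>n. ip H (h n) w - ip H (h n) (Ui w) - (\<kappa> - 1) * ip H (h n) gp * ip H gm w)
        \<longlonglongrightarrow> ip H (x \<ominus> ?K x) w"
      unfolding ipK[OF x(1)] using w by (intro tendsto_intros lim) auto
    then have "(\<lambda>n. ip H (d n) w) \<longlonglongrightarrow> ip H (x \<ominus> ?K x) w"
      unfolding dh ipK[OF h] .
    moreover have "(\<lambda>n. ip H (d n) w) \<longlonglongrightarrow> ip H gm w"
      using dlim dc w by (intro converges_to_ip) auto
    ultimately show "ip H (x \<ominus> ?K x) w = ip H (1 \<odot> gm) w"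
      using LIMSEQ_unique by simp
  qed (use x in auto)
  note e = this
  then have "x = \<zero>" by (rule contraction_ext_no_fixed[OF x(1)])
  then have "ip H (\<zero> \<ominus> ?K \<zero>) gm = 1" using e by simp
  then show False by (simp add: ip_simps ip_contraction_ext)
qed

lemma dissipative_class_dissipative_ext:
  assumes \<kappa>: "cmod \<kappa> < 1"
  shows "dissipative_ext \<kappa> \<in> dissipative_class H"
proof -
  have "symmetric_11 H (inverse_cayley H U perp_gp)"
    using reference_setting_inverse_cayley by (simp add: reference_setting_def)
  then show ?thesis
    unfolding dissipative_class_def
    using \<kappa> maximal_dissipative_dissipative_ext[of \<kappa>] unbounded_dissipative_ext[of \<kappa>]
      symmetric_part_dissipative_ext[OF \<kappa>] by simp
qed

text \<open>
  If two parameters were possible, \<open>gm\<close> would lie in the range of \<open>1 - K\<close>.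
\<close>

lemma von_neumann_parameter_dissipative_ext:
  assumes \<kappa>: "cmod \<kappa> < 1"
  shows "(THE k. is_von_neumann_parameter H (dissipative_ext \<kappa>) gp gm k) = \<kappa>"
proof (rule the_equality)
  show "is_von_neumann_parameter H (dissipative_ext \<kappa>) gp gm \<kappa>"
    using \<kappa> dissipative_extI[OF gp, of \<kappa>] unfolding contraction_ext_gp is_von_neumann_parameter_def
    by blast
  fix k assume "is_von_neumann_parameter H (dissipative_ext \<kappa>) gp gm k"
  then obtain f' where "(gp \<ominus> k \<odot> gm, f') \<in> dissipative_ext \<kappa>"
    by (auto simp: is_von_neumann_parameter_def)
  then obtain h where h: "h \<in> carrier H" "gp \<ominus> k \<odot> gm = h \<ominus> contraction_ext \<kappa> h"
    by (rule dissipative_extE)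
  have "(gp \<ominus> h) \<ominus> contraction_ext \<kappa> (gp \<ominus> h) = (k - \<kappa>) \<odot> gm"
  proof (rule ip_eqI)
    fix w assume w: "w \<in> carrier H"
    have "ip H gp w - k * ip H gm w = ip H (gp \<ominus> k \<odot> gm) w"
      using w by (simp add: ip_simps)
    also have "\<dots> = ip H h w - ip H (contraction_ext \<kappa> h) w"
      unfolding h(2) using h(1) w by (simp add: ip_simps)
    finally have "ip H gp w - k * ip H gm w = ip H h w - ip H (contraction_ext \<kappa> h) w" .
    moreover have "ip H gm w = ip H gp (Ui w)" using ip_U_left[of gp w] w by simp
    ultimately show "ip H ((gp \<ominus> h) \<ominus> contraction_ext \<kappa> (gp \<ominus> h)) w = ip H ((k - \<kappa>) \<odot> gm) w"
      using h(1) w by (simp add: ip_simps ip_contraction_ext algebra_simps)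
  qed (use h in auto)
  note e = this
  have "gp \<ominus> h = \<zero>" by (rule contraction_ext_no_fixed[OF _ e]) (use h in auto)
  then have "(k - \<kappa>) \<odot> gm = \<zero> \<ominus> contraction_ext \<kappa> \<zero>" using e by simp
  then have "ip H ((k - \<kappa>) \<odot> gm) gm = ip H (\<zero> \<ominus> contraction_ext \<kappa> \<zero>) gm" by simp
  then show "k = \<kappa>" by (simp add: ip_simps ip_contraction_ext)
qed

end

text \<open>
  Conversely, let \<open>T\<close> be a maximal dissipative operator with symmetric part \<open>A0\<close>. Write an element of
  its graph as \<open>(h - k, i (h + k))\<close>. Since \<open>T\<close> and its adjoint both extend \<open>A0\<close>, the vector \<open>k - U h\<close>
  is orthogonal to \<open>Ran (A0 - i)\<close>, hence a multiple of \<open>gm\<close>; so \<open>T\<close> is described by the linear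
  relation between \<open>a = (h, gp)\<close> and \<open>b = (k, gm)\<close>. Dissipativity says \<open>|b| \<le> |a|\<close>, which makes the
  relation part of \<open>b = \<kappa> a\<close>, and maximality makes it equal. If \<open>|\<kappa>| = 1\<close>, then \<open>T\<close> would be
  symmetric and its symmetric part too large.
\<close>

context reference_model
begin

lemma dissipative_class_eq_dissipative_ext:
  assumes T: "T \<in> dissipative_class H" and A0_eq: "A0 = symmetric_part H T"
  obtains \<kappa> where "cmod \<kappa> < 1" "T = dissipative_ext \<kappa>"
proof -
  have diss: "dissipative_op H T" and lin: "linear_operator H T"
    and max: "\<And>B. dissipative_op H B \<Longrightarrow> T \<subseteq> B \<Longrightarrow> B = T"
    using T by (auto simp: dissipative_class_def maximal_dissipative_op_def dissipative_op_def)
  have Tc: "f \<in> carrier H" "f' \<in> carrier H" if "(f, f') \<in> T" for f f'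
    using lin that by (auto simp: linear_operator_def)
  have A0c: "u \<in> carrier H" "v \<in> carrier H" if "(u, v) \<in> A0" for u v
    using A0_linear that by (auto simp: linear_operator_def)
  have A0T: "A0 \<subseteq> T" unfolding A0_eq symmetric_part_def by auto
  have A0_sym: "ip H v u' = ip H u v'" if "(u, v) \<in> A0" "(u', v') \<in> A0" for u v u' v'
    using setting that by (auto simp: reference_setting_def symmetric_11_def symmetric_op_def)
  have A0_adj: "(u, v) \<in> adjoint_op H T" if uv: "(u, v) \<in> A0" for u v
  proof -
    obtain w where w: "(u, w) \<in> adjoint_op H T"
      using uv unfolding A0_eq symmetric_part_def by auto
    then have wc: "w \<in> carrier H" by (auto simp: adjoint_op_def)
    have "w \<ominus> v = \<zero>"
    proof (rule hdense_orthogonal[OF _ A0_dense])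
      fix a assume "a \<in> Domain A0"
      then obtain b where ab: "(a, b) \<in> A0" by auto
      have "ip H b u = ip H a w" using w ab A0T by (auto simp: adjoint_op_def)
      then show "ip H a (w \<ominus> v) = 0"
        using A0_sym[OF ab uv] A0c[OF ab] A0c[OF uv] wc by (simp add: ip_simps)
    qed (use A0c uv wc in auto)
    then have "w = v" by (rule minus_eq_zeroD) (use A0c[OF uv] wc in auto)
    then show ?thesis using w by simp
  qed
  have pair: "k = U h \<oplus> (ip H k gm - ip H h gp) \<odot> gm"
    if m: "(h \<ominus> k, \<i> \<odot> (h \<oplus> k)) \<in> T" and h: "h \<in> carrier H" and k: "k \<in> carrier H" for h k
  proof -
    have "ip H v (k \<ominus> U h) = cnj (- \<i>) * ip H u (k \<ominus> U h)" if uv: "(u, v) \<in> A0" for u v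
    proof -
      obtain g where g: "g \<in> carrier H" "u = g \<ominus> U g" "v = \<i> \<odot> (g \<oplus> U g)"
        using uv by (rule A0_elem)
      have "ip H (\<i> \<odot> (h \<oplus> k)) u = ip H (h \<ominus> k) v"
        using A0_adj[OF uv] m by (auto simp: adjoint_op_def)
      then have "ip H h g = ip H k (U g)"
        unfolding g(2,3) using g(1) h k by (simp add: ip_simps algebra_simps complex_eq_iff)
      then have "ip H g h = ip H (U g) k"
        using ip_commute[of g h] ip_commute[of "U g" k] g h k by simp
      then show ?thesis
        unfolding g(2,3) using g(1) h k by (simp add: ip_simps ip_unitary algebra_simps)
    qed
    then have "k \<ominus> U h \<in> deficiency_space H A0 (- \<i>)"
      unfolding deficiency_iff[OF minus_in_carrier[OF k U_in_carrier[OF h]]] by blast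
    then obtain c where c: "k \<ominus> U h = c \<odot> gm" using deficiency_minus_i_iff by blast
    have kw: "ip H k w - ip H (U h) w = c * ip H gm w" if "w \<in> carrier H" for w
      using arg_cong[OF c, of "\<lambda>x. ip H x w"] h k that by (simp add: ip_minus_left ip_smult_left)
    then have "c = ip H k gm - ip H h gp"
      using kw[OF gm] h by (simp add: ip_unitary)
    then show ?thesis
      using kw h k by (intro ip_eqI) (auto simp: ip_add_left ip_smult_left algebra_simps)
  qed
  have le: "cmod (ip H k gm) \<le> cmod (ip H h gp)"
    if m: "(h \<ominus> k, \<i> \<odot> (h \<oplus> k)) \<in> T" and h: "h \<in> carrier H" and k: "k \<in> carrier H" for h k
  proof -
    have "0 \<le> Im (ip H (\<i> \<odot> (h \<oplus> k)) (h \<ominus> k))"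
      using diss m unfolding dissipative_op_def by blast
    then have "(hnorm H k)\<^sup>2 \<le> (hnorm H h)\<^sup>2" using Im_cayley_pair[OF h k] by simp
    moreover have "(hnorm H k)\<^sup>2 = (hnorm H h)\<^sup>2 - (cmod (ip H h gp))\<^sup>2 + (cmod (ip H k gm))\<^sup>2"
      using hnorm_rank_one_change[OF h, of "ip H k gm"] pair[OF m h k] by simp
    ultimately have "(cmod (ip H k gm))\<^sup>2 \<le> (cmod (ip H h gp))\<^sup>2" by simp
    then show ?thesis by (rule power2_le_imp_le) simp
  qed
  have "\<exists>\<kappa>. cmod \<kappa> \<le> 1 \<and> (\<forall>h k. h \<in> carrier H \<longrightarrow> k \<in> carrier H \<longrightarrow>
      (h \<ominus> k, \<i> \<odot> (h \<oplus> k)) \<in> T \<longrightarrow> ip H k gm = \<kappa> * ip H h gp)"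
  proof (cases "\<exists>h k. h \<in> carrier H \<and> k \<in> carrier H \<and> (h \<ominus> k, \<i> \<odot> (h \<oplus> k)) \<in> T \<and> ip H h gp \<noteq> 0")
    case False
    have "ip H k gm = 0 * ip H h gp"
      if "h \<in> carrier H" "k \<in> carrier H" "(h \<ominus> k, \<i> \<odot> (h \<oplus> k)) \<in> T" for h k
    proof -
      have "ip H h gp = 0" using False that by blast
      then show ?thesis using le[OF that(3,1,2)] by simp
    qed
    then show ?thesis by (intro exI[of _ 0]) auto
  next
    case True
    then obtain h1 k1 where 1: "h1 \<in> carrier H" "k1 \<in> carrier H" "(h1 \<ominus> k1, \<i> \<odot> (h1 \<oplus> k1)) \<in> T"
      and a1: "ip H h1 gp \<noteq> 0" by blast
    have "ip H k gm = ip H k1 gm / ip H h1 gp * ip H h gp"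
      if hk: "h \<in> carrier H" "k \<in> carrier H" "(h \<ominus> k, \<i> \<odot> (h \<oplus> k)) \<in> T" for h k
    proof -
      define c where "c = - (ip H h gp / ip H h1 gp)"
      let ?h = "h \<oplus> c \<odot> h1" and ?k = "k \<oplus> c \<odot> k1"
      have "((h \<ominus> k) \<oplus> c \<odot> (h1 \<ominus> k1), (\<i> \<odot> (h \<oplus> k)) \<oplus> c \<odot> (\<i> \<odot> (h1 \<oplus> k1))) \<in> T"
        using lin hk(3) 1(3) unfolding linear_operator_def by simp
      also have "(h \<ominus> k) \<oplus> c \<odot> (h1 \<ominus> k1) = ?h \<ominus> ?k"
        using hk 1 by (intro ip_eqI) (auto simp: ip_simps algebra_simps)
      also have "(\<i> \<odot> (h \<oplus> k)) \<oplus> c \<odot> (\<i> \<odot> (h1 \<oplus> k1)) = \<i> \<odot> (?h \<oplus> ?k)"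
        using hk 1 by (intro ip_eqI) (auto simp: ip_simps algebra_simps)
      finally have "cmod (ip H ?k gm) \<le> cmod (ip H ?h gp)"
        using hk 1 by (intro le) auto
      moreover have "ip H ?h gp = 0" using hk 1 a1 by (simp add: ip_simps c_def)
      ultimately have "ip H k gm + c * ip H k1 gm = 0" using hk 1 by (simp add: ip_simps)
      then show ?thesis by (simp add: c_def add_eq_0_iff2)
    qed
    moreover have "cmod (ip H k1 gm / ip H h1 gp) \<le> 1"
      using le[OF 1(3,1,2)] a1 by (simp add: norm_divide)
    ultimately show ?thesis by blast
  qed
  then obtain \<kappa> where \<kappa>: "cmod \<kappa> \<le> 1"
    and lin_rel: "\<And>h k. \<lbrakk>h \<in> carrier H; k \<in> carrier H; (h \<ominus> k, \<i> \<odot> (h \<oplus> k)) \<in> T\<rbrakk> \<Longrightarrow> ip H k gm = \<kappa> * ip H h gp"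
    by blast
  have "T \<subseteq> dissipative_ext \<kappa>"
  proof (rule subrelI)
    fix f f' assume m: "(f, f') \<in> T"
    obtain h k where h: "h \<in> carrier H" "k \<in> carrier H" "f = h \<ominus> k" "f' = \<i> \<odot> (h \<oplus> k)"
      using Tc[OF m] by (rule cayley_pair_exists)
    then have m': "(h \<ominus> k, \<i> \<odot> (h \<oplus> k)) \<in> T" using m by simp
    have "k = contraction_ext \<kappa> h"
      using pair[OF m' h(1,2)] lin_rel[OF h(1,2) m'] by (simp add: contraction_ext_def left_diff_distrib)
    then show "(f, f') \<in> dissipative_ext \<kappa>"
      using dissipative_extI[OF h(1), of \<kappa>] h(3,4) by simp
  qed
  then have T_eq: "T = dissipative_ext \<kappa>"
    using max[OF dissipative_dissipative_ext[OF \<kappa>]] by simp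
  have "cmod \<kappa> \<noteq> 1"
  proof
    assume \<kappa>1: "cmod \<kappa> = 1"
    let ?K = "contraction_ext \<kappa>"
    have iso: "ip H h gp = ip H (?K h) (?K gp)" if h: "h \<in> carrier H" for h
    proof -
      have "ip H (?K h) (?K gp) = cnj \<kappa> * (ip H h gp + (\<kappa> - 1) * ip H h gp)"
        unfolding contraction_ext_gp using h by (simp add: ip_smult_right ip_contraction_ext)
      also have "\<dots> = (\<kappa> * cnj \<kappa>) * ip H h gp" by (simp add: algebra_simps)
      also have "\<kappa> * cnj \<kappa> = 1" using \<kappa>1 by (simp add: complex_norm_square[symmetric])
      finally show ?thesis by simp
    qed
    have "(gp \<ominus> ?K gp, \<i> \<odot> (gp \<oplus> ?K gp)) \<in> adjoint_op H T"
      unfolding T_eq using iso by (subst adjoint_dissipative_ext_iff) auto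
    then have m: "(gp \<ominus> ?K gp, \<i> \<odot> (gp \<oplus> ?K gp)) \<in> A0"
      unfolding A0_eq symmetric_part_def using dissipative_extI[OF gp, of \<kappa>] T_eq by auto
    obtain h where h: "h \<in> carrier H" "gp \<ominus> ?K gp = h \<ominus> U h" "\<i> \<odot> (gp \<oplus> ?K gp) = \<i> \<odot> (h \<oplus> U h)"
      using m by (rule A0_elem)
    have "gp = h \<and> ?K gp = U h"
      by (rule cayley_pair_eq[OF gp contraction_ext_in_carrier[OF gp] h(1) U_in_carrier[OF h(1)] h(2,3)])
    then have "?K gp = U gp" by metis
    then have "(gp \<ominus> U gp, \<i> \<odot> (gp \<oplus> U gp)) \<in> A0" using m by (simp only:)
    then have "ip H gp gp = 0" by (rule A0_perp_gp[OF _ gp])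
    then show False by simp
  qed
  then have "cmod \<kappa> < 1" using \<kappa> by simp
  then show thesis using T_eq that by blast
qed

end

section \<open>Orthogonal sums\<close>

text \<open>
  The sum is built inside a given type along an injection \<open>e\<close> of the pairs, so that it can live in the
  same type as its summands.
\<close>

definition hilbert_sum :: "('a \<times> 'b \<Rightarrow> 'c) \<Rightarrow> 'a ip_space \<Rightarrow> 'b ip_space \<Rightarrow> 'c ip_space" where
  "hilbert_sum e H1 H2 =
     \<lparr>carrier = e ` (carrier H1 \<times> carrier H2),
      monoid.mult = (\<lambda>x y. x),
      one = e (\<zero>\<^bsub>H1\<^esub>, \<zero>\<^bsub>H2\<^esub>),
      ring.zero = e (\<zero>\<^bsub>H1\<^esub>, \<zero>\<^bsub>H2\<^esub>),
      add = (\<lambda>x y. case (the_inv e x, the_inv e y) of ((x1, x2), (y1, y2)) \<Rightarrow> e (x1 \<oplus>\<^bsub>H1\<^esub> y1, x2 \<oplus>\<^bsub>H2\<^esub> y2)),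
      smult = (\<lambda>c x. case the_inv e x of (x1, x2) \<Rightarrow> e (c \<odot>\<^bsub>H1\<^esub> x1, c \<odot>\<^bsub>H2\<^esub> x2)),
      ip = (\<lambda>x y. case (the_inv e x, the_inv e y) of ((x1, x2), (y1, y2)) \<Rightarrow> ip H1 x1 y1 + ip H2 x2 y2)\<rparr>"

lemma mcomplete_isometric_image:
  assumes M: "Metric_space M d" and N: "Metric_space (f ` M) d'"
    and iso: "\<And>x y. \<lbrakk>x \<in> M; y \<in> M\<rbrakk> \<Longrightarrow> d' (f x) (f y) = d x y"
    and complete: "Metric_space.mcomplete M d"
  shows "Metric_space.mcomplete (f ` M) d'"
proof -
  interpret M: Metric_space M d by (rule M)
  interpret N: Metric_space "f ` M" d' by (rule N)
  show ?thesis
    unfolding N.mcomplete_def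
  proof (intro allI impI)
    fix v assume v: "N.MCauchy v"
    then have "v n \<in> f ` M" for n by (auto simp: N.MCauchy_def)
    then have "\<forall>n. \<exists>x. x \<in> M \<and> v n = f x" by blast
    then obtain u where u: "\<And>n. u n \<in> M" "\<And>n. v n = f (u n)" by metis
    have "M.MCauchy u"
      using v u by (auto simp: N.MCauchy_def M.MCauchy_def iso)
    then obtain x where x: "limitin M.mtopology u x sequentially"
      using complete unfolding M.mcomplete_def by blast
    then have "x \<in> M" by (simp add: M.limitin_metric_dist_null)
    then have "limitin N.mtopology v (f x) sequentially"
      using x u by (simp add: M.limitin_metric_dist_null N.limitin_metric_dist_null iso)
    then show "\<exists>y. limitin N.mtopology v y sequentially" by blast
  qed
qed

locale hilbert_pair = H1: hilbert_space H1 + H2: hilbert_space H2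
  for H1 :: "'a ip_space" and H2 :: "'b ip_space" +
  fixes e :: "'a \<times> 'b \<Rightarrow> 'c"
  assumes inj_e: "inj e"
begin

abbreviation "HS \<equiv> hilbert_sum e H1 H2"

lemma sum_sel:
  "carrier HS = e ` (carrier H1 \<times> carrier H2)"
  "\<zero>\<^bsub>HS\<^esub> = e (\<zero>\<^bsub>H1\<^esub>, \<zero>\<^bsub>H2\<^esub>)"
  "e (x, y) \<oplus>\<^bsub>HS\<^esub> e (x', y') = e (x \<oplus>\<^bsub>H1\<^esub> x', y \<oplus>\<^bsub>H2\<^esub> y')"
  "c \<odot>\<^bsub>HS\<^esub> e (x, y) = e (c \<odot>\<^bsub>H1\<^esub> x, c \<odot>\<^bsub>H2\<^esub> y)"
  "ip HS (e (x, y)) (e (x', y')) = ip H1 x x' + ip H2 y y'"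
  by (simp_all add: hilbert_sum_def the_inv_f_f[OF inj_e])

lemma e_eq [simp]: "e p = e q \<longleftrightarrow> p = q"
  using inj_e by (auto dest: injD)

lemma e_in_sum [simp]: "e (x, y) \<in> carrier HS \<longleftrightarrow> x \<in> carrier H1 \<and> y \<in> carrier H2"
  by (auto simp: sum_sel(1))

lemma sum_cases:
  assumes "p \<in> carrier HS"
  obtains x y where "x \<in> carrier H1" "y \<in> carrier H2" "p = e (x, y)"
  using assms by (auto simp: sum_sel(1))

lemma sum_minus:
  assumes "abelian_group HS" "x \<in> carrier H1" "x' \<in> carrier H1" "y \<in> carrier H2" "y' \<in> carrier H2"
  shows "e (x, y) \<ominus>\<^bsub>HS\<^esub> e (x', y') = e (x \<ominus>\<^bsub>H1\<^esub> x', y \<ominus>\<^bsub>H2\<^esub> y')"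
proof -
  interpret S: abelian_group HS by (rule assms(1))
  have "\<ominus>\<^bsub>HS\<^esub> e (x', y') = e (\<ominus>\<^bsub>H1\<^esub> x', \<ominus>\<^bsub>H2\<^esub> y')"
    by (rule S.minus_equality)
      (use assms(2-5) in \<open>simp_all add: sum_sel(2,3) H1.M.l_neg H2.M.l_neg\<close>)
  then show ?thesis
    by (simp add: a_minus_def sum_sel(3))
qed

lemma abelian_group_sum: "abelian_group HS"
proof (rule abelian_groupI)
  fix p q r assume p: "p \<in> carrier HS" and q: "q \<in> carrier HS" and r: "r \<in> carrier HS"
  then show "p \<oplus>\<^bsub>HS\<^esub> q \<in> carrier HS"
    by (auto elim!: sum_cases simp: sum_sel(3))
  show "p \<oplus>\<^bsub>HS\<^esub> q \<oplus>\<^bsub>HS\<^esub> r = p \<oplus>\<^bsub>HS\<^esub> (q \<oplus>\<^bsub>HS\<^esub> r)"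
    using p q r by (auto elim!: sum_cases simp: sum_sel(3) H1.M.a_assoc H2.M.a_assoc)
next
  fix p q assume p: "p \<in> carrier HS" and q: "q \<in> carrier HS"
  show "p \<oplus>\<^bsub>HS\<^esub> q = q \<oplus>\<^bsub>HS\<^esub> p"
    using p q by (auto elim!: sum_cases simp: sum_sel(3) H1.M.a_comm H2.M.a_comm)
next
  fix p assume p: "p \<in> carrier HS"
  show "\<zero>\<^bsub>HS\<^esub> \<oplus>\<^bsub>HS\<^esub> p = p"
    using p by (auto elim!: sum_cases simp: sum_sel(2,3))
  obtain x y where xy: "x \<in> carrier H1" "y \<in> carrier H2" "p = e (x, y)" using p by (rule sum_cases)
  show "\<exists>q \<in> carrier HS. q \<oplus>\<^bsub>HS\<^esub> p = \<zero>\<^bsub>HS\<^esub>"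
    by (rule bexI[of _ "e (\<ominus>\<^bsub>H1\<^esub> x, \<ominus>\<^bsub>H2\<^esub> y)"])
      (use xy in \<open>simp_all add: sum_sel(2,3) H1.M.l_neg H2.M.l_neg\<close>)
qed (simp add: sum_sel(2))

lemma hdist_sum:
  assumes "p \<in> carrier H1 \<times> carrier H2" "q \<in> carrier H1 \<times> carrier H2"
  shows "hdist HS (e p) (e q) = prod_dist (hdist H1) (hdist H2) p q"
proof -
  obtain x y x' y' where pq: "p = (x, y)" "q = (x', y')" by (cases p, cases q) auto
  have c: "x \<in> carrier H1" "x' \<in> carrier H1" "y \<in> carrier H2" "y' \<in> carrier H2"
    using assms by (auto simp: pq)
  show ?thesis
    using c unfolding pq prod_dist_def
    by (simp add: hdist_def hnorm_def[of HS] sum_minus[OF abelian_group_sum] sum_sel(5)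
        H1.hnorm_squared H2.hnorm_squared)
qed

lemma hilbert_space_sum: "hilbert_space HS"
proof (intro hilbert_space.intro hilbert_space_axioms.intro)
  show "module (ring_of_type_algebra :: complex ring) HS"
  proof (rule moduleI)
    show "cring (ring_of_type_algebra :: complex ring)" by (rule cring_from_type_algebra)
    show "abelian_group HS" by (rule abelian_group_sum)
  qed (auto elim!: sum_cases simp: sum_sel(3,4) ring_of_type_algebra_def
      intro!: H1.ip_eqI H2.ip_eqI simp: H1.ip_simps H2.ip_simps algebra_simps)
  show "ip HS (p \<oplus>\<^bsub>HS\<^esub> q) r = ip HS p r + ip HS q r"
    if "p \<in> carrier HS" "q \<in> carrier HS" "r \<in> carrier HS" for p q r
    using that by (auto elim!: sum_cases simp: sum_sel(3,5) H1.ip_simps H2.ip_simps)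
  show "ip HS (c \<odot>\<^bsub>HS\<^esub> p) r = c * ip HS p r"
    if "p \<in> carrier HS" "r \<in> carrier HS" for p r c
    using that by (auto elim!: sum_cases simp: sum_sel(4,5) H1.ip_simps H2.ip_simps algebra_simps)
  show "ip HS p q = cnj (ip HS q p)" if pq: "p \<in> carrier HS" "q \<in> carrier HS" for p q
  proof -
    obtain x y where p: "x \<in> carrier H1" "y \<in> carrier H2" "p = e (x, y)" using pq(1) by (rule sum_cases)
    obtain x' y' where q: "x' \<in> carrier H1" "y' \<in> carrier H2" "q = e (x', y')" using pq(2) by (rule sum_cases)
    show ?thesis
      using p q H1.ip_commute[of x x'] H2.ip_commute[of y y'] by (simp add: sum_sel(5))
  qed
  show "0 \<le> Re (ip HS p p)" if "p \<in> carrier HS" for p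
    using that by (auto elim!: sum_cases simp: sum_sel(5) H1.ip_nonneg H2.ip_nonneg)
  show "p = \<zero>\<^bsub>HS\<^esub>" if pc: "p \<in> carrier HS" and p0: "ip HS p p = 0" for p
  proof -
    obtain x y where p: "x \<in> carrier H1" "y \<in> carrier H2" "p = e (x, y)" using pc by (rule sum_cases)
    have "complex_of_real ((hnorm H1 x)\<^sup>2 + (hnorm H2 y)\<^sup>2) = 0"
      using p0 p by (simp add: sum_sel(5) H1.ip_self H2.ip_self)
    then have "(hnorm H1 x)\<^sup>2 + (hnorm H2 y)\<^sup>2 = 0" by (simp only: of_real_eq_0_iff)
    then have "hnorm H1 x = 0" "hnorm H2 y = 0" by (simp_all add: sum_power2_eq_zero_iff)
    then show ?thesis using p by (simp add: sum_sel(2))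
  qed
  interpret D: Metric_space12 "carrier H1" "hdist H1" "carrier H2" "hdist H2"
    by (intro Metric_space12.intro H1.Metric_space_hdist H2.Metric_space_hdist)
  have "Metric_space (carrier HS) (hdist HS)"
  proof
    fix p q r
    show "0 \<le> hdist HS p q"
      by (cases "p \<in> carrier HS \<and> q \<in> carrier HS")
        (auto elim!: sum_cases simp: hdist_sum, auto simp: hdist_def)
    show "hdist HS p q = hdist HS q p"
      by (cases "p \<in> carrier HS \<and> q \<in> carrier HS")
        (auto elim!: sum_cases simp: hdist_sum D.Prod_metric.commute, auto simp: hdist_def)
    show "hdist HS p q = 0 \<longleftrightarrow> p = q" if "p \<in> carrier HS" "q \<in> carrier HS"
      using that by (auto elim!: sum_cases simp: hdist_sum)
    show "hdist HS p r \<le> hdist HS p q + hdist HS q r"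
      if "p \<in> carrier HS" "q \<in> carrier HS" "r \<in> carrier HS"
      using that by (auto elim!: sum_cases simp: hdist_sum D.Prod_metric.triangle)
  qed
  then show "Metric_space.mcomplete (carrier HS) (hdist HS)"
    unfolding sum_sel(1)
    by (rule mcomplete_isometric_image[OF D.Prod_metric.Metric_space_axioms])
      (use hdist_sum D.mcomplete_prod_metric H1.complete H2.complete in auto)
qed

sublocale S: hilbert_space HS
  by (rule hilbert_space_sum)

lemmas sum_simps = sum_sel(2-5) sum_minus[OF abelian_group_sum]

end

lemma ex_inj_pairs:
  assumes "infinite (UNIV :: 'a set)"
  obtains e :: "'a \<times> 'a \<Rightarrow> 'a" where "inj e"
proof -
  have "\<exists>f. inj_on f ((UNIV :: 'a set) \<times> (UNIV :: 'a set)) \<and> f ` (UNIV \<times> UNIV) \<subseteq> (UNIV :: 'a set)"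
    unfolding card_of_ordLeq
    by (rule ordIso_imp_ordLeq[OF card_of_Times_same_infinite[OF assms]])
  then show thesis
    using that by auto
qed

text \<open>
  The type of a nonzero Hilbert space contains a copy of the complex numbers. It is therefore large
  enough to hold the sum of two such spaces.
\<close>

lemma (in hilbert_space) infinite_type:
  assumes g: "g \<in> carrier H" "g \<noteq> \<zero>"
  shows "infinite (UNIV :: 'a set)"
proof -
  have "inj (\<lambda>c. c \<odot> g)"
  proof (rule injI)
    fix c d :: complex assume "c \<odot> g = d \<odot> g"
    then have "ip H (c \<odot> g) g = ip H (d \<odot> g) g" by simp
    then have "c * ip H g g = d * ip H g g" using g by (simp add: ip_smult_left)
    moreover have "ip H g g \<noteq> 0" using ip_definite g by blast
    ultimately show "c = d" by simp
  qed
  then have "infinite (range (\<lambda>c :: complex. c \<odot> g))"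
    by (simp add: finite_image_iff infinite_UNIV_char_0)
  then show ?thesis
    by (rule infinite_super[OF subset_UNIV])
qed

section \<open>The three classes in terms of unitary models\<close>

text \<open>
  The three functions are \<open>i (2 p - 1)\<close>, \<open>1 - 1 / p\<close> and a Moebius transform of the latter, where \<open>p\<close> is
  the Caratheodory function of a unitary model at \<open>\<zeta> = (z - i) / (z + i)\<close>. Since \<open>Re p > 1/2\<close>, they have
  values in the half-plane and in the disk. So each of the classes consists of all functions that a
  unitary model, and a number \<open>\<kappa>\<close> in the third case, gives rise to.
\<close>

definition moebius :: "complex \<Rightarrow> complex \<Rightarrow> complex" where
  "moebius \<kappa> s = (s - \<kappa>) / (cnj \<kappa> * s - 1)"

lemma unitary_model_weyl:
  assumes "unitary_model H U Ui gp gm" and "z \<in> upper_half_plane"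
  shows "\<i> * (2 * unitary_model.pfun H Ui gp (cayley_point z) - 1) \<in> upper_half_plane"
proof -
  interpret unitary_model H U Ui gp gm by fact
  show ?thesis
    using Re_pfun_gt[of "cayley_point z"] cayley_point_less_1[of z] assms(2)
    by (simp add: upper_half_plane_def)
qed

lemma unitary_model_livsic_less_1:
  assumes "unitary_model H U Ui gp gm" and "z \<in> upper_half_plane"
  shows "cmod (1 - 1 / unitary_model.pfun H Ui gp (cayley_point z)) < 1"
proof -
  interpret unitary_model H U Ui gp gm by fact
  let ?p = "pfun (cayley_point z)"
  have z: "cmod (cayley_point z) < 1" using assms(2) by (simp add: upper_half_plane_def cayley_point_less_1)
  have "(cmod (?p - 1))\<^sup>2 < (cmod ?p)\<^sup>2"
    using Re_pfun_gt[OF z] unfolding cmod_power2 by (simp add: power2_eq_square algebra_simps)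
  then have "cmod (?p - 1) < cmod ?p" by (rule power2_less_imp_less) simp
  moreover have "1 - 1 / ?p = (?p - 1) / ?p" using pfun_nonzero[OF z] by (simp add: field_simps)
  ultimately show ?thesis
    using pfun_nonzero[OF z] by (simp add: norm_divide)
qed

lemma unitary_model_holomorphic:
  assumes "unitary_model H U Ui gp gm"
  shows "(\<lambda>z. unitary_model.pfun H Ui gp (cayley_point z)) holomorphic_on upper_half_plane"
proof -
  interpret unitary_model H U Ui gp gm by fact
  have "cayley_point ` upper_half_plane \<subseteq> ball 0 1"
    by (auto simp: upper_half_plane_def cayley_point_less_1)
  then show ?thesis
    using holomorphic_on_compose_gen[OF cayley_point_holomorphic pfun_holomorphic] by (simp add: o_def)
qed

lemma unitary_model_pfun_nonzero:
  assumes "unitary_model H U Ui gp gm" and "z \<in> upper_half_plane"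
  shows "unitary_model.pfun H Ui gp (cayley_point z) \<noteq> 0"
  using unitary_model.pfun_nonzero[OF assms(1)] assms(2)
  by (simp add: upper_half_plane_def cayley_point_less_1)

lemma weyl_titchmarsh_class_iff:
  "m \<in> weyl_titchmarsh_class TYPE('a) \<longleftrightarrow>
    (\<exists>(H :: 'a ip_space) U Ui gp gm. unitary_model H U Ui gp gm \<and>
      (\<forall>z \<in> upper_half_plane. m z = \<i> * (2 * unitary_model.pfun H Ui gp (cayley_point z) - 1)))"
  (is "?l \<longleftrightarrow> ?r")
proof
  assume ?l
  then obtain H :: "'a ip_space" and A0 A gp gm where r: "reference_setting H A0 A gp gm"
    and m: "\<And>z. z \<in> upper_half_plane \<Longrightarrow> m z = weyl_titchmarsh_function H A gp z"
    by (auto simp: weyl_titchmarsh_class_def)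
  obtain U Ui where "reference_model H U Ui A0 A gp gm" using r by (rule reference_setting_model)
  then interpret reference_model H U Ui A0 A gp gm .
  show ?r
    using m weyl_titchmarsh_function_eq unitary_model_axioms
    by (intro exI[of _ H] exI[of _ U] exI[of _ Ui] exI[of _ gp] exI[of _ gm])
      (auto simp: upper_half_plane_def)
next
  assume ?r
  then obtain H :: "'a ip_space" and U Ui gp gm where model: "unitary_model H U Ui gp gm"
    and m: "\<And>z. z \<in> upper_half_plane \<Longrightarrow> m z = \<i> * (2 * unitary_model.pfun H Ui gp (cayley_point z) - 1)"
    by blast
  interpret unitary_model H U Ui gp gm by (rule model)
  interpret R: reference_model H U Ui "inverse_cayley H U perp_gp" "inverse_cayley H U (carrier H)" gp gm
    by (rule reference_model_inverse_cayley)
  have "m holomorphic_on upper_half_plane"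
    using unitary_model_holomorphic[OF model]
    by (intro holomorphic_transform[OF _ m[symmetric]] holomorphic_intros)
  moreover have "m ` upper_half_plane \<subseteq> upper_half_plane"
    using m unitary_model_weyl[OF model] by auto
  moreover have "m z = weyl_titchmarsh_function H (inverse_cayley H U (carrier H)) gp z" if "z \<in> upper_half_plane" for z
    using m[OF that] R.weyl_titchmarsh_function_eq that by (simp add: upper_half_plane_def)
  ultimately show ?l
    unfolding weyl_titchmarsh_class_def using R.setting by blast
qed

lemma livsic_class_iff:
  "s \<in> livsic_class TYPE('a) \<longleftrightarrow>
    (\<exists>(H :: 'a ip_space) U Ui gp gm. unitary_model H U Ui gp gm \<and>
      (\<forall>z \<in> upper_half_plane. s z = 1 - 1 / unitary_model.pfun H Ui gp (cayley_point z)))"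
  (is "?l \<longleftrightarrow> ?r")
proof
  assume ?l
  then obtain H :: "'a ip_space" and A0 A gp gm where r: "reference_setting H A0 A gp gm"
    and s: "\<And>z. z \<in> upper_half_plane \<Longrightarrow> s z = livsic_function H A0 gp gm z"
    by (auto simp: livsic_class_def)
  obtain U Ui where "reference_model H U Ui A0 A gp gm" using r by (rule reference_setting_model)
  then interpret reference_model H U Ui A0 A gp gm .
  show ?r
    using s livsic_function_eq unitary_model_axioms
    by (intro exI[of _ H] exI[of _ U] exI[of _ Ui] exI[of _ gp] exI[of _ gm])
      (auto simp: upper_half_plane_def)
next
  assume ?r
  then obtain H :: "'a ip_space" and U Ui gp gm where model: "unitary_model H U Ui gp gm"
    and s: "\<And>z. z \<in> upper_half_plane \<Longrightarrow> s z = 1 - 1 / unitary_model.pfun H Ui gp (cayley_point z)"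
    by blast
  interpret unitary_model H U Ui gp gm by (rule model)
  interpret R: reference_model H U Ui "inverse_cayley H U perp_gp" "inverse_cayley H U (carrier H)" gp gm
    by (rule reference_model_inverse_cayley)
  have "s holomorphic_on upper_half_plane"
    using unitary_model_holomorphic[OF model] unitary_model_pfun_nonzero[OF model]
    by (intro holomorphic_transform[OF _ s[symmetric]] holomorphic_intros)
  moreover have "s ` upper_half_plane \<subseteq> ball 0 1"
    using s unitary_model_livsic_less_1[OF model] by auto
  moreover have "s z = livsic_function H (inverse_cayley H U perp_gp) gp gm z" if "z \<in> upper_half_plane" for z
    using s[OF that] R.livsic_function_eq that by (simp add: upper_half_plane_def)
  ultimately show ?l
    unfolding livsic_class_def using R.setting by blast
qed

lemma characteristic_class_iff:
  "S \<in> characteristic_class TYPE('a) \<longleftrightarrow>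
    (\<exists>(H :: 'a ip_space) U Ui gp gm \<kappa>. unitary_model H U Ui gp gm \<and> cmod \<kappa> < 1 \<and>
      (\<forall>z \<in> upper_half_plane. S z = moebius \<kappa> (1 - 1 / unitary_model.pfun H Ui gp (cayley_point z))))"
  (is "?l \<longleftrightarrow> ?r")
proof
  assume ?l
  then obtain H :: "'a ip_space" and T A gp gm where T: "T \<in> dissipative_class H"
    and r: "reference_setting H (symmetric_part H T) A gp gm"
    and S: "\<And>z. z \<in> upper_half_plane \<Longrightarrow> S z = characteristic_function H T gp gm z"
    by (auto simp: characteristic_class_def)
  obtain U Ui where "reference_model H U Ui (symmetric_part H T) A gp gm"
    using r by (rule reference_setting_model)
  then interpret reference_model H U Ui "symmetric_part H T" A gp gm .
  obtain \<kappa> where \<kappa>: "cmod \<kappa> < 1" and T_eq: "T = dissipative_ext \<kappa>"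
    by (rule dissipative_class_eq_dissipative_ext[OF T refl])
  have "(THE k. is_von_neumann_parameter H T gp gm k) = \<kappa>"
    unfolding T_eq by (rule von_neumann_parameter_dissipative_ext[OF \<kappa>])
  then show ?r
    using S livsic_function_eq \<kappa> unitary_model_axioms
    by (intro exI[of _ H] exI[of _ U] exI[of _ Ui] exI[of _ gp] exI[of _ gm] exI[of _ \<kappa>])
      (auto simp: upper_half_plane_def characteristic_function_def moebius_def Let_def)
next
  assume ?r
  then obtain H :: "'a ip_space" and U Ui gp gm \<kappa> where model: "unitary_model H U Ui gp gm"
    and \<kappa>: "cmod \<kappa> < 1"
    and S: "\<forall>z \<in> upper_half_plane. S z = moebius \<kappa> (1 - 1 / unitary_model.pfun H Ui gp (cayley_point z))"
    by blast
  interpret unitary_model H U Ui gp gm by (rule model)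
  interpret R: reference_model H U Ui "inverse_cayley H U perp_gp" "inverse_cayley H U (carrier H)" gp gm
    by (rule reference_model_inverse_cayley)
  have "S z = characteristic_function H (dissipative_ext \<kappa>) gp gm z" if "z \<in> upper_half_plane" for z
    using S that R.livsic_function_eq[of z]
    by (auto simp: upper_half_plane_def characteristic_function_def moebius_def Let_def
        von_neumann_parameter_dissipative_ext[OF \<kappa>] symmetric_part_dissipative_ext[OF \<kappa>])
  moreover have "reference_setting H (symmetric_part H (dissipative_ext \<kappa>)) (inverse_cayley H U (carrier H)) gp gm"
    unfolding symmetric_part_dissipative_ext[OF \<kappa>] by (rule R.setting)
  ultimately show ?l
    unfolding characteristic_class_def mem_Collect_eq
    by (intro exI[of _ H] exI[of _ "dissipative_ext \<kappa>"] exI[of _ "inverse_cayley H U (carrier H)"]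
        exI[of _ gp] exI[of _ gm] conjI ballI dissipative_class_dissipative_ext[OF \<kappa>])
qed

section \<open>Convex combinations\<close>

definition sum_map :: "('a \<times> 'b \<Rightarrow> 'c) \<Rightarrow> ('a \<Rightarrow> 'a) \<Rightarrow> ('b \<Rightarrow> 'b) \<Rightarrow> 'c \<Rightarrow> 'c" where
  "sum_map e f g p = (case the_inv e p of (x, y) \<Rightarrow> e (f x, g y))"

text \<open>
  For the orthogonal sum of two models with \<open>g\<^sub>+\<close> having the components \<open>sqrt t g\<^sub>1\<close> and \<open>sqrt (1 - t) g\<^sub>2\<close> the
  spectral measure of \<open>g\<^sub>+\<close> is the convex combination of those of \<open>g\<^sub>1\<close> and \<open>g\<^sub>2\<close>.
\<close>

lemma unitary_model_convex:
  fixes H1 :: "'a ip_space" and H2 :: "'b ip_space" and e :: "'a \<times> 'b \<Rightarrow> 'c" and t :: real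
  assumes M1: "unitary_model H1 U1 Ui1 gp1 gm1" and M2: "unitary_model H2 U2 Ui2 gp2 gm2"
    and e: "inj e" and t: "0 \<le> t" "t \<le> 1"
  obtains H :: "'c ip_space" and U Ui gp gm where "unitary_model H U Ui gp gm"
    and "\<And>\<zeta>. cmod \<zeta> < 1 \<Longrightarrow> unitary_model.pfun H Ui gp \<zeta> =
      of_real t * unitary_model.pfun H1 Ui1 gp1 \<zeta> + of_real (1 - t) * unitary_model.pfun H2 Ui2 gp2 \<zeta>"
proof -
  interpret M1: unitary_model H1 U1 Ui1 gp1 gm1 by (rule M1)
  interpret M2: unitary_model H2 U2 Ui2 gp2 gm2 by (rule M2)
  interpret hilbert_pair H1 H2 e by unfold_locales (rule e)
  define a b where "a = complex_of_real (sqrt t)" and "b = complex_of_real (sqrt (1 - t))"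
  have aa: "a * cnj a = of_real t" "b * cnj b = of_real (1 - t)"
    using t by (auto simp: a_def b_def simp flip: of_real_mult)
  define U Ui where "U = sum_map e U1 U2" and "Ui = sum_map e Ui1 Ui2"
  have U: "U (e (x, y)) = e (U1 x, U2 y)" and Ui: "Ui (e (x, y)) = e (Ui1 x, Ui2 y)" for x y
    by (simp_all add: U_def Ui_def sum_map_def the_inv_f_f[OF inj_e])
  define gp gm where "gp = e (a \<odot>\<^bsub>H1\<^esub> gp1, b \<odot>\<^bsub>H2\<^esub> gp2)" and "gm = e (a \<odot>\<^bsub>H1\<^esub> gm1, b \<odot>\<^bsub>H2\<^esub> gm2)"
  have "unitary_model HS U Ui gp gm"
  proof
    show "unitary_pair (carrier HS) (ip HS) U Ui"
      unfolding unitary_pair_def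
      by (auto elim!: sum_cases simp: U Ui sum_simps M1.ip_U_left M2.ip_U_left)
    show "gp \<in> carrier HS" by (simp add: gp_def)
    show "gm = U gp" by (simp add: gp_def gm_def U M1.U_smult M2.U_smult)
    show "ip HS gp gp = 1"
    proof -
      have "ip HS gp gp = a * cnj a + b * cnj b"
        by (simp add: gp_def sum_simps M1.ip_simps M2.ip_simps)
      then show ?thesis by (simp add: aa)
    qed
    fix h c assume h: "h \<in> carrier HS" and f: "Ui h \<ominus>\<^bsub>HS\<^esub> h = c \<odot>\<^bsub>HS\<^esub> gp"
    obtain x y where xy: "x \<in> carrier H1" "y \<in> carrier H2" "h = e (x, y)" using h by (rule sum_cases)
    have "Ui1 x \<ominus>\<^bsub>H1\<^esub> x = (c * a) \<odot>\<^bsub>H1\<^esub> gp1" "Ui2 y \<ominus>\<^bsub>H2\<^esub> y = (c * b) \<odot>\<^bsub>H2\<^esub> gp2"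
      using f xy by (simp_all add: Ui gp_def sum_simps M1.smult_smult M2.smult_smult)
    then have "x = \<zero>\<^bsub>H1\<^esub>" "y = \<zero>\<^bsub>H2\<^esub>"
      using M1.no_fixed[OF xy(1)] M2.no_fixed[OF xy(2)] by auto
    then show "h = \<zero>\<^bsub>HS\<^esub>" using xy by (simp add: sum_simps)
  qed
  then interpret M: unitary_model HS U Ui gp gm .
  have "M.pfun \<zeta> = of_real t * M1.pfun \<zeta> + of_real (1 - t) * M2.pfun \<zeta>" if \<zeta>: "cmod \<zeta> < 1" for \<zeta>
  proof -
    let ?k = "e (a \<odot>\<^bsub>H1\<^esub> M1.kvec \<zeta>, b \<odot>\<^bsub>H2\<^esub> M2.kvec \<zeta>)"
    note k1 = M1.kvec[OF \<zeta>] and k2 = M2.kvec[OF \<zeta>]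
    have kc: "?k \<in> carrier HS" using k1(1) k2(1) by simp
    have "?k \<ominus>\<^bsub>HS\<^esub> \<zeta> \<odot>\<^bsub>HS\<^esub> Ui ?k = gp"
      using k1(1) k2(1) by (simp add: Ui sum_simps M1.kvec_smult[OF \<zeta>] M2.kvec_smult[OF \<zeta>] gp_def)
    then have "?k \<ominus>\<^bsub>HS\<^esub> \<zeta> \<odot>\<^bsub>HS\<^esub> Ui ?k = 1 \<odot>\<^bsub>HS\<^esub> gp" by simp
    then have "?k = 1 \<odot>\<^bsub>HS\<^esub> M.kvec \<zeta>" by (rule M.kvec_unique[OF \<zeta> kc])
    then have "M.kvec \<zeta> = ?k" using M.kvec(1)[OF \<zeta>] by simp
    then have "M.pfun \<zeta> = ip HS ?k gp" unfolding M.pfun_def by simp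
    also have "\<dots> = (a * cnj a) * M1.pfun \<zeta> + (b * cnj b) * M2.pfun \<zeta>"
      unfolding gp_def using k1(1) k2(1)
      by (simp add: M1.pfun_def M2.pfun_def sum_simps M1.ip_simps M2.ip_simps algebra_simps)
    finally have "M.pfun \<zeta> = (a * cnj a) * M1.pfun \<zeta> + (b * cnj b) * M2.pfun \<zeta>" .
    then show ?thesis unfolding aa .
  qed
  then show thesis by (rule that[OF M.unitary_model_axioms])
qed

lemma (in unitary_model) infinite_model_type: "infinite (UNIV :: 'a set)"
proof (rule infinite_type[OF gp])
  show "gp \<noteq> \<zero>" using hnorm_eq_0[OF gp] by (simp add: hnorm_def)
qed

lemma weyl_titchmarsh_class_convex:
  fixes f g :: "complex \<Rightarrow> complex" and t :: real
  assumes f: "f \<in> weyl_titchmarsh_class TYPE('a)" and g: "g \<in> weyl_titchmarsh_class TYPE('a)"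
    and t: "0 \<le> t" "t \<le> 1"
  shows "(\<lambda>z. of_real t * f z + of_real (1 - t) * g z) \<in> weyl_titchmarsh_class TYPE('a)"
proof -
  obtain H1 :: "'a ip_space" and U1 Ui1 gp1 gm1 where M1: "unitary_model H1 U1 Ui1 gp1 gm1"
    and f: "\<And>z. z \<in> upper_half_plane \<Longrightarrow> f z = \<i> * (2 * unitary_model.pfun H1 Ui1 gp1 (cayley_point z) - 1)"
    using f unfolding weyl_titchmarsh_class_iff by blast
  obtain H2 :: "'a ip_space" and U2 Ui2 gp2 gm2 where M2: "unitary_model H2 U2 Ui2 gp2 gm2"
    and g: "\<And>z. z \<in> upper_half_plane \<Longrightarrow> g z = \<i> * (2 * unitary_model.pfun H2 Ui2 gp2 (cayley_point z) - 1)"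
    using g unfolding weyl_titchmarsh_class_iff by blast
  obtain e :: "'a \<times> 'a \<Rightarrow> 'a" where e: "inj e"
    using ex_inj_pairs[OF unitary_model.infinite_model_type[OF M1]] by blast
  obtain H :: "'a ip_space" and U Ui gp gm where M: "unitary_model H U Ui gp gm"
    and p: "\<And>\<zeta>. cmod \<zeta> < 1 \<Longrightarrow> unitary_model.pfun H Ui gp \<zeta> =
      of_real t * unitary_model.pfun H1 Ui1 gp1 \<zeta> + of_real (1 - t) * unitary_model.pfun H2 Ui2 gp2 \<zeta>"
    by (rule unitary_model_convex[OF M1 M2 e t]) blast
  have "of_real t * f z + of_real (1 - t) * g z = \<i> * (2 * unitary_model.pfun H Ui gp (cayley_point z) - 1)"
    if z: "z \<in> upper_half_plane" for z
  proof -
    have "cmod (cayley_point z) < 1"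
      using z by (simp add: upper_half_plane_def cayley_point_less_1)
    then show ?thesis
      unfolding f[OF z] g[OF z] by (simp add: p algebra_simps)
  qed
  then show ?thesis
    unfolding weyl_titchmarsh_class_iff using M by blast
qed

section \<open>Unitary colligations\<close>

definition colligation_ip :: "'a ip_space \<Rightarrow> 'a \<times> complex \<Rightarrow> 'a \<times> complex \<Rightarrow> complex" where
  "colligation_ip H p q = ip H (fst p) (fst q) + snd p * cnj (snd q)"

text \<open>
  A colligation is a unitary operator \<open>V\<close> on the sum of a state space \<open>H\<close> and the line, which maps a state
  and an input to a new state and an output. The condition that no nonzero state is stationary
  under any input is the density condition of unitary models; it is inherited by cascades at once,
  which is what makes colligations suitable for products.
\<close>

locale colligation = hilbert_space H for H :: "'a ip_space" (structure) +
  fixes V Vi :: "'a \<times> complex \<Rightarrow> 'a \<times> complex"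
  assumes unitary: "unitary_pair (carrier H \<times> UNIV) (colligation_ip H) V Vi"
    and no_fixed_state: "\<lbrakk>x \<in> carrier H; V (x, u) = (x, v)\<rbrakk> \<Longrightarrow> x = \<zero>"
begin

lemma fst_V_in_carrier [simp]: "x \<in> carrier H \<Longrightarrow> fst (V (x, u)) \<in> carrier H"
  and fst_Vi_in_carrier [simp]: "x \<in> carrier H \<Longrightarrow> fst (Vi (x, u)) \<in> carrier H"
  and Vi_V: "x \<in> carrier H \<Longrightarrow> Vi (V (x, u)) = (x, u)"
  and V_Vi: "x \<in> carrier H \<Longrightarrow> V (Vi (x, u)) = (x, u)"
  using unitary unfolding unitary_pair_def by (auto simp: mem_Times_iff)

lemma V_adjoint:
  assumes "x \<in> carrier H" "y \<in> carrier H"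
  shows "ip H (fst (V (x, u))) y + snd (V (x, u)) * cnj v = ip H x (fst (Vi (y, v))) + u * cnj (snd (Vi (y, v)))"
proof -
  have "colligation_ip H (V (x, u)) (y, v) = colligation_ip H (x, u) (Vi (y, v))"
    using unitary assms unfolding unitary_pair_def by blast
  then show ?thesis by (simp add: colligation_ip_def)
qed

lemma V_smult:
  assumes x: "x \<in> carrier H"
  shows "V (c \<odot> x, c * u) = (c \<odot> fst (V (x, u)), c * snd (V (x, u)))"
proof (rule prod_eqI)
  show "fst (V (c \<odot> x, c * u)) = fst (c \<odot> fst (V (x, u)), c * snd (V (x, u)))"
  proof (rule ip_eqI)
    fix w assume w: "w \<in> carrier H"
    show "ip H (fst (V (c \<odot> x, c * u))) w = ip H (fst (c \<odot> fst (V (x, u)), c * snd (V (x, u)))) w"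
      using V_adjoint[of "c \<odot> x" w "c * u" 0] V_adjoint[of x w u 0] x w by (simp add: ip_smult_left algebra_simps)
  qed (use x in auto)
  show "snd (V (c \<odot> x, c * u)) = snd (c \<odot> fst (V (x, u)), c * snd (V (x, u)))"
    using V_adjoint[of "c \<odot> x" "\<zero>" "c * u" 1] V_adjoint[of x "\<zero>" u 1] x
    by (simp add: ip_smult_left ip_zero_right algebra_simps)
qed

text \<open>
  The state \<open>f\<close> solves \<open>f = a (\<zeta> f) + b\<close> and \<open>S z = c (\<zeta> f) + d\<close> for the blocks \<open>a\<close>, \<open>b\<close>, \<open>c\<close>, \<open>d\<close> of \<open>V\<close>. So \<open>S\<close>
  is the usual transfer function \<open>d + \<zeta> c (1 - \<zeta> a)\<^sup>-\<^sup>1 b\<close>, stated without the inverse.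
\<close>

definition transfer :: "(complex \<Rightarrow> complex) \<Rightarrow> bool" where
  "transfer S \<longleftrightarrow> (\<forall>z \<in> upper_half_plane. \<exists>f \<in> carrier H. V (cayley_point z \<odot> f, 1) = (f, S z))"

end

definition realizes :: "'a ip_space \<Rightarrow> ('a \<times> complex \<Rightarrow> 'a \<times> complex) \<Rightarrow>
    ('a \<times> complex \<Rightarrow> 'a \<times> complex) \<Rightarrow> (complex \<Rightarrow> complex) \<Rightarrow> bool" where
  "realizes H V Vi S \<longleftrightarrow> colligation H V Vi \<and> colligation.transfer H V S"

lemma realizes_uminus:
  assumes "realizes H V Vi S"
  obtains V' Vi' where "realizes H V' Vi' (\<lambda>z. - S z)"
proof -
  interpret colligation H V Vi using assms by (simp add: realizes_def)
  define V' where "V' p = (fst (V p), - snd (V p))" for p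
  define Vi' where "Vi' p = Vi (fst p, - snd p)" for p
  have "colligation H V' Vi'"
  proof
    show "unitary_pair (carrier H \<times> UNIV) (colligation_ip H) V' Vi'"
      unfolding unitary_pair_def
    proof (intro conjI ballI)
      fix p q assume p: "p \<in> carrier H \<times> (UNIV :: complex set)" and q: "q \<in> carrier H \<times> (UNIV :: complex set)"
      show "colligation_ip H (V' p) q = colligation_ip H p (Vi' q)"
        using V_adjoint[of "fst p" "fst q" "snd p" "- snd q"] p q
        by (simp add: colligation_ip_def V'_def Vi'_def mem_Times_iff)
    qed (auto simp: V'_def Vi'_def mem_Times_iff Vi_V V_Vi)
    fix x u v assume x: "x \<in> carrier H" "V' (x, u) = (x, v)"
    then have "V (x, u) = (x, - v)" by (auto simp: V'_def prod_eq_iff)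
    then show "x = \<zero>\<^bsub>H\<^esub>" by (rule no_fixed_state[OF x(1)])
  qed
  then interpret C: colligation H V' Vi' .
  have tr: "transfer S" using assms by (simp add: realizes_def)
  have "C.transfer (\<lambda>z. - S z)"
    unfolding C.transfer_def
  proof
    fix z assume "z \<in> upper_half_plane"
    then obtain f where "f \<in> carrier H" "V (cayley_point z \<odot>\<^bsub>H\<^esub> f, 1) = (f, S z)"
      using tr unfolding transfer_def by blast
    then show "\<exists>f \<in> carrier H. V' (cayley_point z \<odot>\<^bsub>H\<^esub> f, 1) = (f, - S z)"
      by (intro bexI[of _ f]) (simp_all add: V'_def)
  qed
  then have "realizes H V' Vi' (\<lambda>z. - S z)"
    unfolding realizes_def using C.colligation_axioms by simp
  then show thesis by (rule that)
qed

text \<open>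
  In the cascade the output of the second colligation is the input of the first. Its states are the
  pairs of states, and unitarity, the absence of stationary states and the product formula for the
  transfer functions follow componentwise.
\<close>

lemma realizes_mult:
  assumes R1: "realizes H1 V1 Vi1 S1" and R2: "realizes H2 V2 Vi2 S2" and e: "inj e"
  obtains V Vi where "realizes (hilbert_sum e H1 H2) V Vi (\<lambda>z. S1 z * S2 z)"
proof -
  interpret C1: colligation H1 V1 Vi1 using R1 by (simp add: realizes_def)
  interpret C2: colligation H2 V2 Vi2 using R2 by (simp add: realizes_def)
  interpret hilbert_pair H1 H2 e by unfold_locales (rule e)
  define V where "V p = (case the_inv e (fst p) of (x, y) \<Rightarrow>
      (e (fst (V1 (x, snd (V2 (y, snd p)))), fst (V2 (y, snd p))), snd (V1 (x, snd (V2 (y, snd p))))))" for p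
  define Vi where "Vi p = (case the_inv e (fst p) of (x, y) \<Rightarrow>
      (e (fst (Vi1 (x, snd p)), fst (Vi2 (y, snd (Vi1 (x, snd p))))), snd (Vi2 (y, snd (Vi1 (x, snd p))))))" for p
  have V: "V (e (x, y), u) = (e (fst (V1 (x, snd (V2 (y, u)))), fst (V2 (y, u))), snd (V1 (x, snd (V2 (y, u)))))" for x y u
    by (simp add: V_def the_inv_f_f[OF inj_e])
  have Vi: "Vi (e (x, y), u) = (e (fst (Vi1 (x, u)), fst (Vi2 (y, snd (Vi1 (x, u))))), snd (Vi2 (y, snd (Vi1 (x, u)))))" for x y u
    by (simp add: Vi_def the_inv_f_f[OF inj_e])
  have "colligation HS V Vi"
  proof
    show "unitary_pair (carrier HS \<times> UNIV) (colligation_ip HS) V Vi"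
      unfolding unitary_pair_def
    proof (intro conjI ballI)
      fix p assume "p \<in> carrier HS \<times> (UNIV :: complex set)"
      then obtain x y u where p: "x \<in> carrier H1" "y \<in> carrier H2" "p = (e (x, y), u)"
        by (cases p) (auto elim!: sum_cases)
      show "V p \<in> carrier HS \<times> UNIV" "Vi p \<in> carrier HS \<times> UNIV" using p by (auto simp: V Vi)
      show "Vi (V p) = p" "V (Vi p) = p"
        using p by (simp_all add: V Vi C1.Vi_V C2.Vi_V C1.V_Vi C2.V_Vi)
      fix q assume "q \<in> carrier HS \<times> (UNIV :: complex set)"
      then obtain x' y' v where q: "x' \<in> carrier H1" "y' \<in> carrier H2" "q = (e (x', y'), v)"
        by (cases q) (auto elim!: sum_cases)
      show "colligation_ip HS (V p) q = colligation_ip HS p (Vi q)"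
        using arg_cong2[of _ _ _ _ "(+)", OF C1.V_adjoint[OF p(1) q(1), of "snd (V2 (y, u))" v]
          C2.V_adjoint[OF p(2) q(2), of u "snd (Vi1 (x', v))"]]
        by (simp add: p q V Vi colligation_ip_def sum_simps algebra_simps)
    qed
    fix h u v assume h: "h \<in> carrier HS" "V (h, u) = (h, v)"
    obtain x y where xy: "x \<in> carrier H1" "y \<in> carrier H2" "h = e (x, y)" using h(1) by (rule sum_cases)
    have fx: "fst (V1 (x, snd (V2 (y, u)))) = x" and fy: "fst (V2 (y, u)) = y"
      using h(2) xy by (simp_all add: V)
    have "V2 (y, u) = (y, snd (V2 (y, u)))" using fy by (simp add: prod_eq_iff)
    then have y: "y = \<zero>\<^bsub>H2\<^esub>" by (rule C2.no_fixed_state[OF xy(2)])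
    have "V1 (x, snd (V2 (y, u))) = (x, snd (V1 (x, snd (V2 (y, u)))))" using fx by (simp add: prod_eq_iff)
    then have "x = \<zero>\<^bsub>H1\<^esub>" by (rule C1.no_fixed_state[OF xy(1)])
    then show "h = \<zero>\<^bsub>HS\<^esub>" using y xy by (simp add: sum_simps)
  qed
  then interpret C: colligation HS V Vi .
  have tr: "C1.transfer S1" "C2.transfer S2" using R1 R2 by (simp_all add: realizes_def)
  have "C.transfer (\<lambda>z. S1 z * S2 z)"
    unfolding C.transfer_def
  proof
    fix z assume z: "z \<in> upper_half_plane"
    let ?\<zeta> = "cayley_point z"
    obtain f1 where f1: "f1 \<in> carrier H1" "V1 (?\<zeta> \<odot>\<^bsub>H1\<^esub> f1, 1) = (f1, S1 z)"
      using tr(1) z unfolding C1.transfer_def by blast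
    obtain f2 where f2: "f2 \<in> carrier H2" "V2 (?\<zeta> \<odot>\<^bsub>H2\<^esub> f2, 1) = (f2, S2 z)"
      using tr(2) z unfolding C2.transfer_def by blast
    let ?f = "e (S2 z \<odot>\<^bsub>H1\<^esub> f1, f2)"
    have "V1 (S2 z \<odot>\<^bsub>H1\<^esub> (?\<zeta> \<odot>\<^bsub>H1\<^esub> f1), S2 z * 1) = (S2 z \<odot>\<^bsub>H1\<^esub> f1, S2 z * S1 z)"
      using C1.V_smult[of "?\<zeta> \<odot>\<^bsub>H1\<^esub> f1" "S2 z" 1] f1 by simp
    then have "V1 (?\<zeta> \<odot>\<^bsub>H1\<^esub> (S2 z \<odot>\<^bsub>H1\<^esub> f1), S2 z) = (S2 z \<odot>\<^bsub>H1\<^esub> f1, S2 z * S1 z)"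
      using f1(1) by (simp add: C1.smult_smult mult.commute)
    then have "V (?\<zeta> \<odot>\<^bsub>HS\<^esub> ?f, 1) = (?f, S1 z * S2 z)"
      using f1(1) f2 by (simp add: sum_simps V mult.commute)
    then show "\<exists>f \<in> carrier HS. V (?\<zeta> \<odot>\<^bsub>HS\<^esub> f, 1) = (f, S1 z * S2 z)"
      using f1(1) f2(1) by (intro bexI[of _ ?f]) simp_all
  qed
  then have "realizes HS V Vi (\<lambda>z. S1 z * S2 z)"
    unfolding realizes_def using C.colligation_axioms by simp
  then show thesis by (rule that)
qed

section \<open>Characteristic functions as transfer functions\<close>

text \<open>
  The transfer function of the colligation built from a model is computed from \<open>f = b k\<^sub>\<zeta>\<close>; the scalar
  \<open>b\<close> and the output come out as follows, for \<open>p\<close> the value of the Caratheodory function.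
\<close>

lemma moebius_output:
  fixes p \<kappa> b r :: complex
  assumes p: "p \<noteq> 0" and D: "p - cnj \<kappa> * (p - 1) \<noteq> 0"
    and b: "b * (p - cnj \<kappa> * (p - 1)) = r" and r: "r * r = 1 - \<kappa> * cnj \<kappa>"
  shows "\<kappa> - r * (b * (p - 1)) = moebius \<kappa> (1 - 1 / p)"
proof -
  let ?D = "p - cnj \<kappa> * (p - 1)"
  have b': "b = r / ?D" using b D by (simp add: field_simps)
  have "(\<kappa> - r * (b * (p - 1))) * ?D = \<kappa> * ?D - r * (b * ?D) * (p - 1)"
    by (simp add: algebra_simps)
  also have "\<dots> = \<kappa> * ?D - (1 - \<kappa> * cnj \<kappa>) * (p - 1)"
    unfolding b r ..
  also have "\<dots> = \<kappa> * p - (p - 1)" by (simp add: algebra_simps)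
  finally have 1: "\<kappa> - r * (b * (p - 1)) = (\<kappa> * p - (p - 1)) / ?D"
    using D by (simp add: eq_divide_eq)
  have "(1 - 1 / p) - \<kappa> = - (\<kappa> * p - (p - 1)) / p" using p by (simp add: field_simps)
  moreover have "cnj \<kappa> * (1 - 1 / p) - 1 = - ?D / p" using p by (simp add: field_simps)
  moreover have "(- x / p) / (- y / p) = x / y" for x y using p by simp
  ultimately show ?thesis
    unfolding 1 moebius_def by (simp only:)
qed

context unitary_model
begin

lemma moebius_denominator:
  assumes \<zeta>: "cmod \<zeta> < 1" and \<kappa>: "cmod \<kappa> < 1"
  shows "pfun \<zeta> - cnj \<kappa> * (pfun \<zeta> - 1) \<noteq> 0"
proof
  assume "pfun \<zeta> - cnj \<kappa> * (pfun \<zeta> - 1) = 0"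
  then have "cmod (pfun \<zeta>) = cmod \<kappa> * cmod (pfun \<zeta> - 1)"
    using norm_mult[of "cnj \<kappa>" "pfun \<zeta> - 1"] by simp
  also have "\<dots> \<le> 1 * cmod (pfun \<zeta> - 1)"
    using \<kappa> by (intro mult_right_mono) auto
  finally have "(cmod (pfun \<zeta>))\<^sup>2 \<le> (cmod (pfun \<zeta> - 1))\<^sup>2"
    by (intro power_mono) auto
  then show False
    using Re_pfun_gt[OF \<zeta>] unfolding cmod_power2 by (simp add: power2_eq_square algebra_simps)
qed

text \<open>
  From a model to a colligation: the operator \<open>U*\<close> maps \<open>gm\<close> to \<open>gp\<close>. This connection is cut, and the two
  open ends together with the input and the output are joined by a unitary \<open>2 \<times> 2\<close> matrix whose
  entry from input to output is \<open>\<kappa>\<close>.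
\<close>

lemma realizes_characteristic:
  assumes \<kappa>: "cmod \<kappa> < 1"
    and S: "\<And>z. z \<in> upper_half_plane \<Longrightarrow> S z = moebius \<kappa> (1 - 1 / pfun (cayley_point z))"
  obtains V Vi where "realizes H V Vi S"
proof -
  define r where "r = complex_of_real (sqrt (1 - (cmod \<kappa>)\<^sup>2))"
  have "(cmod \<kappa>)\<^sup>2 \<le> 1" using \<kappa> by (simp add: abs_square_le_1)
  then have "r * r = of_real (1 - (cmod \<kappa>)\<^sup>2)"
    by (simp add: r_def flip: of_real_mult)
  then have rr: "r * r = 1 - \<kappa> * cnj \<kappa>"
    by (simp only: of_real_diff of_real_1 complex_norm_square)
  have rc: "cnj r = r" by (simp add: r_def)
  (* The ports (x, gm), u of the input and (x', gp), y of the output are joined by the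
     unitary matrix with rows (cnj \<kappa>, r) and (- r, \<kappa>). *)
  define V where "V q = (let a = ip H (fst q) gm in
      (Ui (fst q) \<oplus> (cnj \<kappa> * a + r * snd q - a) \<odot> gp, - r * a + \<kappa> * snd q))" for q
  define Vi where "Vi q = (let c = ip H (fst q) gp in
      (U (fst q) \<oplus> (\<kappa> * c - r * snd q - c) \<odot> gm, r * c + cnj \<kappa> * snd q))" for q
  have V: "V (x, u) = (Ui x \<oplus> (cnj \<kappa> * ip H x gm + r * u - ip H x gm) \<odot> gp, - r * ip H x gm + \<kappa> * u)" for x u
    by (simp add: V_def Let_def)
  have Vi: "Vi (x, u) = (U x \<oplus> (\<kappa> * ip H x gp - r * u - ip H x gp) \<odot> gm, r * ip H x gp + cnj \<kappa> * u)" for x u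
    by (simp add: Vi_def Let_def)
  have "colligation H V Vi"
  proof
    show "unitary_pair (carrier H \<times> UNIV) (colligation_ip H) V Vi"
      unfolding unitary_pair_def
    proof (intro conjI ballI)
      fix q assume "q \<in> carrier H \<times> (UNIV :: complex set)"
      then obtain x u where q: "x \<in> carrier H" "q = (x, u)" by auto
      show "V q \<in> carrier H \<times> UNIV" "Vi q \<in> carrier H \<times> UNIV" using q by (auto simp: V Vi)
      show "Vi (V q) = q"
      proof -
        define a where "a = ip H x gm"
        define \<alpha> where "\<alpha> = cnj \<kappa> * a + r * u"
        define y where "y = - r * a + \<kappa> * u"
        define x' where "x' = Ui x \<oplus> (\<alpha> - a) \<odot> gp"
        have Vq: "V q = (x', y)" by (simp add: q(2) V x'_def y_def \<alpha>_def a_def)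
        have x'c: "x' \<in> carrier H" using q(1) by (simp add: x'_def)
        have \<alpha>': "ip H x' gp = \<alpha>" using q(1) by (simp add: x'_def ip_simps ip_unitary a_def)
        have "\<kappa> * \<alpha> - r * y = (\<kappa> * cnj \<kappa> + r * r) * a" "r * \<alpha> + cnj \<kappa> * y = (\<kappa> * cnj \<kappa> + r * r) * u"
          by (simp_all add: \<alpha>_def y_def algebra_simps)
        then have ay: "\<kappa> * \<alpha> - r * y = a" "r * \<alpha> + cnj \<kappa> * y = u" by (simp_all add: rr)
        have "U x' \<oplus> (a - \<alpha>) \<odot> gm = x"
        proof (rule ip_eqI)
          fix w assume w: "w \<in> carrier H"
          have "ip H gm w = ip H gp (Ui w)" using ip_U_left[of gp w] w by simp
          then show "ip H (U x' \<oplus> (a - \<alpha>) \<odot> gm) w = ip H x w"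
            using q(1) w by (simp add: x'_def ip_simps ip_unitary algebra_simps)
        qed (use x'c q(1) in auto)
        then show ?thesis unfolding Vq Vi \<alpha>' by (simp add: ay q(2))
      qed
      show "V (Vi q) = q"
      proof -
        define c where "c = ip H x gp"
        define a where "a = \<kappa> * c - r * u"
        define y where "y = r * c + cnj \<kappa> * u"
        define x' where "x' = U x \<oplus> (a - c) \<odot> gm"
        have Vq: "Vi q = (x', y)" by (simp add: q(2) Vi x'_def y_def a_def c_def)
        have x'c: "x' \<in> carrier H" using q(1) by (simp add: x'_def)
        have a': "ip H x' gm = a" using q(1) by (simp add: x'_def ip_simps ip_unitary c_def)
        have "cnj \<kappa> * a + r * y = (\<kappa> * cnj \<kappa> + r * r) * c" "- r * a + \<kappa> * y = (\<kappa> * cnj \<kappa> + r * r) * u"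
          by (simp_all add: a_def y_def algebra_simps)
        then have ay: "cnj \<kappa> * a + r * y = c" "- r * a + \<kappa> * y = u" by (simp_all add: rr)
        have "Ui x' \<oplus> (c - a) \<odot> gp = x"
        proof (rule ip_eqI)
          fix w assume w: "w \<in> carrier H"
          have "ip H gm (U w) = ip H gp w" using ip_U_left[of gp "U w"] w by simp
          then show "ip H (Ui x' \<oplus> (c - a) \<odot> gp) w = ip H x w"
            using q(1) w by (simp add: x'_def ip_simps ip_unitary algebra_simps)
        qed (use x'c q(1) in auto)
        then show ?thesis unfolding Vq V a' ay by (simp add: q(2))
      qed
      fix q' assume "q' \<in> carrier H \<times> (UNIV :: complex set)"
      then obtain x' u' where q': "x' \<in> carrier H" "q' = (x', u')" by auto
      have "ip H gp x' = cnj (ip H x' gp)" using ip_commute[of gp x'] q' by simp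
      then show "colligation_ip H (V q) q' = colligation_ip H q (Vi q')"
        using q q' by (simp add: V Vi colligation_ip_def ip_simps ip_unitary rc algebra_simps)
    qed
    fix x u v assume x: "x \<in> carrier H" "V (x, u) = (x, v)"
    define c where "c = cnj \<kappa> * ip H x gm + r * u - ip H x gm"
    have e: "Ui x \<oplus> c \<odot> gp = x" using x(2) by (simp add: V c_def)
    have "ip H (Ui x) w + c * ip H gp w = ip H x w" if w: "w \<in> carrier H" for w
    proof -
      have "ip H (Ui x \<oplus> c \<odot> gp) w = ip H (Ui x) w + c * ip H gp w"
        using x(1) w by (simp add: ip_add_left ip_smult_left)
      then show ?thesis unfolding e by simp
    qed
    then have "Ui x \<ominus> x = (- c) \<odot> gp"
      using x(1) by (intro ip_eqI) (auto simp: ip_minus_left ip_smult_left algebra_simps)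
    then show "x = \<zero>" by (rule no_fixed[OF x(1)])
  qed
  then interpret C: colligation H V Vi .
  have "C.transfer S"
    unfolding C.transfer_def
  proof
    fix z assume z: "z \<in> upper_half_plane"
    let ?\<zeta> = "cayley_point z"
    have \<zeta>: "cmod ?\<zeta> < 1" using z by (simp add: upper_half_plane_def cayley_point_less_1)
    define p where "p = pfun ?\<zeta>"
    have D: "p - cnj \<kappa> * (p - 1) \<noteq> 0" unfolding p_def by (rule moebius_denominator[OF \<zeta> \<kappa>])
    define b where "b = r / (p - cnj \<kappa> * (p - 1))"
    have b: "b * (p - cnj \<kappa> * (p - 1)) = r" using D by (simp add: b_def)
    let ?f = "b \<odot> kvec ?\<zeta>"
    note k = kvec(1)[OF \<zeta>]
    have "ip H (?\<zeta> \<odot> ?f) gm = b * (?\<zeta> * ip H (kvec ?\<zeta>) gm)"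
      using k by (simp add: ip_smult_left)
    then have a: "ip H (?\<zeta> \<odot> ?f) gm = b * (p - 1)"
      using pfun_eq[OF \<zeta>] by (simp add: p_def)
    have "cnj \<kappa> * (b * (p - 1)) + r * 1 - b * (p - 1) = b"
      unfolding b[symmetric] by (simp add: algebra_simps)
    then have "V (?\<zeta> \<odot> ?f, 1) = (Ui (?\<zeta> \<odot> ?f) \<oplus> b \<odot> gp, \<kappa> - r * (b * (p - 1)))"
      unfolding V a by simp
    also have "Ui (?\<zeta> \<odot> ?f) \<oplus> b \<odot> gp = ?f"
      using k ip_kvec[OF \<zeta>] by (intro ip_eqI) (auto simp: ip_simps ip_unitary algebra_simps)
    also have "\<kappa> - r * (b * (p - 1)) = S z"
      unfolding S[OF z] p_def[symmetric]
      by (rule moebius_output[OF _ D b rr]) (simp add: p_def pfun_nonzero[OF \<zeta>])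
    finally show "\<exists>f \<in> carrier H. V (?\<zeta> \<odot> f, 1) = (f, S z)"
      using k by (intro bexI[of _ ?f]) auto
  qed
  then have "realizes H V Vi S" unfolding realizes_def using C.colligation_axioms by simp
  then show thesis by (rule that)
qed

end

lemma i_in_upper_half_plane: "\<i> \<in> upper_half_plane"
  by (simp add: upper_half_plane_def)

lemma cayley_point_i: "cayley_point \<i> = 0"
  by (simp add: cayley_point_def)

text \<open>
  From a colligation back to a model: \<open>gp\<close> and \<open>- gm\<close> are the normalized responses of \<open>V\<close> and of its
  inverse to the input \<open>1\<close> in the zero state. Feeding a suitable multiple of \<open>(x, gm)\<close> into the input
  turns \<open>V\<close> into an operator of the state space alone that maps \<open>gm\<close> to \<open>gp\<close>; it is the \<open>U*\<close> from which the
  previous construction produces \<open>V\<close>.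
\<close>

lemma (in colligation) transfer_unitary_model:
  assumes tr: "transfer S" and S_i: "cmod (S \<i>) < 1"
  shows "\<exists>U Ui gp gm. unitary_model H U Ui gp gm \<and> (\<forall>z \<in> upper_half_plane. S z =
      moebius (S \<i>) (1 - 1 / unitary_model.pfun H Ui gp (cayley_point z)))"
proof -
  define \<kappa> where "\<kappa> = S \<i>"
  have \<kappa>: "cmod \<kappa> < 1" using S_i by (simp add: \<kappa>_def)
  define r where "r = complex_of_real (sqrt (1 - (cmod \<kappa>)\<^sup>2))"
  have k1: "(cmod \<kappa>)\<^sup>2 < 1" using \<kappa> by (simp add: abs_square_less_1)
  then have r0: "r \<noteq> 0" by (simp add: r_def)
  have "r * r = of_real (1 - (cmod \<kappa>)\<^sup>2)"
    using k1 by (simp add: r_def flip: of_real_mult)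
  then have rr: "r * r = 1 - \<kappa> * cnj \<kappa>"
    by (simp only: of_real_diff of_real_1 complex_norm_square)
  have rc: "cnj r = r" by (simp add: r_def)
  define b where "b = fst (V (\<zero>, 1))"
  define c where "c = fst (Vi (\<zero>, 1))"
  have bc: "b \<in> carrier H" "c \<in> carrier H" by (simp_all add: b_def c_def)
  obtain f where "f \<in> carrier H" "V (cayley_point \<i> \<odot> f, 1) = (f, S \<i>)"
    using tr i_in_upper_half_plane unfolding transfer_def by blast
  then have snd_V0: "snd (V (\<zero>, 1)) = \<kappa>" by (simp add: cayley_point_i \<kappa>_def)
  have V0: "V (\<zero>, 1) = (b, \<kappa>)" by (simp add: b_def snd_V0[symmetric])
  have snd_Vi0: "snd (Vi (\<zero>, 1)) = cnj \<kappa>"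
    using V_adjoint[of "\<zero>" "\<zero>" 1 1] by (simp add: snd_V0 ip_zero_left ip_zero_right)
  have Vi0: "Vi (\<zero>, 1) = (c, cnj \<kappa>)" by (simp add: c_def snd_Vi0[symmetric])
  have Vib: "Vi (b, \<kappa>) = (\<zero>, 1)" using Vi_V[of "\<zero>" 1] by (simp add: V0)
  have Vc: "V (c, cnj \<kappa>) = (\<zero>, 1)" using V_Vi[of "\<zero>" 1] by (simp add: Vi0)
  have ip_bb: "ip H b b = r * r"
    using V_adjoint[of "\<zero>" b 1 \<kappa>] bc by (simp add: V0 Vib ip_zero_left rr eq_diff_eq)
  have ip_cc: "ip H c c = r * r"
    using V_adjoint[of c "\<zero>" "cnj \<kappa>" 1] bc by (simp add: Vi0 Vc ip_zero_right rr eq_diff_eq mult.commute)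
  define gp gm where "gp = (1 / r) \<odot> b" and "gm = (- (1 / r)) \<odot> c"
  have gc: "gp \<in> carrier H" "gm \<in> carrier H" using bc by (auto simp: gp_def gm_def)
  have ip_gp: "ip H gp gp = 1" and ip_gm: "ip H gm gm = 1"
    using bc r0 by (simp_all add: gp_def gm_def ip_simps ip_bb ip_cc rc)
  have b_gp: "b = r \<odot> gp" and c_gm: "c = (- r) \<odot> gm"
    using bc r0 by (simp_all add: gp_def gm_def smult_smult)
  (* how the ports of the input determine those of the output *)
  have V_snd: "snd (V (x, u)) = - r * ip H x gm + \<kappa> * u" if x: "x \<in> carrier H" for x u
  proof -
    have "ip H x c = - r * ip H x gm" unfolding c_gm using x gc by (simp add: ip_smult_right rc)
    then show ?thesis
      using V_adjoint[of x "\<zero>" u 1] x by (simp add: Vi0 ip_zero_right)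
  qed
  have V_gp: "ip H (fst (V (x, u))) gp = cnj \<kappa> * ip H x gm + r * u" if x: "x \<in> carrier H" for x u
  proof -
    have "ip H (fst (V (x, u))) b + snd (V (x, u)) * cnj \<kappa> = u"
      using V_adjoint[of x b u \<kappa>] x bc by (simp add: Vib ip_zero_right)
    moreover have "ip H (fst (V (x, u))) b = r * ip H (fst (V (x, u))) gp"
      unfolding b_gp using x gc by (simp add: ip_smult_right rc)
    ultimately have "r * ip H (fst (V (x, u))) gp = u - (- r * ip H x gm + \<kappa> * u) * cnj \<kappa>"
      by (simp add: V_snd[OF x] algebra_simps)
    also have "\<dots> = r * (cnj \<kappa> * ip H x gm) + (1 - \<kappa> * cnj \<kappa>) * u"
      by (simp add: algebra_simps)
    also have "\<dots> = r * (cnj \<kappa> * ip H x gm + r * u)"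
      unfolding rr[symmetric] by (simp add: algebra_simps)
    finally show ?thesis using r0 by simp
  qed
  have Vi_snd: "snd (Vi (y, w)) = r * ip H y gp + cnj \<kappa> * w" if y: "y \<in> carrier H" for y w
  proof -
    have "ip H b y = r * ip H gp y" unfolding b_gp using y gc by (simp add: ip_smult_left)
    then have "r * ip H gp y + \<kappa> * cnj w = cnj (snd (Vi (y, w)))"
      using V_adjoint[of "\<zero>" y 1 w] y by (simp add: V0 ip_zero_left)
    then have "snd (Vi (y, w)) = cnj (r * ip H gp y + \<kappa> * cnj w)" by simp
    then show ?thesis using ip_commute[of y gp] y gc by (simp add: rc)
  qed
  have Vi_gm: "ip H (fst (Vi (y, w))) gm = \<kappa> * ip H y gp - r * w" if y: "y \<in> carrier H" for y w
  proof -
    have "cnj w = ip H c (fst (Vi (y, w))) + cnj \<kappa> * cnj (snd (Vi (y, w)))"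
      using V_adjoint[of c y "cnj \<kappa>" w] y bc by (simp add: Vc ip_zero_left)
    then have "w = cnj (ip H c (fst (Vi (y, w))) + cnj \<kappa> * cnj (snd (Vi (y, w))))"
      by (metis complex_cnj_cnj)
    then have "w = ip H (fst (Vi (y, w))) c + \<kappa> * snd (Vi (y, w))"
      using ip_commute[of "fst (Vi (y, w))" c] y bc by simp
    moreover have "ip H (fst (Vi (y, w))) c = - r * ip H (fst (Vi (y, w))) gm"
      unfolding c_gm using y gc by (simp add: ip_smult_right rc)
    ultimately have "r * ip H (fst (Vi (y, w))) gm = \<kappa> * (r * ip H y gp + cnj \<kappa> * w) - w"
      by (simp add: Vi_snd[OF y] algebra_simps)
    also have "\<dots> = r * (\<kappa> * ip H y gp) - (1 - \<kappa> * cnj \<kappa>) * w"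
      by (simp add: algebra_simps)
    also have "\<dots> = r * (\<kappa> * ip H y gp - r * w)"
      unfolding rr[symmetric] by (simp add: algebra_simps)
    finally show ?thesis using r0 by simp
  qed
  (* The feedback inputs that make the ports (x, gm) and (x', gp) agree. *)
  define un where "un x = (1 - cnj \<kappa>) * ip H x gm / r" for x
  define wn where "wn y = - (1 - \<kappa>) * ip H y gp / r" for y
  define Ui where "Ui x = fst (V (x, un x))" for x
  define U where "U y = fst (Vi (y, wn y))" for y
  have V_un: "V (x, un x) = (Ui x, wn (Ui x))" and Ui_gp: "ip H (Ui x) gp = ip H x gm"
    if x: "x \<in> carrier H" for x
  proof -
    show g: "ip H (Ui x) gp = ip H x gm"
      unfolding Ui_def V_gp[OF x] un_def using r0 by (simp add: field_simps)
    have "snd (V (x, un x)) * r = - (r * r) * ip H x gm + \<kappa> * (1 - cnj \<kappa>) * ip H x gm"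
      unfolding V_snd[OF x] un_def using r0 by (simp add: algebra_simps)
    also have "\<dots> = - (1 - \<kappa>) * ip H x gm" unfolding rr by (simp add: algebra_simps)
    finally have "snd (V (x, un x)) = wn (Ui x)"
      unfolding wn_def g using r0 by (simp add: eq_divide_eq)
    then show "V (x, un x) = (Ui x, wn (Ui x))" by (simp add: Ui_def prod_eq_iff)
  qed
  have Vi_wn: "Vi (y, wn y) = (U y, un (U y))" and U_gm: "ip H (U y) gm = ip H y gp"
    if y: "y \<in> carrier H" for y
  proof -
    show g: "ip H (U y) gm = ip H y gp"
      unfolding U_def Vi_gm[OF y] wn_def using r0 by (simp add: field_simps)
    have "snd (Vi (y, wn y)) * r = (r * r) * ip H y gp - cnj \<kappa> * (1 - \<kappa>) * ip H y gp"
      unfolding Vi_snd[OF y] wn_def using r0 by (simp add: algebra_simps)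
    also have "\<dots> = (1 - cnj \<kappa>) * ip H y gp" unfolding rr by (simp add: algebra_simps)
    finally have "snd (Vi (y, wn y)) = un (U y)"
      unfolding un_def g using r0 by (simp add: eq_divide_eq)
    then show "Vi (y, wn y) = (U y, un (U y))" by (simp add: U_def prod_eq_iff)
  qed
  have UiU_c: "Ui x \<in> carrier H" "U x \<in> carrier H" if "x \<in> carrier H" for x
    using that by (simp_all add: Ui_def U_def)
  have UUi: "U (Ui x) = x" if x: "x \<in> carrier H" for x
    using Vi_V[OF x, of "un x"] by (simp add: V_un[OF x] Vi_wn[OF UiU_c(1)[OF x]])
  have UiU: "Ui (U y) = y" if y: "y \<in> carrier H" for y
    using V_Vi[OF y, of "wn y"] by (simp add: Vi_wn[OF y] V_un[OF UiU_c(2)[OF y]])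
  have adj: "ip H (Ui x) y = ip H x (U y)" if x: "x \<in> carrier H" and y: "y \<in> carrier H" for x y
  proof -
    have "ip H (Ui x) y + wn (Ui x) * cnj (wn y) = ip H x (U y) + un x * cnj (un (U y))"
      using V_adjoint[OF x y, of "un x" "wn y"] by (simp add: V_un[OF x] Vi_wn[OF y])
    moreover have "wn (Ui x) * cnj (wn y) = un x * cnj (un (U y))"
      using r0 by (simp add: wn_def un_def Ui_gp[OF x] U_gm[OF y] rc field_simps)
    ultimately show ?thesis by simp
  qed
  have V_input: "fst (V (x, u)) = Ui x \<oplus> ((u - un x) * r) \<odot> gp" if x: "x \<in> carrier H" for x u
  proof (rule ip_eqI)
    fix w assume w: "w \<in> carrier H"
    have bw: "ip H b w = cnj (snd (Vi (w, 0)))"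
      using V_adjoint[of "\<zero>" w 1 0] w by (simp add: V0 ip_zero_left)
    have "ip H (fst (V (x, u))) w = ip H (Ui x) w + (u - un x) * ip H b w"
      unfolding bw Ui_def
      using V_adjoint[OF x w, of u 0] V_adjoint[OF x w, of "un x" 0] by (simp add: algebra_simps)
    then show "ip H (fst (V (x, u))) w = ip H (Ui x \<oplus> ((u - un x) * r) \<odot> gp) w"
      unfolding b_gp using UiU_c[OF x] gc w by (simp add: ip_add_left ip_smult_left)
  qed (use x UiU_c[OF x] gc in auto)
  have up: "unitary_pair (carrier H) (ip H) U Ui"
    unfolding unitary_pair_def
  proof (intro conjI ballI)
    fix x y assume x: "x \<in> carrier H" and y: "y \<in> carrier H"
    show "ip H (U x) y = ip H x (Ui y)"
      using adj[OF y x] ip_commute[of "U x" y] ip_commute[of x "Ui y"] x y UiU_c by simp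
  qed (auto simp: UiU_c UUi UiU)
  have U_gp: "gm = U gp"
  proof -
    have "ip H (U gp) (U gp) = ip H gp gp"
      using adj[of "U gp" gp] UiU gc UiU_c by simp
    moreover have "ip H (U gp) gm = 1" using U_gm[OF gc(1)] ip_gp by simp
    moreover have "ip H gm (U gp) = 1"
      using ip_commute[of gm "U gp"] calculation gc UiU_c by simp
    ultimately have "ip H (gm \<ominus> U gp) (gm \<ominus> U gp) = 0"
      using gc UiU_c[OF gc(1)] ip_gp ip_gm by (simp add: ip_simps)
    then have "gm \<ominus> U gp = \<zero>" using gc UiU_c by (intro ip_definite) auto
    then show ?thesis by (rule minus_eq_zeroD[OF _ gc(2) UiU_c(2)[OF gc(1)]])
  qed
  have "unitary_model H U Ui gp gm"
  proof
    show "unitary_pair (carrier H) (ip H) U Ui" by (rule up)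
    show "gp \<in> carrier H" "gm = U gp" "ip H gp gp = 1" by (fact gc U_gp ip_gp)+
    fix h d assume h: "h \<in> carrier H" and d: "Ui h \<ominus> h = d \<odot> gp"
    define u where "u = un h - d / r"
    have "fst (V (h, u)) = Ui h \<oplus> (- d) \<odot> gp"
      unfolding V_input[OF h] using r0 by (simp add: u_def)
    also have "\<dots> = h"
    proof (rule ip_eqI)
      fix w assume w: "w \<in> carrier H"
      have "ip H (Ui h \<ominus> h) w = d * ip H gp w" unfolding d using gc w by (simp add: ip_smult_left)
      then show "ip H (Ui h \<oplus> (- d) \<odot> gp) w = ip H h w"
        using h gc UiU_c[OF h] w by (simp add: ip_add_left ip_minus_left ip_smult_left algebra_simps)
    qed (use h gc UiU_c[OF h] in auto)
    finally have "V (h, u) = (h, snd (V (h, u)))" by (simp add: prod_eq_iff)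
    then show "h = \<zero>" by (rule no_fixed_state[OF h])
  qed
  then interpret M: unitary_model H U Ui gp gm .
  have "S z = moebius \<kappa> (1 - 1 / M.pfun (cayley_point z))"
    if z: "z \<in> upper_half_plane" for z
  proof -
    let ?\<zeta> = "cayley_point z"
    have \<zeta>: "cmod ?\<zeta> < 1" using z by (simp add: upper_half_plane_def cayley_point_less_1)
    obtain f where f: "f \<in> carrier H" "V (?\<zeta> \<odot> f, 1) = (f, S z)"
      using tr z unfolding transfer_def by blast
    define d where "d = (1 - un (?\<zeta> \<odot> f)) * r"
    have \<zeta>f: "?\<zeta> \<odot> f \<in> carrier H" using f(1) by simp
    have f_eq: "f = Ui (?\<zeta> \<odot> f) \<oplus> d \<odot> gp"
      using V_input[OF \<zeta>f, of 1] f(2) by (simp add: d_def)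
    have "f \<ominus> ?\<zeta> \<odot> Ui f = d \<odot> gp"
    proof (rule ip_eqI)
      fix w assume w: "w \<in> carrier H"
      have "ip H f w = ip H (Ui (?\<zeta> \<odot> f) \<oplus> d \<odot> gp) w" using f_eq by simp
      then show "ip H (f \<ominus> ?\<zeta> \<odot> Ui f) w = ip H (d \<odot> gp) w"
        using f(1) w by (simp add: ip_simps M.ip_unitary)
    qed (use f(1) in auto)
    then have fd: "f = d \<odot> M.kvec ?\<zeta>" by (rule M.kvec_unique[OF \<zeta> f(1)])
    define p where "p = M.pfun ?\<zeta>"
    have a: "ip H (?\<zeta> \<odot> f) gm = d * (p - 1)"
      unfolding p_def M.pfun_eq[OF \<zeta>] fd using M.kvec(1)[OF \<zeta>] by (simp add: ip_smult_left)
    have "d = r - un (?\<zeta> \<odot> f) * r" by (simp add: d_def left_diff_distrib)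
    also have "un (?\<zeta> \<odot> f) * r = (1 - cnj \<kappa>) * (d * (p - 1))"
      unfolding un_def a using r0 by simp
    finally have "d = r - (1 - cnj \<kappa>) * (d * (p - 1))" .
    then have dD: "d * (p - cnj \<kappa> * (p - 1)) = r" by (simp add: algebra_simps)
    have D: "p - cnj \<kappa> * (p - 1) \<noteq> 0" unfolding p_def by (rule M.moebius_denominator[OF \<zeta> \<kappa>])
    have "S z = \<kappa> - r * (d * (p - 1))"
      using V_snd[OF \<zeta>f, of 1] f(2) a by simp
    also have "\<dots> = moebius \<kappa> (1 - 1 / p)"
      by (rule moebius_output[OF _ D dD rr]) (simp add: p_def M.pfun_nonzero[OF \<zeta>])
    finally show ?thesis unfolding p_def .
  qed
  then show ?thesis
    unfolding \<kappa>_def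
    by (intro exI[of _ U] exI[of _ Ui] exI[of _ gp] exI[of _ gm] conjI ballI M.unitary_model_axioms)
qed

section \<open>Products of characteristic and Livsic functions\<close>

lemma characteristic_class_iff_realizes:
  "S \<in> characteristic_class TYPE('a) \<longleftrightarrow> (\<exists>(H :: 'a ip_space) V Vi. realizes H V Vi S) \<and> cmod (S \<i>) < 1"
proof
  assume "S \<in> characteristic_class TYPE('a)"
  then obtain H :: "'a ip_space" and U Ui gp gm \<kappa> where M: "unitary_model H U Ui gp gm" and \<kappa>: "cmod \<kappa> < 1"
    and ex: "\<forall>z \<in> upper_half_plane. S z = moebius \<kappa> (1 - 1 / unitary_model.pfun H Ui gp (cayley_point z))"
    unfolding characteristic_class_iff by blast
  interpret unitary_model H U Ui gp gm by (rule M)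
  have S: "S z = moebius \<kappa> (1 - 1 / pfun (cayley_point z))"
    if "z \<in> upper_half_plane" for z
    using ex that by auto
  obtain V Vi where "realizes H V Vi S" by (rule realizes_characteristic[OF \<kappa> S])
  moreover have "S \<i> = \<kappa>"
    using S[OF i_in_upper_half_plane] by (simp add: cayley_point_i pfun_0 moebius_def)
  ultimately show "(\<exists>(H :: 'a ip_space) V Vi. realizes H V Vi S) \<and> cmod (S \<i>) < 1"
    using \<kappa> by auto
next
  assume "(\<exists>(H :: 'a ip_space) V Vi. realizes H V Vi S) \<and> cmod (S \<i>) < 1"
  then obtain H :: "'a ip_space" and V Vi where "realizes H V Vi S" and S_i: "cmod (S \<i>) < 1" by blast
  then have "colligation H V Vi" and tr: "colligation.transfer H V S" by (simp_all add: realizes_def)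
  then interpret colligation H V Vi by simp
  obtain U Ui gp gm where M: "unitary_model H U Ui gp gm"
    and S: "\<forall>z \<in> upper_half_plane. S z =
      moebius (S \<i>) (1 - 1 / unitary_model.pfun H Ui gp (cayley_point z))"
    using transfer_unitary_model[OF tr S_i] by blast
  show "S \<in> characteristic_class TYPE('a)"
    unfolding characteristic_class_iff
    by (intro exI[of _ H] exI[of _ U] exI[of _ Ui] exI[of _ gp] exI[of _ gm] exI[of _ "S \<i>"])
      (use M S_i S in simp)
qed

lemma characteristic_class_infinite_type:
  assumes "S \<in> characteristic_class TYPE('a)"
  shows "infinite (UNIV :: 'a set)"
proof -
  obtain H :: "'a ip_space" and U Ui gp gm where "unitary_model H U Ui gp gm"
    using assms unfolding characteristic_class_iff by blast
  then show ?thesis by (rule unitary_model.infinite_model_type)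
qed

lemma characteristic_class_mult:
  assumes S1: "S1 \<in> characteristic_class TYPE('a)" and S2: "S2 \<in> characteristic_class TYPE('a)"
  shows "(\<lambda>z. S1 z * S2 z) \<in> characteristic_class TYPE('a)"
proof -
  obtain H1 :: "'a ip_space" and V1 Vi1 where R1: "realizes H1 V1 Vi1 S1" and c1: "cmod (S1 \<i>) < 1"
    using S1 unfolding characteristic_class_iff_realizes by blast
  obtain H2 :: "'a ip_space" and V2 Vi2 where R2: "realizes H2 V2 Vi2 S2" and c2: "cmod (S2 \<i>) < 1"
    using S2 unfolding characteristic_class_iff_realizes by blast
  obtain e :: "'a \<times> 'a \<Rightarrow> 'a" where "inj e"
    using ex_inj_pairs[OF characteristic_class_infinite_type[OF S1]] by blast
  then obtain V Vi where "realizes (hilbert_sum e H1 H2) V Vi (\<lambda>z. S1 z * S2 z)"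
    by (rule realizes_mult[OF R1 R2])
  moreover have "cmod (S1 \<i> * S2 \<i>) < 1"
    using mult_strict_mono'[of "cmod (S1 \<i>)" 1 "cmod (S2 \<i>)" 1] c1 c2 by (simp add: norm_mult)
  ultimately show ?thesis
    unfolding characteristic_class_iff_realizes by blast
qed

lemma characteristic_class_uminus:
  assumes S: "S \<in> characteristic_class TYPE('a)"
  shows "(\<lambda>z. - S z) \<in> characteristic_class TYPE('a)"
proof -
  obtain H :: "'a ip_space" and V Vi where R: "realizes H V Vi S" and c: "cmod (S \<i>) < 1"
    using S unfolding characteristic_class_iff_realizes by blast
  obtain V' Vi' where "realizes H V' Vi' (\<lambda>z. - S z)" using R by (rule realizes_uminus)
  then show ?thesis
    unfolding characteristic_class_iff_realizes using c by auto
qed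

text \<open>
  The Livsic function of a model is \<open>- S\<close> for the characteristic function with \<open>\<kappa> = 0\<close>, and the sign can be
  absorbed. As \<open>s \<i> = 0\<close> for every Livsic function, \<open>S \<i>\<close> is the von Neumann parameter, so that \<open>S \<i> = 0\<close>
  leaves only \<open>\<kappa> = 0\<close>.
\<close>

lemma livsic_class_iff_characteristic:
  "s \<in> livsic_class TYPE('a) \<longleftrightarrow> s \<in> characteristic_class TYPE('a) \<and> s \<i> = 0"
proof
  assume "s \<in> livsic_class TYPE('a)"
  then obtain H :: "'a ip_space" and U Ui gp gm where M: "unitary_model H U Ui gp gm"
    and s: "\<And>z. z \<in> upper_half_plane \<Longrightarrow> s z = 1 - 1 / unitary_model.pfun H Ui gp (cayley_point z)"
    unfolding livsic_class_iff by blast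
  interpret unitary_model H U Ui gp gm by (rule M)
  have "(\<lambda>z. - s z) \<in> characteristic_class TYPE('a)"
    unfolding characteristic_class_iff
    by (intro exI[of _ H] exI[of _ U] exI[of _ Ui] exI[of _ gp] exI[of _ gm] exI[of _ 0])
      (use M s in \<open>simp add: moebius_def\<close>)
  then have "(\<lambda>z. - (- s z)) \<in> characteristic_class TYPE('a)" by (rule characteristic_class_uminus)
  moreover have "s \<i> = 0" using s[OF i_in_upper_half_plane] by (simp add: cayley_point_i pfun_0)
  ultimately show "s \<in> characteristic_class TYPE('a) \<and> s \<i> = 0" by simp
next
  assume s: "s \<in> characteristic_class TYPE('a) \<and> s \<i> = 0"
  then have "(\<lambda>z. - s z) \<in> characteristic_class TYPE('a)" by (intro characteristic_class_uminus) simp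
  then obtain H :: "'a ip_space" and U Ui gp gm \<kappa> where M: "unitary_model H U Ui gp gm"
    and ex: "\<forall>z \<in> upper_half_plane. - s z = moebius \<kappa> (1 - 1 / unitary_model.pfun H Ui gp (cayley_point z))"
    unfolding characteristic_class_iff by blast
  interpret unitary_model H U Ui gp gm by (rule M)
  have "- s \<i> = \<kappa>"
    using ex i_in_upper_half_plane by (simp add: cayley_point_i pfun_0 moebius_def)
  then have \<kappa>: "\<kappa> = 0" using s by simp
  have "s z = 1 - 1 / pfun (cayley_point z)" if "z \<in> upper_half_plane" for z
  proof -
    have "- s z = - (1 - 1 / pfun (cayley_point z))"
      using ex that unfolding \<kappa> by (simp add: moebius_def)
    then show ?thesis by (simp only: neg_equal_iff_equal)
  qed
  then show "s \<in> livsic_class TYPE('a)"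
    unfolding livsic_class_iff using M by blast
qed

theorem theorem6p3:
  fixes MM CC SS :: "(complex \<Rightarrow> complex) set"
  defines "MM \<equiv> weyl_titchmarsh_class TYPE('a)"
    and "CC \<equiv> livsic_class TYPE('a)"
    and "SS \<equiv> characteristic_class TYPE('a)"
  shows "(\<forall>f \<in> MM. \<forall>g \<in> MM. \<forall>t :: real. 0 \<le> t \<and> t \<le> 1 \<longrightarrow>
            (\<lambda>z. of_real t * f z + of_real (1 - t) * g z) \<in> MM) \<and>
         SS * SS \<subseteq> SS \<and>
         (CC \<subseteq> SS \<and> CC * SS = SS * CC \<and> SS * CC \<subseteq> CC) \<and>
         CC * CC \<subseteq> CC"
proof -
  have times: "f * g = (\<lambda>z. f z * g z)" for f g :: "complex \<Rightarrow> complex"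
    by (simp add: fun_eq_iff)
  have 1: "\<forall>f \<in> MM. \<forall>g \<in> MM. \<forall>t :: real. 0 \<le> t \<and> t \<le> 1 \<longrightarrow>
      (\<lambda>z. of_real t * f z + of_real (1 - t) * g z) \<in> MM"
    unfolding MM_def using weyl_titchmarsh_class_convex by blast
  have 2: "f * g \<in> SS" if "f \<in> SS" "g \<in> SS" for f g
    using characteristic_class_mult that unfolding SS_def times by blast
  have CC: "f \<in> CC \<longleftrightarrow> f \<in> SS \<and> f \<i> = 0" for f
    unfolding CC_def SS_def by (rule livsic_class_iff_characteristic)
  have 3: "f * g \<in> CC" if "f \<in> SS" "g \<in> CC" for f g
    using that 2[of f g] unfolding CC by (simp add: times)
  have "SS * SS \<subseteq> SS" "SS * CC \<subseteq> CC" "CC * CC \<subseteq> CC" "CC \<subseteq> SS"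
    using 2 3 CC by (auto elim!: set_times_elim)
  then show ?thesis
    using 1 by (simp add: mult.commute)
qed

end
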